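(* 1) Let $v=2(b_1,\ldots,b_m)$ with $b_i\in\mathbb Z$ be an element of $D_m$ with at least two non-zero coordinates $b_i$ such that $b_1+\ldots+b_m\equiv1\bmod 2$ and $\gcd(b_1,\ldots,b_m)=1$. Then $$\vartheta_{D_m}|_{v^\perp}\in J^{cusp}_{\frac m2,\,v^\perp_{D_m}}(v_\eta^{3m})\qquad\text{and}\qquad\vartheta_{D_m(3)}|_{v^\perp}\in J^{cusp}_{\frac m2,\,v^\perp_{D_m(3)}}(v_\eta^m)$$ are non-zero Jacobi cusp forms of critical weight such that $$\mathrm{Ord}(\vartheta_{D_m}|_{v^\perp})=\frac1{(v,v)}>0,\qquad \mathrm{Ord}(\vartheta_{D_m(3)}|_{v^\perp})=\frac1{3(v,v)}>0,$$ where $(v,v)=4\sum_i b_i^2$ is the Euclidean norm of $v$ in $D_m\subset\mathbb Z^m$. 2) The theta-product $$\vartheta_{A_m}(\tau,z_1,\ldots,z_m)=\vartheta(\tau,z_1)\cdots\vartheta(\tau,z_m)\cdot\vartheta(\tau,z_1+\ldots+z_m)\in J_{\frac{m+1}2,A_m}(v_\eta^{3m+3})$$ is a Jacobi form of critical weight. If $m$ is even, then $\vartheta_{A_m}$ is a Jacobi cusp form and $\mathrm{Ord}(\vartheta_{A_m})=\frac1{4(m+1)}>0$. 3) For the renormalized lattice $A_m(3)$ the Jacobi form $$\vartheta_{A_m(3)}(\tau,z_1,\ldots,z_m)=\vartheta_{3/2}(\tau,z_1)\cdots\vartheta_{3/2}(\tau,z_m)\cdot\vartheta_{3/2}(\tau,z_1+\ldots+z_m)$$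 belongs to $J_{\frac{m+1}2,A_m(3)}(v_\eta^{m+1})$. For even $m$, $\mathrm{Ord}(\vartheta_{A_m(3)})=\frac1{12(m+1)}>0$.
   Context: **Jacobi forms of index one.** Let $L$ be a positive definite even lattice with form $(\cdot,\cdot)$ (extended bilinearly to $L\otimes\mathbb C$) and dual $L^\vee$; $L(3)$ is $L$ with form $3(\cdot,\cdot)$. $v_\eta$ is the multiplier system of the Dedekind eta function: $\eta(\frac{a\tau+b}{c\tau+d})=v_\eta(A)(c\tau+d)^{1/2}\eta(\tau)$. For $k\in\frac12\mathbb Z$, $d\in\mathbb Z$, $J_{k,L}(v_\eta^d)$ is the space of holomorphic $\varphi:\mathbb H\times(L\otimes\mathbb C)\to\mathbb C$ such that $\varphi(\frac{a\tau+b}{c\tau+d},\frac{\mathfrak Z}{c\tau+d})=v_\eta^d(A)(c\tau+d)^ke^{\pi i\frac{c(\mathfrak Z,\mathfrak Z)}{c\tau+d}}\varphi(\tau,\mathfrak Z)$ for all $A=\begin{pmatrix}a&b\\c&d\end{pmatrix}\in\mathrm{SL}_2(\mathbb Z)$ (in $v_\eta^d$ the letter $d$ is the fixed exponent), $\varphi(\tau,\mathfrak Z+x\tau+y)=e^{-\pi i((x,x)\tau+2(x,\mathfrak Z))}\varphi(\tau,\mathfrak Z)$ for $x,y\in L$, and $\varphi=\sum f(n,l)e^{2\pi i(n\tau+(l,\mathfrak Z))}$ with the sum over rational $n\ge0$, $n\equiv\frac d{24}\bmod\mathbb Z$, $l\in L^\vee$, $2n-(l,l)\ge0$. It is a cusp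 form (space $J^{cusp}_{k,L}(v_\eta^d)$) if $f(n,l)\ne0$ only for $2n-(l,l)>0$. $\mathrm{Ord}(\varphi)=\min_{f(n,l)\ne0}(2n-(l,l))$, where the form is that of the lattice of the Jacobi form. The critical weight for $L$ is $\frac{\mathrm{rank}L+1}2$. **Theta functions.** With $q=e^{2\pi i\tau}$, $r=e^{2\pi iz}$: $\vartheta(\tau,z)=\sum_{n\in\mathbb Z}\left(\frac{-4}n\right)q^{n^2/8}r^{n/2}$, where $\left(\frac{-4}n\right)$ is $1,-1,0$ for $n\equiv1\bmod4$, $n\equiv3\bmod4$, $n$ even; $\vartheta_{3/2}(\tau,z)=\eta(\tau)\vartheta(\tau,2z)/\vartheta(\tau,z)$. **Lattices.** $D_m=\{x\in\mathbb Z^m: x_1+\ldots+x_m\in2\mathbb Z\}$ and $A_m=\{x\in\mathbb Z^{m+1}:x_1+\ldots+x_{m+1}=0\}$ with the standard Euclidean form. Points of $A_m\otimes\mathbb C$ are written $(z_1,\ldots,z_m,-(z_1+\ldots+z_m))$, with coordinates $z_1,\ldots,z_m$. $\vartheta_{D_m}(\tau,z_1,\ldots,z_m)=\prod_{i=1}^m\vartheta(\tau,z_i)\in J_{\frac m2,D_m}(v_\eta^{3m})$ and $\vartheta_{D_m(3)}(\tau,z_1,\ldots,z_m)=\prod_{i=1}^m\vartheta_{3/2}(\tau,z_i)\in J_{\frac m2,D_m(3)}(v_\eta^m)$. **Pullback.** $v^\perp_{D_m}$ (resp. $v^\perp_{D_m(3)}$) is the orthogonal complement of $v$ in $D_m$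 (resp. in $D_m(3)$), and $\varphi|_{v^\perp}$ is the restriction of $\varphi(\tau,\mathfrak Z)$ to $\mathfrak Z\in v^\perp\otimes\mathbb C$. *)

theory Defs
  imports "HOL-Complex_Analysis.Complex_Analysis"
begin

section \<open>Even positive definite lattices\<close>

text \<open>
  A lattice is a discrete subgroup of a coordinate space together with a real bilinear form.
  The form is stored separately from the points because \<open>L(3)\<close> has the points of \<open>L\<close>
  but three times its form.
\<close>

record ('n::finite) form_lattice =
  pts :: "(real ^ 'n) set"
  form :: "real ^ 'n \<Rightarrow> real ^ 'n \<Rightarrow> real"

definition even_lattice :: "('n::finite) form_lattice \<Rightarrow> bool" where
  "even_lattice L \<longleftrightarrow>
     0 \<in> pts L \<and> (\<forall>x\<in>pts L. \<forall>y\<in>pts L. x - y \<in> pts L) \<and> discrete (pts L) \<and>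
     bilinear (form L) \<and> (\<forall>x y. form L x y = form L y x) \<and>
     (\<forall>x\<in>span (pts L). x \<noteq> 0 \<longrightarrow> form L x x > 0) \<and>
     (\<forall>x\<in>pts L. \<exists>j::int. form L x x = 2 * of_int j)"

definition dual_lattice :: "('n::finite) form_lattice \<Rightarrow> (real ^ 'n) set" where
  "dual_lattice L = {y \<in> span (pts L). \<forall>x\<in>pts L. form L x y \<in> \<int>}"

text \<open>The real dimension of the span is the rank, since the lattice is discrete.\<close>

definition lattice_rank :: "('n::finite) form_lattice \<Rightarrow> nat" where
  "lattice_rank L = dim (pts L)"

definition critical_weight :: "('n::finite) form_lattice \<Rightarrow> real" where
  "critical_weight L = (real (lattice_rank L) + 1) / 2"

definition rescale :: "real \<Rightarrow> ('n::finite) form_lattice \<Rightarrow> 'n form_lattice" where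
  "rescale t L = L\<lparr>form := \<lambda>x y. t * form L x y\<rparr>"

definition orth_compl :: "('n::finite) form_lattice \<Rightarrow> real ^ 'n \<Rightarrow> 'n form_lattice" where
  "orth_compl L v = L\<lparr>pts := {x \<in> pts L. form L x v = 0}\<rparr>"

definition cvec :: "real ^ 'n \<Rightarrow> complex ^ ('n::finite)" where
  "cvec x = (\<chi> i. complex_of_real (x $ i))"

text \<open>
  \<open>L \<otimes> \<complex>\<close> is realised as the complex span of \<open>L\<close>; the bilinear (not sesquilinear) extension
  of the form is written out in real and imaginary parts.
\<close>

definition complexify :: "('n::finite) form_lattice \<Rightarrow> (complex ^ 'n) set" where
  "complexify L = vec.span (cvec ` pts L)"

definition cform :: "('n::finite) form_lattice \<Rightarrow> complex ^ 'n \<Rightarrow> complex ^ 'n \<Rightarrow> complex" where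
  "cform L Z W =
     (let X = (\<chi> i. Re (Z $ i)); Y = (\<chi> i. Im (Z $ i));
          U = (\<chi> i. Re (W $ i)); V = (\<chi> i. Im (W $ i))
      in Complex (form L X U - form L Y V) (form L X V + form L Y U))"


section \<open>The eta multiplier system\<close>

definition upper_half :: "complex set" where
  "upper_half = {\<tau>. Im \<tau> > 0}"

definition mobius :: "int \<Rightarrow> int \<Rightarrow> int \<Rightarrow> int \<Rightarrow> complex \<Rightarrow> complex" where
  "mobius a b c d \<tau> = (of_int a * \<tau> + of_int b) / (of_int c * \<tau> + of_int d)"

definition dedekind_eta :: "complex \<Rightarrow> complex" where
  "dedekind_eta \<tau> =
     exp (2 * pi * \<i> * \<tau> / 24) * prodinf (\<lambda>n. 1 - exp (2 * pi * \<i> * of_nat (Suc n) * \<tau>))"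

text \<open>
  Square roots and half-integral powers of \<open>c\<tau> + d\<close> are taken with the principal branch
  throughout; \<^const>\<open>csqrt\<close> and \<^const>\<open>powr\<close> are compatible.
\<close>

definition eta_mult :: "int \<Rightarrow> int \<Rightarrow> int \<Rightarrow> int \<Rightarrow> complex" where
  "eta_mult a b c d =
     (THE w. \<forall>\<tau>\<in>upper_half.
        dedekind_eta (mobius a b c d \<tau>) = w * csqrt (of_int c * \<tau> + of_int d) * dedekind_eta \<tau>)"


section \<open>Jacobi forms of index one\<close>

text \<open>
  Functions on \<open>\<H> \<times> (L \<otimes> \<complex>)\<close> are represented by functions on the ambient space whose values
  elsewhere are ignored. Holomorphic means: at every point there is a complex-linear derivative
  along \<open>\<H> \<times> (L \<otimes> \<complex>)\<close>.
\<close>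

definition jacobi_holomorphic ::
    "('n::finite) form_lattice \<Rightarrow> (complex \<Rightarrow> complex ^ 'n \<Rightarrow> complex) \<Rightarrow> bool" where
  "jacobi_holomorphic L \<phi> \<longleftrightarrow>
     (\<forall>p\<in>upper_half \<times> complexify L. \<exists>D.
        ((\<lambda>(\<tau>, Z). \<phi> \<tau> Z) has_derivative D) (at p within upper_half \<times> complexify L) \<and>
        (\<forall>u t Z. D (u * t, u *s Z) = u * D (t, Z)))"

definition fourier_index :: "('n::finite) form_lattice \<Rightarrow> int \<Rightarrow> (real \<times> (real ^ 'n)) set" where
  "fourier_index L N =
     {(n, l). n \<in> \<rat> \<and> n \<ge> 0 \<and> n - of_int N / 24 \<in> \<int> \<and> l \<in> dual_lattice L \<and>
              2 * n - form L l l \<ge> 0}"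

definition has_fourier_expansion ::
    "('n::finite) form_lattice \<Rightarrow> int \<Rightarrow> (complex \<Rightarrow> complex ^ 'n \<Rightarrow> complex) \<Rightarrow>
     (real \<times> (real ^ 'n) \<Rightarrow> complex) \<Rightarrow> bool" where
  "has_fourier_expansion L N \<phi> f \<longleftrightarrow>
     (\<forall>p. p \<notin> fourier_index L N \<longrightarrow> f p = 0) \<and>
     (\<forall>\<tau>\<in>upper_half. \<forall>Z\<in>complexify L.
        ((\<lambda>(n, l). f (n, l) * exp (2 * pi * \<i> * (of_real n * \<tau> + cform L (cvec l) Z)))
          has_sum \<phi> \<tau> Z) (fourier_index L N))"

definition fourier_coeff ::
    "('n::finite) form_lattice \<Rightarrow> int \<Rightarrow> (complex \<Rightarrow> complex ^ 'n \<Rightarrow> complex) \<Rightarrow>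
     real \<times> (real ^ 'n) \<Rightarrow> complex" where
  "fourier_coeff L N \<phi> = (THE f. has_fourier_expansion L N \<phi> f)"

text \<open>
  \<open>jacobi_forms k L N\<close> is the space \<open>J\<^bsub>k,L\<^esub>(v\<^sub>\<eta>\<^sup>N)\<close>, for half-integral \<open>k\<close>. That \<open>L\<close> is an even
  positive definite lattice is part of membership.
\<close>

definition jacobi_forms ::
    "real \<Rightarrow> ('n::finite) form_lattice \<Rightarrow> int \<Rightarrow> (complex \<Rightarrow> complex ^ 'n \<Rightarrow> complex) set" where
  "jacobi_forms k L N = {\<phi>.
     even_lattice L \<and> jacobi_holomorphic L \<phi> \<and>
     (\<forall>a b c d::int. a * d - b * c = 1 \<longrightarrow> (\<forall>\<tau>\<in>upper_half. \<forall>Z\<in>complexify L.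
        \<phi> (mobius a b c d \<tau>) (inverse (of_int c * \<tau> + of_int d) *s Z) =
          eta_mult a b c d powi N * (of_int c * \<tau> + of_int d) powr of_real k *
          exp (pi * \<i> * of_int c * cform L Z Z / (of_int c * \<tau> + of_int d)) * \<phi> \<tau> Z)) \<and>
     (\<forall>x\<in>pts L. \<forall>y\<in>pts L. \<forall>\<tau>\<in>upper_half. \<forall>Z\<in>complexify L.
        \<phi> \<tau> (Z + \<tau> *s cvec x + cvec y) =
          exp (- pi * \<i> * (of_real (form L x x) * \<tau> + 2 * cform L (cvec x) Z)) * \<phi> \<tau> Z) \<and>
     (\<exists>f. has_fourier_expansion L N \<phi> f)}"

definition jacobi_cusp_forms ::
    "real \<Rightarrow> ('n::finite) form_lattice \<Rightarrow> int \<Rightarrow> (complex \<Rightarrow> complex ^ 'n \<Rightarrow> complex) set" where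
  "jacobi_cusp_forms k L N = {\<phi> \<in> jacobi_forms k L N.
     \<forall>n l. fourier_coeff L N \<phi> (n, l) \<noteq> 0 \<longrightarrow> 2 * n - form L l l > 0}"

definition Ord ::
    "('n::finite) form_lattice \<Rightarrow> int \<Rightarrow> (complex \<Rightarrow> complex ^ 'n \<Rightarrow> complex) \<Rightarrow> real" where
  "Ord L N \<phi> = (LEAST r. \<exists>n l. fourier_coeff L N \<phi> (n, l) \<noteq> 0 \<and> r = 2 * n - form L l l)"

definition nonzero_on ::
    "('n::finite) form_lattice \<Rightarrow> (complex \<Rightarrow> complex ^ 'n \<Rightarrow> complex) \<Rightarrow> bool" where
  "nonzero_on L \<phi> \<longleftrightarrow> (\<exists>\<tau>\<in>upper_half. \<exists>Z\<in>complexify L. \<phi> \<tau> Z \<noteq> 0)"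

definition pullback ::
    "(complex \<Rightarrow> complex ^ 'n \<Rightarrow> complex) \<Rightarrow> ('n::finite) form_lattice \<Rightarrow>
     complex \<Rightarrow> complex ^ 'n \<Rightarrow> complex" where
  "pullback \<phi> L = (\<lambda>\<tau>. restrict (\<phi> \<tau>) (complexify L))"


section \<open>Theta functions\<close>

definition kronecker_m4 :: "int \<Rightarrow> complex" where
  "kronecker_m4 n = (if n mod 4 = 1 then 1 else if n mod 4 = 3 then -1 else 0)"

definition jtheta :: "complex \<Rightarrow> complex \<Rightarrow> complex" where
  "jtheta \<tau> z = infsum (\<lambda>n::int. kronecker_m4 n *
     exp (2 * pi * \<i> * \<tau> * (of_int n)\<^sup>2 / 8) * exp (2 * pi * \<i> * z * of_int n / 2)) UNIV"

text \<open>
  The quotient defining \<open>\<theta>\<^bsub>3/2\<^esub>\<close> has removable singularities at the zeros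
  \<open>z \<in> \<int>\<tau> + \<int>\<close> of the denominator, where HOL division would give \<open>0\<close>;
  \<^const>\<open>remove_sings\<close> supplies the holomorphic continuation in \<open>z\<close>.
\<close>

definition jtheta32 :: "complex \<Rightarrow> complex \<Rightarrow> complex" where
  "jtheta32 \<tau> z = remove_sings (\<lambda>w. dedekind_eta \<tau> * jtheta \<tau> (2 * w) / jtheta \<tau> w) z"


section \<open>The lattices \<open>D\<^sub>m\<close> and \<open>A\<^sub>m\<close> and their theta products\<close>

text \<open>
  Here \<open>m = CARD('m)\<close>. The \<open>m + 1\<close> coordinates of the ambient space of \<open>A\<^sub>m\<close> are indexed by
  \<open>'m option\<close>, with \<^const>\<open>None\<close> the index of the last one; the coordinates
  \<open>z\<^sub>1, \<dots>, z\<^sub>m\<close> of a point are the components at \<^const>\<open>Some\<close>.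
\<close>

definition D_lattice :: "('m::finite) form_lattice" where
  "D_lattice = \<lparr>pts = {x. (\<forall>i. x $ i \<in> \<int>) \<and> (\<exists>j::int. (\<Sum>i\<in>UNIV. x $ i) = 2 * of_int j)},
                form = (\<lambda>x y. x \<bullet> y)\<rparr>"

definition A_lattice :: "('m::finite) option form_lattice" where
  "A_lattice = \<lparr>pts = {x. (\<forall>i. x $ i \<in> \<int>) \<and> (\<Sum>i\<in>UNIV. x $ i) = 0},
                form = (\<lambda>x y. x \<bullet> y)\<rparr>"

definition theta_D :: "complex \<Rightarrow> complex ^ ('m::finite) \<Rightarrow> complex" where
  "theta_D \<tau> Z = (\<Prod>i\<in>UNIV. jtheta \<tau> (Z $ i))"

definition theta_D3 :: "complex \<Rightarrow> complex ^ ('m::finite) \<Rightarrow> complex" where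
  "theta_D3 \<tau> Z = (\<Prod>i\<in>UNIV. jtheta32 \<tau> (Z $ i))"

definition theta_A :: "complex \<Rightarrow> complex ^ ('m::finite option) \<Rightarrow> complex" where
  "theta_A \<tau> Z =
     (\<Prod>i\<in>UNIV. jtheta \<tau> (Z $ Some i)) * jtheta \<tau> (\<Sum>i\<in>UNIV. Z $ Some i)"

definition theta_A3 :: "complex \<Rightarrow> complex ^ ('m::finite option) \<Rightarrow> complex" where
  "theta_A3 \<tau> Z =
     (\<Prod>i\<in>UNIV. jtheta32 \<tau> (Z $ Some i)) * jtheta32 \<tau> (\<Sum>i\<in>UNIV. Z $ Some i)"

end

theory Submission
  imports Defs
begin

text \<open>
  All four products are handled at once. The lattice \<open>A\<^sub>m\<close> is the section of \<open>D\<close> in \<open>m + 1\<close> coordinates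
  by the hyperplane orthogonal to \<open>(1, \<dots>, 1)\<close>, and there the last coordinate is minus the sum of the
  others. Since \<open>\<theta>\<close> is odd and \<open>\<theta>\<^bsub>3/2\<^esub>\<close> is even, \<open>\<theta>\<^bsub>A\<^esub>\<close> and \<open>\<theta>\<^bsub>A(3)\<^esub>\<close> are, up to sign, restrictions
  of \<open>\<theta>\<^bsub>D\<^esub>\<close> and \<open>\<theta>\<^bsub>D(3)\<^esub>\<close>, with \<open>b = (1, \<dots>, 1)\<close>; for even \<open>m\<close> this vector satisfies the same
  hypotheses as the vectors \<open>b\<close> of the first part.

  The order is a computation with exponents. Both functions are theta series
  \<open>\<Sum> \<psi>(n) q\<^bsup>n\<^sup>2/8t\<^esup> r\<^bsup>n/2\<^esup>\<close>, with \<open>t = 1\<close> or \<open>t = 3\<close> and \<open>\<psi>\<close> supported on odd numbers. Expanding a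
  product of such series and restricting to \<open>b\<^sup>\<bottom>\<close>, an integer vector \<open>N\<close> contributes the exponent whose
  lattice part is the projection of \<open>N/2t\<close> to \<open>b\<^sup>\<bottom>\<close>, so that its norm \<open>2n - (l,l)\<close> is the squared length
  of what the projection removes, \<open>(N,b)\<^sup>2 / 4t(b,b)\<close>. If all \<open>N\<^sub>i\<close> and the sum of the \<open>b\<^sub>i\<close> are odd then
  \<open>(N,b)\<close> is odd, so the norm is at least \<open>1/4t(b,b)\<close>. The bound is attained if \<open>(N,b) = 1\<close>, and such an
  \<open>N\<close> with entries prime to 6 exists because the \<open>b\<^sub>i\<close> are coprime. The only other vector with the same
  exponent would be the mirror image of \<open>N\<close> in \<open>b\<^sup>\<bottom>\<close>, which is not integral, so nothing cancels
  (\<open>exponent_norm\<close>, \<open>norm_lower_bound\<close>, \<open>minimal_exponent_coeff\<close>). Coefficients may be read off from one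
  expansion because an absolutely convergent Fourier expansion is unique (\<open>fourier_expansion_unique\<close>).

  The transformation laws rest on the Jacobi triple product, which is the limit of a finite q-binomial
  identity. It gives the zeros of \<open>\<theta>\<close>, its derivative \<open>2\<pi>i \<eta>\<^sup>3\<close> at \<open>0\<close>, its product over the half periods
  and the pentagonal number theorem. Two entire functions with the same multipliers under
  \<open>z \<mapsto> z + 1\<close> and \<open>z \<mapsto> z + \<tau>\<close> are proportional if the zeros of one are simple and shared by the other
  (\<open>proportional_if_same_multipliers\<close>, by Liouville's theorem). This yields the modular law of \<open>\<theta>\<close> for
  every matrix at once, with a factor that is a quotient of cubes of \<open>\<eta>\<close>; comparing half periods under
  \<open>\<tau> \<mapsto> -1/\<tau>\<close> turns this into the modular law of \<open>\<eta>\<close> itself. The same principle identifies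
  \<open>\<eta>(\<tau>) \<theta>(\<tau>,2z) / \<theta>(\<tau>,z)\<close> with the theta series of the character modulo 12.
\<close>

section \<open>Exponentials and theta series in one variable\<close>

definition e2pi :: "complex \<Rightarrow> complex" where
  "e2pi w = exp (2 * pi * \<i> * w)"

lemma e2pi_add: "e2pi (a + b) = e2pi a * e2pi b"
  by (simp add: e2pi_def exp_add ring_distribs)

lemma e2pi_minus: "e2pi (- a) = inverse (e2pi a)"
  by (simp add: e2pi_def exp_minus)

lemma e2pi_0 [simp]: "e2pi 0 = 1"
  by (simp add: e2pi_def)

lemma e2pi_nonzero [simp]: "e2pi a \<noteq> 0"
  by (simp add: e2pi_def)

lemma e2pi_power: "e2pi a ^ k = e2pi (of_nat k * a)"
  by (simp add: e2pi_def exp_of_nat_mult[symmetric] mult_ac)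

lemma e2pi_eq_1_iff: "e2pi a = 1 \<longleftrightarrow> (\<exists>n::int. a = of_int n)"
proof -
  have "e2pi a = 1 \<longleftrightarrow> (\<exists>n::int. 2 * pi * \<i> * a = 2 * pi * \<i> * of_int n)"
    unfolding e2pi_def exp_eq_1 by (auto simp: complex_eq_iff)
  then show ?thesis by simp
qed

lemma e2pi_of_int [simp]: "e2pi (of_int n) = 1"
  by (auto simp: e2pi_eq_1_iff)

lemma e2pi_half: "e2pi (1 / 2) = -1"
  by (simp add: e2pi_def exp_pi_i')

lemma e2pi_half_int: "e2pi (of_int n / 2) = (if even n then 1 else -1)"
proof (cases "even n")
  case False
  then obtain k where "n = 2 * k + 1" by (elim oddE)
  then have "of_int n / 2 = of_int k + (1 / 2 :: complex)" by (simp add: field_simps)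
  then show ?thesis using False by (simp only: e2pi_add e2pi_half e2pi_of_int) simp
next
  case True
  then obtain k where "n = 2 * k" by (elim evenE)
  then have "of_int n / 2 = (of_int k :: complex)" by simp
  then show ?thesis using True by (simp only: e2pi_of_int) simp
qed

lemma norm_e2pi: "norm (e2pi a) = exp (- 2 * pi * Im a)"
  by (simp add: e2pi_def norm_exp_eq_Re)

lemma norm_e2pi_less_1: "a \<in> upper_half \<Longrightarrow> norm (e2pi a) < 1"
  by (simp add: norm_e2pi upper_half_def)

definition theta_term :: "real \<Rightarrow> (int \<Rightarrow> complex) \<Rightarrow> complex \<Rightarrow> complex \<Rightarrow> int \<Rightarrow> complex" where
  "theta_term t \<psi> \<tau> z n =
     \<psi> n * e2pi ((of_int n)\<^sup>2 * \<tau> / (8 * of_real t) + of_int n * z / 2)"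

text \<open>
  The normalisation makes \<open>t\<close> the index in \<open>z\<close>: translating \<open>z\<close> by \<open>\<tau>\<close> shifts \<open>n\<close> by \<open>2t\<close>. The function
  \<open>\<theta>\<close> has \<open>t = 1\<close> and the character modulo 4, and \<open>\<theta>\<^bsub>3/2\<^esub>\<close> will turn out to have \<open>t = 3\<close> and the character
  modulo 12.
\<close>

definition theta_series :: "real \<Rightarrow> (int \<Rightarrow> complex) \<Rightarrow> complex \<Rightarrow> complex \<Rightarrow> complex" where
  "theta_series t \<psi> \<tau> z = (\<Sum>\<^sub>\<infinity>n. theta_term t \<psi> \<tau> z n)"

text \<open>
  An exponential bound, rather than boundedness, lets the series of \<open>z\<close>-derivatives, whose coefficients
  are \<open>\<pi>i n \<psi>(n)\<close>, belong to the same class.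
\<close>

definition exp_bounded :: "(int \<Rightarrow> complex) \<Rightarrow> bool" where
  "exp_bounded \<psi> \<longleftrightarrow> (\<exists>K. \<forall>n. norm (\<psi> n) \<le> exp (K * \<bar>of_int n\<bar>))"

lemma summable_on_exp_minus_abs: "(\<lambda>n::int. exp (- \<bar>real_of_int n\<bar>)) summable_on UNIV"
proof -
  have g: "summable (\<lambda>n::nat. exp (- real n))"
  proof -
    have "(\<lambda>n::nat. exp (- real n)) = (\<lambda>n. exp (-1) ^ n)"
      by (auto simp: exp_of_nat_mult[symmetric])
    then show ?thesis by (simp add: summable_geometric)
  qed
  have g': "(\<lambda>n::nat. exp (- real n)) summable_on UNIV"
    using g by (subst summable_on_UNIV_nonneg_real_iff) auto
  have 1: "(\<lambda>n::int. exp (- \<bar>real_of_int n\<bar>)) summable_on range int"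
    using g' by (subst summable_on_reindex) (auto simp: o_def)
  have 2: "(\<lambda>n::int. exp (- \<bar>real_of_int n\<bar>)) summable_on range (\<lambda>n. - int n)"
    using g' by (subst summable_on_reindex) (auto simp: o_def inj_on_def)
  have "range int \<union> range (\<lambda>n. - int n) = UNIV"
  proof safe
    fix n :: int assume "n \<notin> range (\<lambda>n. - int n)"
    then show "n \<in> range int" by (cases n rule: int_cases2) auto
  qed auto
  then show ?thesis using summable_on_union[OF 1 2] by simp
qed

text \<open>
  Completing the square absorbs the linear term and leaves the factor \<open>exp (-\<bar>n\<bar>)\<close>.
\<close>

lemma summable_on_gauss:
  assumes "a > 0"
  shows "(\<lambda>n::int. exp (b * \<bar>real_of_int n\<bar> - a * (real_of_int n)\<^sup>2)) summable_on UNIV"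
proof (rule summable_on_comparison_test)
  show "(\<lambda>n::int. exp ((b + 1)\<^sup>2 / (4 * a)) * exp (- \<bar>real_of_int n\<bar>)) summable_on UNIV"
    by (intro summable_on_cmult_right summable_on_exp_minus_abs)
  show "exp (b * \<bar>real_of_int n\<bar> - a * (real_of_int n)\<^sup>2)
          \<le> exp ((b + 1)\<^sup>2 / (4 * a)) * exp (- \<bar>real_of_int n\<bar>)" for n
  proof -
    have "(b + 1) * x - a * x\<^sup>2 \<le> (b + 1)\<^sup>2 / (4 * a)" for x
    proof -
      have "0 \<le> (2 * a * x - (b + 1))\<^sup>2" by simp
      then show ?thesis using assms by (simp add: field_simps power2_eq_square)
    qed
    from this[of "\<bar>real_of_int n\<bar>"] show ?thesis
      by (simp add: exp_add[symmetric] algebra_simps)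
  qed
qed auto

text \<open>
  A bound that is uniform on \<open>Im \<tau> \<ge> \<delta>\<close>, \<open>\<bar>Im z\<bar> \<le> R\<close>, as needed for the Weierstrass M-test.
\<close>

lemma norm_theta_term_le:
  assumes "t > 0" "\<forall>n. norm (\<psi> n) \<le> exp (K * \<bar>of_int n\<bar>)" "Im \<tau> \<ge> \<delta>" "\<bar>Im z\<bar> \<le> R"
  shows "norm (theta_term t \<psi> \<tau> z n)
           \<le> exp ((K + pi * R) * \<bar>of_int n\<bar> - (pi * \<delta> / (4 * t)) * (of_int n)\<^sup>2)"
proof -
  have "norm (theta_term t \<psi> \<tau> z n) = norm (\<psi> n) *
          exp (- 2 * pi * ((of_int n)\<^sup>2 * Im \<tau> / (8 * t) + of_int n * Im z / 2))"
  proof -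
    have e: "(of_int n)\<^sup>2 * \<tau> / (8 * complex_of_real t) = of_real ((of_int n)\<^sup>2 / (8 * t)) * \<tau>"
      by simp
    show ?thesis
      unfolding theta_term_def norm_mult norm_e2pi e by (simp add: algebra_simps)
  qed
  also have "\<dots> \<le> exp (K * \<bar>of_int n\<bar>) * 
          exp (pi * R * \<bar>of_int n\<bar> - (pi * \<delta> / (4 * t)) * (of_int n)\<^sup>2)"
  proof (intro mult_mono)
    have "- (of_int n * Im z) \<le> \<bar>of_int n * Im z\<bar>" by linarith
    also have "\<dots> \<le> \<bar>of_int n\<bar> * R"
      unfolding abs_mult by (intro mult_left_mono assms) auto
    finally have "- (of_int n * Im z) \<le> \<bar>of_int n\<bar> * R" .
    then have "pi * - (of_int n * Im z) \<le> pi * (\<bar>of_int n\<bar> * R)"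
      by (intro mult_left_mono) auto
    moreover have "(pi * \<delta> / (4 * t)) * (of_int n)\<^sup>2 \<le> (pi * Im \<tau> / (4 * t)) * (of_int n)\<^sup>2"
      using assms by (intro mult_right_mono divide_right_mono mult_left_mono) auto
    ultimately show "exp (- 2 * pi * ((of_int n)\<^sup>2 * Im \<tau> / (8 * t) + of_int n * Im z / 2))
        \<le> exp (pi * R * \<bar>of_int n\<bar> - (pi * \<delta> / (4 * t)) * (of_int n)\<^sup>2)"
      by (simp add: algebra_simps)
  qed (use assms in auto)
  also have "\<dots> = exp ((K + pi * R) * \<bar>of_int n\<bar> - (pi * \<delta> / (4 * t)) * (of_int n)\<^sup>2)"
    by (simp add: exp_add[symmetric] algebra_simps)
  finally show ?thesis .
qed

lemma theta_term_abs_summable: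
  assumes "t > 0" "exp_bounded \<psi>" "\<tau> \<in> upper_half"
  shows "(\<lambda>n. norm (theta_term t \<psi> \<tau> z n)) summable_on UNIV"
proof -
  obtain K where K: "\<forall>n. norm (\<psi> n) \<le> exp (K * \<bar>of_int n\<bar>)"
    using assms by (auto simp: exp_bounded_def)
  have "pi * Im \<tau> / (4 * t) > 0" using assms by (auto simp: upper_half_def)
  from summable_on_gauss[OF this, of "K + pi * \<bar>Im z\<bar>"] show ?thesis
    by (rule summable_on_comparison_test)
       (use norm_theta_term_le[OF assms(1) K order.refl order.refl, of \<tau> z] in auto)
qed

lemma theta_series_has_sum:
  assumes "t > 0" "exp_bounded \<psi>" "\<tau> \<in> upper_half"
  shows "(theta_term t \<psi> \<tau> z has_sum theta_series t \<psi> \<tau> z) UNIV"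
  unfolding theta_series_def
  using abs_summable_summable[OF theta_term_abs_summable[OF assms, of z]] by (rule has_sum_infsum)

lemma theta_series_uniform_limit:
  assumes "t > 0" "exp_bounded \<psi>" "\<delta> > 0"
  shows "uniform_limit {p. Im (fst p) \<ge> \<delta> \<and> \<bar>Im (snd p)\<bar> \<le> R}
           (\<lambda>X p. \<Sum>n\<in>X. theta_term t \<psi> (fst p) (snd p) n)
           (\<lambda>p. theta_series t \<psi> (fst p) (snd p)) (finite_subsets_at_top UNIV)"
proof -
  obtain K where K: "\<forall>n. norm (\<psi> n) \<le> exp (K * \<bar>of_int n\<bar>)"
    using assms by (auto simp: exp_bounded_def)
  have "pi * \<delta> / (4 * t) > 0" using assms by auto
  note M = summable_on_gauss[OF this, of "K + pi * R"]
  show ?thesis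
    unfolding theta_series_def
    using norm_theta_term_le[OF assms(1) K] M by (intro Weierstrass_m_test_general) auto
qed

lemma theta_series_continuous_on:
  assumes "t > 0" "exp_bounded \<psi>"
  shows "continuous_on (upper_half \<times> UNIV) (\<lambda>p. theta_series t \<psi> (fst p) (snd p))"
proof (rule continuous_at_imp_continuous_on, safe)
  fix \<tau> z :: complex assume \<tau>: "\<tau> \<in> upper_half"
  define U where "U = {p. Im (fst p) > Im \<tau> / 2 \<and> \<bar>Im (snd p)\<bar> < \<bar>Im z\<bar> + (1::real)}"
  have op: "open U" unfolding U_def
    by (intro open_Collect_conj open_Collect_less continuous_intros)
  have "uniform_limit U
           (\<lambda>X p. \<Sum>n\<in>X. theta_term t \<psi> (fst p) (snd p) n)
           (\<lambda>p. theta_series t \<psi> (fst p) (snd p)) (finite_subsets_at_top UNIV)"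
    by (rule uniform_limit_on_subset[OF theta_series_uniform_limit[OF assms,
            of "Im \<tau> / 2" "\<bar>Im z\<bar> + 1"]])
       (use \<tau> in \<open>auto simp: U_def upper_half_def\<close>)
  then have "continuous_on U (\<lambda>p. theta_series t \<psi> (fst p) (snd p))"
  proof (rule uniform_limit_theorem[rotated])
    show "\<forall>\<^sub>F X in finite_subsets_at_top UNIV.
       continuous_on U (\<lambda>p. \<Sum>n\<in>X. theta_term t \<psi> (fst p) (snd p) n)"
      unfolding theta_term_def e2pi_def using assms by (intro always_eventually allI continuous_intros) auto
  qed auto
  moreover have "(\<tau>, z) \<in> U" using \<tau> by (auto simp: U_def upper_half_def)
  ultimately show "isCont (\<lambda>p. theta_series t \<psi> (fst p) (snd p)) (\<tau>, z)"
    using op by (simp add: continuous_on_eq_continuous_at)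
qed

lemma exp_bounded_deriv:
  assumes "exp_bounded \<psi>"
  shows "exp_bounded (\<lambda>n. pi * \<i> * of_int n * \<psi> n)"
proof -
  obtain K where K: "\<And>n. norm (\<psi> n) \<le> exp (K * \<bar>of_int n\<bar>)"
    using assms by (auto simp: exp_bounded_def)
  have "norm (pi * \<i> * of_int n * \<psi> n) \<le> exp ((K + pi) * \<bar>of_int n\<bar>)" for n
  proof -
    have "norm (pi * \<i> * of_int n * \<psi> n) = (pi * \<bar>of_int n\<bar>) * norm (\<psi> n)"
      by (simp add: norm_mult)
    also have "\<dots> \<le> exp (pi * \<bar>of_int n\<bar>) * exp (K * \<bar>of_int n\<bar>)"
    proof (intro mult_mono K)
      show "pi * \<bar>of_int n\<bar> \<le> exp (pi * \<bar>of_int n\<bar>)"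
        using exp_ge_add_one_self[of "pi * \<bar>real_of_int n\<bar>"] by linarith
    qed auto
    finally show ?thesis by (simp add: exp_add[symmetric] algebra_simps)
  qed
  then show ?thesis unfolding exp_bounded_def by blast
qed

text \<open>
  Locally uniform limits of holomorphic functions may be differentiated termwise.
\<close>

lemma theta_series_has_field_derivative:
  assumes "t > 0" "exp_bounded \<psi>" "\<tau> \<in> upper_half"
  shows "((\<lambda>z. theta_series t \<psi> \<tau> z) has_field_derivative
           theta_series t (\<lambda>n. pi * \<i> * of_int n * \<psi> n) \<tau> z) (at z)"
proof -
  let ?F = "finite_subsets_at_top (UNIV::int set)"
  have lim: "uniform_limit (ball z r)
           (\<lambda>X w. \<Sum>n\<in>X. theta_term t \<psi> \<tau> w n) (\<lambda>w. theta_series t \<psi> \<tau> w) ?F" for r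
  proof -
    have "uniform_limit ((\<lambda>w. (\<tau>, w)) ` ball z r)
           (\<lambda>X p. \<Sum>n\<in>X. theta_term t \<psi> (fst p) (snd p) n)
           (\<lambda>p. theta_series t \<psi> (fst p) (snd p)) ?F"
    proof (rule uniform_limit_on_subset[OF theta_series_uniform_limit[OF assms(1,2),
            of "Im \<tau>" "\<bar>Im z\<bar> + r"]])
      show "(\<lambda>w. (\<tau>, w)) ` ball z r \<subseteq> {p. Im \<tau> \<le> Im (fst p) \<and> \<bar>Im (snd p)\<bar> \<le> \<bar>Im z\<bar> + r}"
      proof safe
        fix w assume "w \<in> ball z r"
        then have "\<bar>Im z - Im w\<bar> < r"
          using abs_Im_le_cmod[of "z - w"] by (simp add: dist_norm)
        then show "\<bar>Im (snd (\<tau>, w))\<bar> \<le> \<bar>Im z\<bar> + r" by simp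
      qed auto
    qed (use assms in \<open>auto simp: upper_half_def\<close>)
    then show ?thesis by (simp add: uniform_limit_iff)
  qed
  have holo: "(\<lambda>w. \<Sum>n\<in>X. theta_term t \<psi> \<tau> w n) holomorphic_on A" for X A
    unfolding theta_term_def e2pi_def by (intro holomorphic_intros) auto
  have "(\<lambda>w. theta_series t \<psi> \<tau> w) holomorphic_on ball z 1"
  proof (rule holomorphic_uniform_limit)
    show "uniform_limit (cball z 1) (\<lambda>X w. \<Sum>n\<in>X. theta_term t \<psi> \<tau> w n)
            (\<lambda>w. theta_series t \<psi> \<tau> w) ?F"
      by (rule uniform_limit_on_subset[OF lim[of 2]]) auto
  qed (use holo holomorphic_on_imp_continuous_on in \<open>auto intro!: always_eventually\<close>)
  then have der: "((\<lambda>w. theta_series t \<psi> \<tau> w) has_field_derivative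
       deriv (\<lambda>w. theta_series t \<psi> \<tau> w) z) (at z)"
    by (rule holomorphic_derivI) auto
  have dsum: "deriv (\<lambda>w. \<Sum>n\<in>X. theta_term t \<psi> \<tau> w n) z =
          (\<Sum>n\<in>X. theta_term t (\<lambda>n. pi * \<i> * of_int n * \<psi> n) \<tau> z n)" for X
  proof (rule DERIV_imp_deriv)
    show "((\<lambda>w. \<Sum>n\<in>X. theta_term t \<psi> \<tau> w n) has_field_derivative
            (\<Sum>n\<in>X. theta_term t (\<lambda>n. pi * \<i> * of_int n * \<psi> n) \<tau> z n)) (at z)"
      unfolding theta_term_def e2pi_def
      by (intro DERIV_sum) (auto intro!: derivative_eq_intros simp: field_simps)
  qed
  have "((\<lambda>X. (deriv ^^ 1) (\<lambda>w. \<Sum>n\<in>X. theta_term t \<psi> \<tau> w n) z) \<longlongrightarrow>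
           (deriv ^^ 1) (\<lambda>w. theta_series t \<psi> \<tau> w) z) ?F"
    by (rule higher_deriv_complex_uniform_limit[OF lim[of 1]]) (use holo in auto)
  then have "((\<lambda>X. \<Sum>n\<in>X. theta_term t (\<lambda>n. pi * \<i> * of_int n * \<psi> n) \<tau> z n) \<longlongrightarrow>
           deriv (\<lambda>w. theta_series t \<psi> \<tau> w) z) ?F"
    by (simp add: dsum)
  moreover have "((\<lambda>X. \<Sum>n\<in>X. theta_term t (\<lambda>n. pi * \<i> * of_int n * \<psi> n) \<tau> z n) \<longlongrightarrow>
           theta_series t (\<lambda>n. pi * \<i> * of_int n * \<psi> n) \<tau> z) ?F"
    using theta_series_has_sum[OF assms(1) exp_bounded_deriv[OF assms(2)] assms(3), of z]
    unfolding has_sum_def .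
  ultimately have "deriv (\<lambda>w. theta_series t \<psi> \<tau> w) z =
           theta_series t (\<lambda>n. pi * \<i> * of_int n * \<psi> n) \<tau> z"
    by (rule tendsto_unique[rotated]) auto
  then show ?thesis using der by simp
qed

lemma open_upper_half: "open upper_half"
  unfolding upper_half_def by (intro open_Collect_less continuous_intros)

lemma theta_series_holomorphic_tau:
  assumes "t > 0" "exp_bounded \<psi>"
  shows "(\<lambda>\<tau>. theta_series t \<psi> \<tau> z) holomorphic_on upper_half"
proof -
  let ?F = "finite_subsets_at_top (UNIV::int set)"
  have "(\<lambda>\<tau>. theta_series t \<psi> \<tau> z) holomorphic_on ball \<tau> (Im \<tau> / 2)" if "\<tau> \<in> upper_half" for \<tau>
  proof (rule holomorphic_uniform_limit)
    have "uniform_limit ((\<lambda>w. (w, z)) ` cball \<tau> (Im \<tau> / 2))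
           (\<lambda>X p. \<Sum>n\<in>X. theta_term t \<psi> (fst p) (snd p) n)
           (\<lambda>p. theta_series t \<psi> (fst p) (snd p)) ?F"
    proof (rule uniform_limit_on_subset[OF theta_series_uniform_limit[OF assms(1,2),
            of "Im \<tau> / 2" "\<bar>Im z\<bar>"]])
      show "(\<lambda>w. (w, z)) ` cball \<tau> (Im \<tau> / 2) \<subseteq> {p. Im \<tau> / 2 \<le> Im (fst p) \<and> \<bar>Im (snd p)\<bar> \<le> \<bar>Im z\<bar>}"
      proof safe
        fix w assume "w \<in> cball \<tau> (Im \<tau> / 2)"
        then have "\<bar>Im \<tau> - Im w\<bar> \<le> Im \<tau> / 2"
          using abs_Im_le_cmod[of "\<tau> - w"] by (simp add: dist_norm)
        then have "Im \<tau> / 2 \<le> Im w" by linarith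
        then show "Im \<tau> / 2 \<le> Im (fst (w, z))" by simp
      qed auto
    qed (use that in \<open>auto simp: upper_half_def\<close>)
    then show "uniform_limit (cball \<tau> (Im \<tau> / 2)) (\<lambda>X w. \<Sum>n\<in>X. theta_term t \<psi> w z n)
            (\<lambda>w. theta_series t \<psi> w z) ?F" by (simp add: uniform_limit_iff)
    have "(\<lambda>w. \<Sum>n\<in>X. theta_term t \<psi> w z n) holomorphic_on A" for X A
      unfolding theta_term_def e2pi_def using assms by (intro holomorphic_intros) auto
    then show "\<forall>\<^sub>F X in ?F. continuous_on (cball \<tau> (Im \<tau> / 2)) (\<lambda>w. \<Sum>n\<in>X. theta_term t \<psi> w z n) \<and>
       (\<lambda>w. \<Sum>n\<in>X. theta_term t \<psi> w z n) holomorphic_on ball \<tau> (Im \<tau> / 2)"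
      using holomorphic_on_imp_continuous_on by (auto intro!: always_eventually)
  qed auto
  then have "(\<lambda>\<tau>. theta_series t \<psi> \<tau> z) field_differentiable at \<tau>" if "\<tau> \<in> upper_half" for \<tau>
    using that holomorphic_on_imp_differentiable_at[of _ "ball \<tau> (Im \<tau> / 2)" \<tau>]
    by (auto simp: upper_half_def)
  then show ?thesis using field_differentiable_at_within holomorphic_on_def by blast
qed

text \<open>
  Joint differentiability follows from holomorphy in each variable once one of the two partial
  derivatives is jointly continuous; the \<open>z\<close>-derivative is again a theta series.
\<close>

lemma theta_series_has_derivative:
  assumes "t > 0" "exp_bounded \<psi>" "\<tau> \<in> upper_half"
  shows "\<exists>A B. ((\<lambda>(\<tau>, z). theta_series t \<psi> \<tau> z) has_derivative (\<lambda>(s, u). A * s + B * u))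
           (at (\<tau>, z) within upper_half \<times> UNIV)"
proof -
  let ?\<psi>' = "\<lambda>n. pi * \<i> * of_int n * \<psi> n"
  let ?A = "deriv (\<lambda>\<tau>. theta_series t \<psi> \<tau> z) \<tau>"
  define B where "B = (\<lambda>\<tau> z. blinfun_mult_right (theta_series t ?\<psi>' \<tau> z))"
  have "((\<lambda>(\<tau>, z). theta_series t \<psi> \<tau> z) has_derivative
          (\<lambda>(s, u). ?A * s + blinfun_apply (B \<tau> z) u)) (at (\<tau>, z) within upper_half \<times> UNIV)"
  proof (rule has_derivative_partialsI)
    have "((\<lambda>\<tau>. theta_series t \<psi> \<tau> z) has_field_derivative ?A) (at \<tau>)"
      using holomorphic_derivI[OF theta_series_holomorphic_tau[OF assms(1,2)] open_upper_half assms(3)] .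
    then show "((\<lambda>\<tau>. theta_series t \<psi> \<tau> z) has_derivative (*) ?A) (at \<tau> within upper_half)"
      by (metis has_derivative_at_withinI has_field_derivative_def)
    show "((\<lambda>z. theta_series t \<psi> \<tau> z) has_derivative blinfun_apply (B \<tau> z)) (at z within UNIV)"
      if "\<tau> \<in> upper_half" for \<tau> z
      using theta_series_has_field_derivative[OF assms(1,2) that, of z]
      by (simp add: has_field_derivative_def B_def blinfun_mult_right.rep_eq)
    have "continuous_on (upper_half \<times> UNIV) (\<lambda>p. theta_series t ?\<psi>' (fst p) (snd p))"
      by (rule theta_series_continuous_on[OF assms(1) exp_bounded_deriv[OF assms(2)]])
    then have "continuous (at (\<tau>, z) within upper_half \<times> UNIV)
                (\<lambda>p. theta_series t ?\<psi>' (fst p) (snd p))"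
      using assms(3) by (auto simp: continuous_on_eq_continuous_within)
    then have "continuous (at (\<tau>, z) within upper_half \<times> UNIV)
                (\<lambda>p. blinfun_mult_right (theta_series t ?\<psi>' (fst p) (snd p)))"
      by (rule bounded_linear.continuous[OF bounded_linear_blinfun_mult_right])
    then show "continuous (at (\<tau>, z) within upper_half \<times> UNIV) (\<lambda>(\<tau>, z). B \<tau> z)"
      by (simp add: B_def case_prod_unfold)
  qed auto
  then show ?thesis
    by (intro exI[of _ ?A] exI[of _ "theta_series t ?\<psi>' \<tau> z"])
       (simp add: B_def blinfun_mult_right.rep_eq)
qed

section \<open>Infinite products and a finite form of the triple product\<close>

text \<open>
  The finite q-Pochhammer symbol \<open>(q;q)\<^sub>n\<close>.
\<close>

definition qprod :: "complex \<Rightarrow> nat \<Rightarrow> complex" where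
  "qprod q n = (\<Prod>i<n. 1 - q ^ Suc i)"

text \<open>
  The q-Pochhammer symbol \<open>(a;q)\<^sub>\<infinity>\<close>.
\<close>

definition qpoch :: "complex \<Rightarrow> complex \<Rightarrow> complex" where
  "qpoch a q = (\<Prod>i. 1 - a * q ^ i)"

lemma one_minus_power_nonzero: "norm (q::complex) < 1 \<Longrightarrow> 1 - q ^ Suc n \<noteq> 0"
proof
  assume q: "norm q < 1" and "1 - q ^ Suc n = 0"
  then have "norm (q ^ Suc n) = 1" by simp
  moreover have "norm (q ^ Suc n) < 1" proof -
    have "norm q * norm q ^ n \<le> norm q * 1"
      using q by (intro mult_left_mono power_le_one) auto
    then show ?thesis using q by (simp add: norm_mult norm_power)
  qed
  ultimately show False by simp
qed

lemma qprod_nonzero: "norm q < 1 \<Longrightarrow> qprod q n \<noteq> 0"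
  by (auto simp: qprod_def dest: one_minus_power_nonzero)

lemma qprod_Suc: "qprod q (Suc n) = qprod q n * (1 - q ^ Suc n)"
  by (simp add: qprod_def)

lemma qprod_0 [simp]: "qprod q 0 = 1"
  by (simp add: qprod_def)

lemma convergent_prod_qpoch:
  fixes q a :: complex assumes "norm q < 1"
  shows "convergent_prod (\<lambda>i. 1 - a * q ^ i)"
proof (rule abs_convergent_prod_imp_convergent_prod)
  have "summable (\<lambda>i. norm a * norm q ^ i)"
    using assms by (intro summable_mult summable_geometric) auto
  then show "abs_convergent_prod (\<lambda>i. 1 - a * q ^ i)"
    by (intro summable_imp_abs_convergent_prod) (simp add: norm_mult norm_power mult_ac)
qed

lemma qpoch_tendsto:
  assumes "norm q < 1" shows "(\<lambda>n. \<Prod>i<n. 1 - a * q ^ i) \<longlonglongrightarrow> qpoch a q"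
proof -
  have "(\<lambda>n. \<Prod>i\<le>n. 1 - a * q ^ i) \<longlonglongrightarrow> qpoch a q"
    unfolding qpoch_def by (rule convergent_prod_LIMSEQ[OF convergent_prod_qpoch[OF assms]])
  then have "(\<lambda>n. \<Prod>i<Suc n. 1 - a * q ^ i) \<longlonglongrightarrow> qpoch a q"
    by (simp add: lessThan_Suc_atMost)
  then show ?thesis by (rule LIMSEQ_imp_Suc)
qed

lemma qpoch_nonzero:
  assumes "norm q < 1" "\<And>i. a * q ^ i \<noteq> 1" shows "qpoch a q \<noteq> 0"
  unfolding qpoch_def using assms convergent_prod_qpoch by (intro prodinf_nonzero) auto

lemma qpoch_split_head:
  assumes "norm q < 1" shows "qpoch a q = (1 - a) * qpoch (a * q) q"
proof -
  have "(\<lambda>n. \<Prod>i<Suc n. 1 - a * q ^ i) \<longlonglongrightarrow> qpoch a q"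
    by (rule LIMSEQ_Suc[OF qpoch_tendsto[OF assms]])
  moreover have "(\<lambda>n. (1 - a) * (\<Prod>i<n. 1 - (a * q) * q ^ i)) \<longlonglongrightarrow> (1 - a) * qpoch (a * q) q"
    by (intro tendsto_mult tendsto_const qpoch_tendsto assms)
  ultimately show ?thesis
    by (subst (asm) prod.lessThan_Suc_shift) (simp add: mult_ac LIMSEQ_unique)
qed

lemma qpoch_continuous:
  assumes "norm q < 1" shows "continuous_on UNIV (\<lambda>a. qpoch a q)"
proof -
  have "continuous_on (ball 0 R) (\<lambda>a. qpoch a q)" for R
  proof -
    have "uniformly_convergent_on (cball 0 R) (\<lambda>N a. \<Prod>n<N. 1 - a * q ^ n)"
    proof (rule uniformly_convergent_on_prod')
      have "uniformly_convergent_on (cball 0 R) (\<lambda>N a. \<Sum>n<N. norm a * norm q ^ n)"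
      proof (rule Weierstrass_m_test')
        show "norm (norm x * norm q ^ n) \<le> R * norm q ^ n" if "x \<in> cball 0 R" for n x
          using that by (auto simp: norm_mult norm_power intro!: mult_right_mono)
        show "summable (\<lambda>n. R * norm q ^ n)" using assms by (intro summable_mult summable_geometric) auto
      qed
      then show "uniformly_convergent_on (cball 0 R) (\<lambda>N a. \<Sum>n<N. norm (1 - a * q ^ n - 1))"
        by (simp add: norm_mult norm_power)
    qed (auto intro!: continuous_intros)
    then obtain l where l: "uniform_limit (cball 0 R) (\<lambda>N a. \<Prod>n<N. 1 - a * q ^ n) l sequentially"
      by (auto simp: uniformly_convergent_on_def)
    have "l a = qpoch a q" if "a \<in> cball 0 R" for a
      using tendsto_uniform_limitI[OF l that] qpoch_tendsto[OF assms] by (rule LIMSEQ_unique)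
    moreover have "continuous_on (cball 0 R) l"
      by (rule uniform_limit_theorem[OF _ l]) (auto intro!: always_eventually continuous_intros)
    ultimately have "continuous_on (cball 0 R) (\<lambda>a. qpoch a q)"
      by (metis (no_types, lifting) continuous_on_cong)
    then show ?thesis by (rule continuous_on_subset) auto
  qed
  then have "isCont (\<lambda>a. qpoch a q) a" for a
    using continuous_on_interior[of "ball 0 (norm a + 1)" "\<lambda>a. qpoch a q" a] by simp
  then show ?thesis by (simp add: continuous_at_imp_continuous_on)
qed

lemma triangle_Suc: "Suc k * k div 2 = k * (k - 1) div 2 + k"
proof (cases k)
  case (Suc j)
  have "Suc (Suc j) * Suc j = Suc j * j + 2 * Suc j" by (simp add: algebra_simps)
  then show ?thesis using Suc by simp
qed auto

text \<open>
  Cauchy's q-binomial theorem. The coefficients satisfy the q-Pascal rule, which corresponds to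
  splitting off the last factor of the product.
\<close>

lemma q_binomial:
  fixes q x :: complex assumes q: "norm q < 1"
  shows "(\<Prod>k<N. 1 + x * q ^ k) =
     (\<Sum>k\<le>N. q ^ (k * (k - 1) div 2) * (qprod q N / (qprod q k * qprod q (N - k))) * x ^ k)"
proof -
  define c where "c = (\<lambda>N k. if k \<le> N then q ^ (k * (k - 1) div 2) * (qprod q N / (qprod q k * qprod q (N - k))) else 0)"
  have nz [simp]: "qprod q n \<noteq> 0" for n using qprod_nonzero[OF q] .
  have nz' [simp]: "1 - q ^ Suc n \<noteq> 0" "1 - q * q ^ n \<noteq> 0" for n using one_minus_power_nonzero[OF q, of n] by simp_all
  have c0: "c N 0 = 1" for N by (simp add: c_def)
  \<comment> \<open>The q-Pascal rule; the coefficient is 0 outside the range \<open>k \<le> N\<close>.\<close>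
  have rec: "c (Suc N) (Suc k) = c N (Suc k) + q ^ N * c N k" for N k
  proof -
    consider "k > N" | "k = N" | "k < N" by linarith
    then show ?thesis
    proof cases
      case 2
      then show ?thesis using triangle_Suc[of N] by (simp add: c_def power_add)
    next
      case 3
      then obtain d where d: "N = Suc (k + d)" using less_imp_Suc_add by blast
      have 1: "Suc N - Suc k = Suc d" "N - Suc k = d" "N - k = Suc d" using d by auto
      have 2: "q ^ (Suc k * (Suc k - 1) div 2) = q ^ (k * (k - 1) div 2) * q ^ k"
        using triangle_Suc[of k] by (simp add: power_add)
      have 3: "1 - q ^ Suc N = (1 - q ^ Suc d) + q ^ Suc d * (1 - q ^ Suc k)"
        using d by (simp add: algebra_simps power_add)
      have qN: "q ^ N = q ^ k * q ^ Suc d" using d by (simp add: power_add)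
      have le: "Suc k \<le> Suc N" "Suc k \<le> N" "k \<le> N" using d by auto
      define u where "u = 1 - q ^ Suc d"
      define w where "w = 1 - q ^ Suc k"
      have nz2: "u \<noteq> 0" "w \<noteq> 0" using nz'(1) unfolding u_def w_def by blast+
      have L: "c (Suc N) (Suc k) = q ^ (k * (k - 1) div 2) * q ^ k * (qprod q N * (u + q ^ Suc d * w) / ((qprod q k * w) * (qprod q d * u)))"
        unfolding c_def 1 2 qprod_Suc[of q N] 3 using le by (simp only: if_True qprod_Suc u_def w_def)
      have R1: "c N (Suc k) = q ^ (k * (k - 1) div 2) * q ^ k * (qprod q N / ((qprod q k * w) * qprod q d))"
        unfolding c_def 1 2 using le by (simp only: if_True qprod_Suc u_def w_def)
      have R2: "c N k = q ^ (k * (k - 1) div 2) * (qprod q N / (qprod q k * (qprod q d * u)))"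
        unfolding c_def 1 using le by (simp only: if_True qprod_Suc u_def w_def)
      show ?thesis unfolding L R1 R2 qN using nz2 by (simp add: field_simps)
    qed (simp add: c_def)
  qed
  have "(\<Prod>k<N. 1 + x * q ^ k) = (\<Sum>k\<le>N. c N k * x ^ k)"
  proof (induction N)
    case 0
    show ?case by (simp add: c0)
  next
    case (Suc N)
    have "(\<Sum>k\<le>Suc N. c (Suc N) k * x ^ k) = 1 + (\<Sum>k\<le>N. c (Suc N) (Suc k) * x ^ Suc k)"
      by (subst sum.atMost_Suc_shift) (simp add: c0)
    also have "\<dots> = 1 + (\<Sum>k\<le>N. c N (Suc k) * x ^ Suc k) + x * q ^ N * (\<Sum>k\<le>N. c N k * x ^ k)"
      by (simp add: rec sum.distrib algebra_simps sum_distrib_left)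
    also have "1 + (\<Sum>k\<le>N. c N (Suc k) * x ^ Suc k) = (\<Sum>k\<le>Suc N. c N k * x ^ k)"
      by (subst sum.atMost_Suc_shift) (simp add: c0)
    also have "\<dots> = (\<Sum>k\<le>N. c N k * x ^ k)" by (simp add: c_def)
    finally show ?case using Suc by (simp add: algebra_simps)
  qed
  then show ?thesis by (simp add: c_def)
qed


text \<open>
  Dominated convergence for sums over the integers, transported from sums over the naturals.
\<close>

lemma tannery_infsum_int:
  fixes a :: "nat \<Rightarrow> int \<Rightarrow> complex"
  assumes lim: "\<And>i. (\<lambda>n. a n i) \<longlonglongrightarrow> b i" and le: "\<And>n i. norm (a n i) \<le> M i"
    and M: "M summable_on UNIV"
  shows "(\<lambda>n. \<Sum>\<^sub>\<infinity>i. a n i) \<longlonglongrightarrow> (\<Sum>\<^sub>\<infinity>i. b i)"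
proof -
  have M0: "M i \<ge> 0" for i using le[of 0 i] norm_ge_zero order_trans by blast
  have "(\<lambda>k. M (int_decode k)) summable_on UNIV"
    using M by (subst summable_on_reindex_bij_betw[OF bij_int_decode]) auto
  then have sM: "summable (\<lambda>k. M (int_decode k))"
    by (subst (asm) summable_on_UNIV_nonneg_real_iff) (auto simp: M0)
  have eq: "suminf (\<lambda>k. f (int_decode k)) = (\<Sum>\<^sub>\<infinity>i. f i)"
    if "\<And>i. norm (f i) \<le> M i" for f :: "int \<Rightarrow> complex"
  proof -
    have "summable (\<lambda>k. norm (f (int_decode k)))"
      by (rule summable_comparison_test'[OF sM]) (use that in auto)
    then have "((\<lambda>k. f (int_decode k)) has_sum suminf (\<lambda>k. f (int_decode k))) UNIV"
      by (intro norm_summable_imp_has_sum summable_sums) (auto intro: summable_norm_cancel)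
    then have "(f has_sum suminf (\<lambda>k. f (int_decode k))) UNIV"
      by (subst (asm) has_sum_reindex_bij_betw[OF bij_int_decode])
    then show ?thesis by (rule infsumI[symmetric])
  qed
  have "(\<lambda>n. suminf (\<lambda>k. a n (int_decode k))) \<longlonglongrightarrow> suminf (\<lambda>k. b (int_decode k))"
    using tannerys_theorem[of "\<lambda>k n. a n (int_decode k)" "\<lambda>k. b (int_decode k)" sequentially
        "\<lambda>k. M (int_decode k)", OF lim always_eventually sM] le by auto
  moreover have "norm (b i) \<le> M i" for i
    by (rule tendsto_upperbound[OF tendsto_norm[OF lim]]) (use le in auto)
  ultimately show ?thesis using le by (simp add: eq)
qed

lemma sum_nat_shift_int: "(\<Sum>k\<le>2*n. f (int k - int n)) = (\<Sum>i\<in>{-int n..int n}. f i)"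
  by (rule sum.reindex_bij_witness[of _ "\<lambda>i. nat (i + int n)" "\<lambda>k. int k - int n"]) auto


lemma kronecker_m4_odd: "kronecker_m4 (2 * i + 1) = (if even i then 1 else -1)"
proof -
  have "(2 * i + 1) mod 4 = (if even i then 1 else 3)" by presburger
  then show ?thesis by (simp add: kronecker_m4_def)
qed

text \<open>
  The q-binomial theorem with \<open>2n\<close> factors, centred by taking \<open>x = - y q\<^bsup>1-n\<^esup>\<close>: the factors with
  exponents \<open>1, \<dots>, n\<close> give the first product, and in the other \<open>n\<close> factors the negative powers of \<open>q\<close> are
  pulled out. The prefactor completes the square in the exponent, so that the terms are those of \<open>\<theta>\<close>.
\<close>

lemma finite_triple_product:
  fixes \<tau> z :: complex
  assumes "\<tau> \<in> upper_half"
  defines "q \<equiv> e2pi \<tau>" and "y \<equiv> e2pi z"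
  shows "e2pi (\<tau> / 8 + z / 2) * ((\<Prod>j<n. 1 - y * q * q ^ j) * (\<Prod>j<n. 1 - inverse y * q ^ j)) =
    (\<Sum>i\<in>{-int n..int n}. qprod q (2 * n) / (qprod q (nat (int n + i)) * qprod q (nat (int n - i))) *
        theta_term 1 kronecker_m4 \<tau> z (2 * i + 1))"
proof -
  have q: "norm q < 1" using norm_e2pi_less_1[OF assms(1)] by (simp add: q_def)
  define x where "x = - e2pi (z + (1 - of_nat n) * \<tau>)"
  have powq: "q ^ k = e2pi (of_nat k * \<tau>)" for k
    unfolding q_def by (simp add: e2pi_power)
  have sgn: "(-1) ^ n * (-1) ^ k = kronecker_m4 (2 * (int k - int n) + 1)" for k
    unfolding kronecker_m4_odd by (simp add: minus_one_power_iff)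
  have "(\<Prod>k<2*n. 1 + x * q ^ k) = (\<Prod>k<n. 1 + x * q ^ k) * (\<Prod>k\<in>{n..<2*n}. 1 + x * q ^ k)"
    by (subst prod.union_disjoint[symmetric]) (auto intro!: prod.cong)
  also have "(\<Prod>k\<in>{n..<2*n}. 1 + x * q ^ k) = (\<Prod>j<n. 1 - y * q * q ^ j)"
  proof (rule prod.reindex_bij_witness[of _ "\<lambda>j. j + n" "\<lambda>k. k - n"])
    fix k assume "k \<in> {n..<2*n}"
    then obtain j where k: "k = n + j" using le_Suc_ex by auto
    show "1 - y * q * q ^ (k - n) = 1 + x * q ^ k"
    proof -
      have "y * q * q ^ j = e2pi (z + \<tau> + of_nat j * \<tau>)"
        by (simp add: powq e2pi_add y_def) (simp add: q_def)
      also have "z + \<tau> + of_nat j * \<tau> = (z + (1 - of_nat n) * \<tau>) + of_nat (n + j) * \<tau>"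
        by (simp add: algebra_simps)
      finally show ?thesis unfolding k x_def powq by (simp add: e2pi_add)
    qed
  qed auto
  also have "(\<Prod>k<n. 1 + x * q ^ k) = (\<Prod>j<n. 1 - e2pi (z - of_nat j * \<tau>))"
  proof (rule prod.reindex_bij_witness[of _ "\<lambda>j. n - 1 - j" "\<lambda>k. n - 1 - k"])
    fix k assume "k \<in> {..<n}"
    then obtain j where n: "n = Suc (k + j)" using less_imp_Suc_add by blast
    show "1 - e2pi (z - of_nat (n - 1 - k) * \<tau>) = 1 + x * q ^ k"
    proof -
      have "z - of_nat (n - 1 - k) * \<tau> = (z + (1 - of_nat n) * \<tau>) + of_nat k * \<tau>"
        unfolding n by (simp add: algebra_simps)
      then show ?thesis unfolding x_def powq by (simp only: e2pi_add) simp
    qed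
  qed auto
  also have "\<dots> = (\<Prod>j<n. - e2pi (z - of_nat j * \<tau>)) * (\<Prod>j<n. 1 - inverse y * q ^ j)"
    unfolding prod.distrib[symmetric]
  proof (rule prod.cong)
    fix j
    have "e2pi (z - of_nat j * \<tau>) * (inverse y * q ^ j) = 1"
      unfolding powq y_def e2pi_minus[symmetric] e2pi_add[symmetric] by simp
    then show "1 - e2pi (z - of_nat j * \<tau>) = - e2pi (z - of_nat j * \<tau>) * (1 - inverse y * q ^ j)"
      by (simp add: algebra_simps)
  qed auto
  also have "(\<Prod>j<n. - e2pi (z - of_nat j * \<tau>)) =
      (-1) ^ n * e2pi (of_nat n * z - of_nat (n * (n - 1) div 2) * \<tau>)"
  proof (induction n)
    case (Suc n)
    have "of_nat (Suc n * (Suc n - 1) div 2) = (of_nat (n * (n - 1) div 2) + of_nat n :: complex)"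
      using triangle_Suc[of n] by simp
    then have "e2pi (of_nat (Suc n) * z - of_nat (Suc n * (Suc n - 1) div 2) * \<tau>) =
        e2pi (of_nat n * z - of_nat (n * (n - 1) div 2) * \<tau>) * e2pi (z - of_nat n * \<tau>)"
      unfolding e2pi_add[symmetric] by (intro arg_cong[of _ _ e2pi]) (simp only: of_nat_Suc ring_distribs, simp)
    then show ?case using Suc by simp
  qed auto
  finally have A: "(\<Prod>k<2*n. 1 + x * q ^ k) = (-1) ^ n * e2pi (of_nat n * z - of_nat (n * (n - 1) div 2) * \<tau>) *
     ((\<Prod>j<n. 1 - y * q * q ^ j) * (\<Prod>j<n. 1 - inverse y * q ^ j))" by (simp add: mult_ac)
  define u where "u = e2pi (\<tau> / 8 + z / 2) * ((-1) ^ n * e2pi (of_nat (n * (n - 1) div 2) * \<tau> - of_nat n * z))"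
  have "e2pi (\<tau> / 8 + z / 2) * ((\<Prod>j<n. 1 - y * q * q ^ j) * (\<Prod>j<n. 1 - inverse y * q ^ j)) =
        u * (\<Prod>k<2*n. 1 + x * q ^ k)"
  proof -
    have "((-1) ^ n * e2pi (of_nat (n * (n - 1) div 2) * \<tau> - of_nat n * z)) *
          ((-1) ^ n * e2pi (of_nat n * z - of_nat (n * (n - 1) div 2) * \<tau>)) = 1"
    proof -
      have "e2pi (of_nat (n * (n - 1) div 2) * \<tau> - of_nat n * z) *
            e2pi (of_nat n * z - of_nat (n * (n - 1) div 2) * \<tau>) = 1"
        unfolding e2pi_add[symmetric] by simp
      then show ?thesis by (simp add: mult_ac minus_one_power_iff)
    qed
    note * = this
    have "u * (\<Prod>k<2*n. 1 + x * q ^ k) = e2pi (\<tau> / 8 + z / 2) * (((-1) ^ n * e2pi (of_nat (n * (n - 1) div 2) * \<tau> - of_nat n * z)) *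
          ((-1) ^ n * e2pi (of_nat n * z - of_nat (n * (n - 1) div 2) * \<tau>))) *
          ((\<Prod>j<n. 1 - y * q * q ^ j) * (\<Prod>j<n. 1 - inverse y * q ^ j))"
      unfolding A u_def by (simp only: mult_ac)
    then show ?thesis unfolding * by simp
  qed
  also have "\<dots> = (\<Sum>k\<le>2*n. (qprod q (2 * n) / (qprod q k * qprod q (2 * n - k))) *
                   (u * (q ^ (k * (k - 1) div 2) * x ^ k)))"
    unfolding q_binomial[OF q] by (simp add: sum_distrib_left mult_ac)
  also have "\<dots> = (\<Sum>k\<le>2*n. (qprod q (2 * n) / (qprod q (nat (int n + (int k - int n))) * qprod q (nat (int n - (int k - int n))))) *
                   theta_term 1 kronecker_m4 \<tau> z (2 * (int k - int n) + 1))"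
  proof (rule sum.cong, goal_cases)
    case (2 k)
    have tri: "of_nat (j * (j - 1) div 2) = (of_nat j * (of_nat j - 1) / 2 :: complex)" for j :: nat
    proof (induction j)
      case (Suc j)
      then show ?case using triangle_Suc[of j] by (simp add: field_simps del: of_nat_mult)
    qed auto
    have xk: "x ^ k = (-1) ^ k * e2pi (of_nat k * (z + (1 - of_nat n) * \<tau>))"
      unfolding x_def by (subst power_minus) (simp add: e2pi_power)
    have "u * (q ^ (k * (k - 1) div 2) * x ^ k) = ((-1) ^ n * (-1) ^ k) *
       e2pi ((\<tau> / 8 + z / 2) + (of_nat (n * (n - 1) div 2) * \<tau> - of_nat n * z) +
         of_nat (k * (k - 1) div 2) * \<tau> + of_nat k * (z + (1 - of_nat n) * \<tau>))"
      unfolding u_def powq xk e2pi_add by (simp only: mult_ac)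
    also have "(\<tau> / 8 + z / 2) + (of_nat (n * (n - 1) div 2) * \<tau> - of_nat n * z) +
         of_nat (k * (k - 1) div 2) * \<tau> + of_nat k * (z + (1 - of_nat n) * \<tau>) =
         (of_int (2 * (int k - int n) + 1))\<^sup>2 * \<tau> / (8 * of_real 1) + of_int (2 * (int k - int n) + 1) * z / 2"
      unfolding tri by (simp add: field_simps power2_eq_square)
    finally have "u * (q ^ (k * (k - 1) div 2) * x ^ k) = theta_term 1 kronecker_m4 \<tau> z (2 * (int k - int n) + 1)"
      unfolding theta_term_def sgn .
    moreover have "nat (int n + (int k - int n)) = k" "nat (int n - (int k - int n)) = 2 * n - k" using 2 by auto
    ultimately show ?case by (simp only:)
  qed auto
  also have "\<dots> = (\<Sum>i\<in>{-int n..int n}. qprod q (2 * n) / (qprod q (nat (int n + i)) * qprod q (nat (int n - i))) *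
        theta_term 1 kronecker_m4 \<tau> z (2 * i + 1))"
    by (rule sum_nat_shift_int)
  finally show ?thesis .
qed

section \<open>The Jacobi triple product\<close>

lemma exp_bounded_if_le_1: "(\<And>n. norm (\<psi> n) \<le> 1) \<Longrightarrow> exp_bounded \<psi>"
  unfolding exp_bounded_def by (intro exI[of _ 0]) simp

lemma exp_bounded_kronecker_m4: "exp_bounded kronecker_m4"
  by (rule exp_bounded_if_le_1) (simp add: kronecker_m4_def)

lemma jtheta_eq_theta_series: "jtheta \<tau> z = theta_series 1 kronecker_m4 \<tau> z"
  unfolding jtheta_def theta_series_def theta_term_def e2pi_def
  by (simp add: exp_add[symmetric] mult.assoc algebra_simps)

lemma infsum_odd:
  fixes f :: "int \<Rightarrow> complex" assumes "\<And>n. even n \<Longrightarrow> f n = 0"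
  shows "(\<Sum>\<^sub>\<infinity>n. f n) = (\<Sum>\<^sub>\<infinity>i. f (2 * i + 1))"
proof -
  have "(\<Sum>\<^sub>\<infinity>n. f n) = (\<Sum>\<^sub>\<infinity>n\<in>range (\<lambda>i. 2 * i + 1). f n)"
  proof (rule infsum_cong_neutral)
    fix n assume "n \<in> UNIV - range (\<lambda>i::int. 2 * i + 1)"
    then have "even n" by (metis Diff_iff oddE rangeI)
    then show "f n = 0" by (rule assms)
  qed auto
  also have "\<dots> = (\<Sum>\<^sub>\<infinity>i. f (2 * i + 1))"
    by (subst infsum_reindex) (auto simp: o_def inj_on_def)
  finally show ?thesis .
qed

lemma kronecker_m4_even: "even n \<Longrightarrow> kronecker_m4 n = 0"
proof -
  assume "even n"
  then have "n mod 4 \<noteq> 1" "n mod 4 \<noteq> 3" by presburger+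
  then show ?thesis by (simp add: kronecker_m4_def)
qed

lemma qprod_tendsto: "norm q < 1 \<Longrightarrow> qprod q \<longlonglongrightarrow> qpoch q q"
  using qpoch_tendsto[of q q] by (simp add: qprod_def[abs_def])

lemma qpoch_self_nonzero:
  assumes "norm q < 1" shows "qpoch q q \<noteq> 0"
proof (rule qpoch_nonzero[OF assms])
  show "q * q ^ i \<noteq> 1" for i using one_minus_power_nonzero[OF assms, of i] by auto
qed

text \<open>
  The Gaussian binomial coefficients are bounded and tend to \<open>1 / (q;q)\<^sub>\<infinity>\<close>, so the finite identity
  passes to the limit by dominated convergence.
\<close>

theorem jacobi_triple_product:
  assumes \<tau>: "\<tau> \<in> upper_half"
  defines "q \<equiv> e2pi \<tau>"
  shows "jtheta \<tau> z =
    e2pi (\<tau> / 8 + z / 2) * qpoch q q * (qpoch (e2pi z * q) q * qpoch (inverse (e2pi z)) q)"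
proof -
  have q: "norm q < 1" using norm_e2pi_less_1[OF \<tau>] by (simp add: q_def)
  note P = qprod_tendsto[OF q] and P0 = qpoch_self_nonzero[OF q]
  define T where "T = (\<lambda>i::int. theta_term 1 kronecker_m4 \<tau> z (2 * i + 1))"
  define c where "c = (\<lambda>n (i::int). qprod q (2 * n) / (qprod q (nat (int n + i)) * qprod q (nat (int n - i))))"
  define a where "a = (\<lambda>n i. if i \<in> {-int n..int n} then c n i * T i else 0)"
  obtain B where B: "B > 0" "\<And>n. norm (qprod q n) \<le> B"
    using P convergentI convergent_imp_Bseq BseqE by metis
  have "(\<lambda>n. inverse (qprod q n)) \<longlonglongrightarrow> inverse (qpoch q q)"
    by (intro tendsto_inverse P P0)
  then obtain C where C: "C > 0" "\<And>n. norm (inverse (qprod q n)) \<le> C"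
    using convergentI convergent_imp_Bseq BseqE by metis
  have T: "(\<lambda>i. norm (T i)) summable_on UNIV"
  proof -
    have "(\<lambda>n. norm (theta_term 1 kronecker_m4 \<tau> z n)) summable_on range (\<lambda>i. 2 * i + 1)"
      by (rule summable_on_subset_banach[OF theta_term_abs_summable])
         (auto simp: \<tau> exp_bounded_kronecker_m4)
    then show ?thesis
      by (subst (asm) summable_on_reindex) (auto simp: o_def inj_on_def T_def)
  qed
  have lim: "(\<lambda>n. \<Sum>\<^sub>\<infinity>i. a n i) \<longlonglongrightarrow> (\<Sum>\<^sub>\<infinity>i. inverse (qpoch q q) * T i)"
  proof (rule tannery_infsum_int)
    show "(\<lambda>i. B * C * C * norm (T i)) summable_on UNIV"
      by (intro summable_on_cmult_right T)
    show "norm (a n i) \<le> B * C * C * norm (T i)" for n i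
    proof -
      have "norm (c n i) = norm (qprod q (2 * n)) * norm (inverse (qprod q (nat (int n + i)))) *
          norm (inverse (qprod q (nat (int n - i))))"
        by (simp add: c_def norm_mult norm_divide norm_inverse field_simps)
      also have "\<dots> \<le> B * C * C"
        using B C by (intro mult_mono) auto
      finally have "norm (c n i * T i) \<le> B * C * C * norm (T i)"
        unfolding norm_mult by (intro mult_right_mono) auto
      moreover have "0 \<le> B * C * C * norm (T i)" using B(1) C(1) by simp
      ultimately show ?thesis by (simp add: a_def)
    qed
    show "(\<lambda>n. a n i) \<longlonglongrightarrow> inverse (qpoch q q) * T i" for i
    proof -
      have s: "(\<lambda>n. qprod q (f n)) \<longlonglongrightarrow> qpoch q q" if "filterlim f at_top sequentially" for f
        by (rule filterlim_compose[OF P that])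
      have f1: "filterlim (\<lambda>n. nat (int n + i)) at_top sequentially"
        unfolding filterlim_at_top
      proof
        fix Z :: nat
        show "\<forall>\<^sub>F n in sequentially. Z \<le> nat (int n + i)"
          using eventually_ge_at_top[of "Z + nat (- i)"] by eventually_elim linarith
      qed
      have f2: "filterlim (\<lambda>n. nat (int n - i)) at_top sequentially"
        unfolding filterlim_at_top
      proof
        fix Z :: nat
        show "\<forall>\<^sub>F n in sequentially. Z \<le> nat (int n - i)"
          using eventually_ge_at_top[of "Z + nat i"] by eventually_elim linarith
      qed
      have f3: "filterlim (\<lambda>n::nat. 2 * n) at_top sequentially"
        unfolding filterlim_at_top
      proof
        fix Z :: nat
        show "\<forall>\<^sub>F n in sequentially. Z \<le> 2 * n"
          using eventually_ge_at_top[of Z] by eventually_elim linarith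
      qed
      have "(\<lambda>n. c n i * T i) \<longlonglongrightarrow> qpoch q q / (qpoch q q * qpoch q q) * T i"
        unfolding c_def by (intro tendsto_intros s f1 f2 f3) (use P0 in auto)
      also have "qpoch q q / (qpoch q q * qpoch q q) = inverse (qpoch q q)" using P0 by (simp add: field_simps)
      finally have l: "(\<lambda>n. c n i * T i) \<longlonglongrightarrow> inverse (qpoch q q) * T i" .
      have "\<forall>\<^sub>F n in sequentially. c n i * T i = a n i"
        using eventually_ge_at_top[of "nat \<bar>i\<bar>"] by eventually_elim (auto simp: a_def)
      from Lim_transform_eventually[OF l this] show ?thesis .
    qed
  qed
  have "(\<Sum>\<^sub>\<infinity>i. a n i) = e2pi (\<tau> / 8 + z / 2) *
     ((\<Prod>j<n. 1 - e2pi z * q * q ^ j) * (\<Prod>j<n. 1 - inverse (e2pi z) * q ^ j))" for n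
  proof -
    have "(\<Sum>\<^sub>\<infinity>i. a n i) = (\<Sum>\<^sub>\<infinity>i\<in>{-int n..int n}. c n i * T i)"
      by (rule infsum_cong_neutral) (auto simp: a_def)
    also have "\<dots> = (\<Sum>i\<in>{-int n..int n}. c n i * T i)" by simp
    finally show ?thesis
      using finite_triple_product[OF \<tau>, where z=z and n=n] by (simp add: c_def T_def q_def)
  qed
  then have "(\<lambda>n. \<Sum>\<^sub>\<infinity>i. a n i) \<longlonglongrightarrow> e2pi (\<tau> / 8 + z / 2) *
     (qpoch (e2pi z * q) q * qpoch (inverse (e2pi z)) q)"
    by (simp only:) (intro tendsto_intros qpoch_tendsto q)
  from LIMSEQ_unique[OF lim this]
  have "inverse (qpoch q q) * (\<Sum>\<^sub>\<infinity>i. T i) = e2pi (\<tau> / 8 + z / 2) *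
     (qpoch (e2pi z * q) q * qpoch (inverse (e2pi z)) q)"
    by (simp add: infsum_cmult_right')
  moreover have "(\<Sum>\<^sub>\<infinity>i. T i) = jtheta \<tau> z"
    unfolding jtheta_eq_theta_series theta_series_def T_def
    by (rule infsum_odd[symmetric]) (simp add: theta_term_def kronecker_m4_even)
  ultimately show ?thesis using P0 by (simp add: field_simps)
qed

lemma dedekind_eta_eq: "dedekind_eta \<tau> = e2pi (\<tau> / 24) * qpoch (e2pi \<tau>) (e2pi \<tau>)"
proof -
  have "exp (2 * pi * \<i> * of_nat (Suc n) * \<tau>) = e2pi \<tau> * e2pi \<tau> ^ n" for n
    by (simp add: e2pi_power e2pi_add[symmetric]) (simp add: e2pi_def algebra_simps)
  then show ?thesis unfolding dedekind_eta_def qpoch_def by (simp add: e2pi_def)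
qed

lemma dedekind_eta_nonzero: "\<tau> \<in> upper_half \<Longrightarrow> dedekind_eta \<tau> \<noteq> 0"
  by (simp add: dedekind_eta_eq qpoch_self_nonzero norm_e2pi_less_1)

text \<open>
  A convergent product vanishes only if one of its factors does.
\<close>

lemma jtheta_zeroD:
  assumes "\<tau> \<in> upper_half" "jtheta \<tau> z = 0"
  shows "\<exists>a b :: int. z = of_int a + of_int b * \<tau>"
proof -
  define q where "q = e2pi \<tau>"
  have q: "norm q < 1" using norm_e2pi_less_1[OF assms(1)] by (simp add: q_def)
  have "qpoch (e2pi z * q) q = 0 \<or> qpoch (inverse (e2pi z)) q = 0"
    using assms jacobi_triple_product[OF assms(1), of z] qpoch_self_nonzero[OF q] by (auto simp: q_def)
  then consider i where "e2pi z * q * q ^ i = 1" | i where "inverse (e2pi z) * q ^ i = 1"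
    using qpoch_nonzero[OF q] by metis
  then show ?thesis
  proof cases
    case (1 i)
    have "e2pi (z + of_nat (Suc i) * \<tau>) = e2pi z * q * q ^ i"
      by (simp add: q_def e2pi_power e2pi_add ring_distribs)
    then obtain n :: int where "z + of_nat (Suc i) * \<tau> = of_int n" using 1 by (auto simp: e2pi_eq_1_iff)
    then have "z = of_int n + of_int (- int (Suc i)) * \<tau>" by (simp add: algebra_simps)
    then show ?thesis by blast
  next
    case (2 i)
    have "e2pi (- z + of_nat i * \<tau>) = inverse (e2pi z) * q ^ i"
      by (simp only: q_def e2pi_power e2pi_add e2pi_minus)
    then obtain n :: int where "- z + of_nat i * \<tau> = of_int n" using 2 by (auto simp: e2pi_eq_1_iff)
    then have "z = of_int (- n) + of_int (int i) * \<tau>" by (simp add: algebra_simps)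
    then show ?thesis by blast
  qed
qed

text \<open>
  The factor \<open>1 - 1/r\<close> of the product carries the zero at \<open>z = 0\<close>; the remaining factors are continuous
  and at \<open>z = 0\<close> are three copies of \<open>(q;q)\<^sub>\<infinity>\<close>.
\<close>

lemma jtheta_deriv_0:
  assumes \<tau>: "\<tau> \<in> upper_half"
  shows "(jtheta \<tau> has_field_derivative 2 * pi * \<i> * dedekind_eta \<tau> ^ 3) (at 0)"
proof -
  define q where "q = e2pi \<tau>"
  have q: "norm q < 1" using norm_e2pi_less_1[OF \<tau>] by (simp add: q_def)
  define h where "h = (\<lambda>z. e2pi (\<tau> / 8 + z / 2) * qpoch q q * (qpoch (e2pi z * q) q * qpoch (inverse (e2pi z) * q) q))"
  define g where "g = (\<lambda>z. 1 - inverse (e2pi z))"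
  have eq: "jtheta \<tau> z = g z * h z" for z
    unfolding jacobi_triple_product[OF \<tau>] g_def h_def q_def[symmetric]
    by (subst qpoch_split_head[OF q, of "inverse (e2pi z)"]) (simp add: mult_ac)
  have dg: "(g has_field_derivative 2 * pi * \<i>) (at 0)"
    unfolding g_def e2pi_def by (auto intro!: derivative_eq_intros)
  have cq: "isCont (\<lambda>a. qpoch a q) a" for a
    using qpoch_continuous[OF q] continuous_on_eq_continuous_at by blast
  have "isCont h 0"
    unfolding h_def e2pi_def
    by (intro continuous_intros isCont_o2[OF _ cq]) auto
  then have "h \<midarrow>0\<rightarrow> h 0" by (simp add: isCont_def)
  moreover have "((\<lambda>z. (g z - g 0) / (z - 0)) \<midarrow>0\<rightarrow> 2 * pi * \<i>)"
    using dg by (simp only: has_field_derivative_iff)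
  ultimately have "((\<lambda>z. (g z - g 0) / (z - 0) * h z) \<midarrow>0\<rightarrow> 2 * pi * \<i> * h 0)"
    by (intro tendsto_mult)
  moreover have "g 0 = 0" by (simp add: g_def)
  ultimately have "((\<lambda>z. (jtheta \<tau> z - jtheta \<tau> 0) / (z - 0)) \<midarrow>0\<rightarrow> 2 * pi * \<i> * h 0)"
    by (simp add: eq)
  moreover have "h 0 = dedekind_eta \<tau> ^ 3"
    unfolding h_def dedekind_eta_eq power_mult_distrib e2pi_power q_def by (simp add: power3_eq_cube)
  ultimately show ?thesis by (simp only: has_field_derivative_iff)
qed

text \<open>
  Here \<open>s\<^sup>2 = q\<close>. Every power \<open>s\<^sup>k\<close> with \<open>1 \<le> k \<le> 2N\<close> occurs in a factor \<open>1 + s\<^sup>k\<close>, and together with the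
  factors \<open>1 - s\<^sup>k\<close> these multiply to \<open>1 - q\<^sup>k\<close>.
\<close>

lemma half_period_qprod:
  "(\<Prod>i<N. (1 + s ^ (2 * i + 2)) * (1 - (s::complex) ^ (2 * i + 1)) * (1 + s ^ (2 * i + 1))) * qprod (s\<^sup>2) N = qprod (s\<^sup>2) (2 * N)"
proof (induction N)
  case (Suc N)
  define u where "u = s ^ (2 * N)"
  have p: "s ^ (2 * N + 2) = u * s\<^sup>2" "s ^ (2 * N + 1) = u * s" "(s\<^sup>2) ^ Suc N = u * s\<^sup>2"
    "(s\<^sup>2) ^ Suc (2 * N) = u\<^sup>2 * s\<^sup>2" "(s\<^sup>2) ^ Suc (Suc (2 * N)) = u\<^sup>2 * s ^ 4"
    by (simp_all add: u_def power_add power_mult power2_eq_square power_mult_distrib algebra_simps eval_nat_numeral)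
  have "qprod (s\<^sup>2) (2 * Suc N) = qprod (s\<^sup>2) (2 * N) * (1 - u\<^sup>2 * s\<^sup>2) * (1 - u\<^sup>2 * s ^ 4)"
  proof -
    have "2 * Suc N = Suc (Suc (2 * N))" by simp
    then show ?thesis unfolding p[symmetric] by (simp only: qprod_Suc)
  qed
  also have "\<dots> = (\<Prod>i<N. (1 + s ^ (2 * i + 2)) * (1 - s ^ (2 * i + 1)) * (1 + s ^ (2 * i + 1))) * qprod (s\<^sup>2) N
                  * ((1 - u\<^sup>2 * s\<^sup>2) * (1 - u\<^sup>2 * s ^ 4))"
    by (subst Suc[symmetric]) simp
  also have "(1 - u\<^sup>2 * s\<^sup>2) * (1 - u\<^sup>2 * s ^ 4) = (1 + u * s\<^sup>2) * (1 - u * s) * (1 + u * s) * (1 - u * s\<^sup>2)"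
    by (simp add: algebra_simps eval_nat_numeral)
  finally show ?case
    unfolding prod.lessThan_Suc qprod_Suc p by (simp only: mult_ac)
qed simp

text \<open>
  Letting \<open>N\<close> tend to infinity in the preceding identity, both sides contain the same nonzero factor
  \<open>(q;q)\<^sub>\<infinity>\<close>.
\<close>

lemma half_period_qpoch:
  assumes "norm s < 1"
  shows "qpoch (- (s\<^sup>2)) (s\<^sup>2) * qpoch s (s\<^sup>2) * qpoch (- s) (s\<^sup>2) = 1"
proof -
  have q: "norm (s\<^sup>2) < 1" using assms by (simp add: norm_power power_less_one_iff abs_square_less_1)
  note P = qprod_tendsto[OF q] and P0 = qpoch_self_nonzero[OF q]
  have "(\<lambda>N. (\<Prod>i<N. 1 - (- (s\<^sup>2)) * (s\<^sup>2) ^ i) * (\<Prod>i<N. 1 - s * (s\<^sup>2) ^ i) * (\<Prod>i<N. 1 - (- s) * (s\<^sup>2) ^ i) * qprod (s\<^sup>2) N)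
     \<longlonglongrightarrow> qpoch (- (s\<^sup>2)) (s\<^sup>2) * qpoch s (s\<^sup>2) * qpoch (- s) (s\<^sup>2) * qpoch (s\<^sup>2) (s\<^sup>2)"
    by (intro tendsto_mult qpoch_tendsto q P)
  also have "(\<lambda>N. (\<Prod>i<N. 1 - (- (s\<^sup>2)) * (s\<^sup>2) ^ i) * (\<Prod>i<N. 1 - s * (s\<^sup>2) ^ i) * (\<Prod>i<N. 1 - (- s) * (s\<^sup>2) ^ i) * qprod (s\<^sup>2) N)
     = (\<lambda>N. qprod (s\<^sup>2) (2 * N))"
  proof -
    have "s ^ (2 * i + 2) = s\<^sup>2 * (s\<^sup>2) ^ i" "s ^ (2 * i + 1) = s * (s\<^sup>2) ^ i" for i
      by (simp_all add: power_mult power_add power2_eq_square)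
    note * = this
    show ?thesis unfolding half_period_qprod[symmetric] * prod.distrib[symmetric] by simp
  qed
  finally have "(\<lambda>N. qprod (s\<^sup>2) (2 * N)) \<longlonglongrightarrow> qpoch (- (s\<^sup>2)) (s\<^sup>2) * qpoch s (s\<^sup>2) * qpoch (- s) (s\<^sup>2) * qpoch (s\<^sup>2) (s\<^sup>2)" .
  moreover have "(\<lambda>N. qprod (s\<^sup>2) (2 * N)) \<longlonglongrightarrow> qpoch (s\<^sup>2) (s\<^sup>2)"
    using LIMSEQ_subseq_LIMSEQ[OF P, of "\<lambda>n. 2 * n"] by (simp add: strict_mono_def o_def)
  ultimately have "qpoch (- (s\<^sup>2)) (s\<^sup>2) * qpoch s (s\<^sup>2) * qpoch (- s) (s\<^sup>2) * qpoch (s\<^sup>2) (s\<^sup>2) = qpoch (s\<^sup>2) (s\<^sup>2)"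
    by (rule LIMSEQ_unique)
  then show ?thesis using P0 by simp
qed

text \<open>
  The three values involve the products \<open>(-q;q)\<close>, \<open>(s;q)\<close> and \<open>(-s;q)\<close> with \<open>s\<^sup>2 = q\<close>, each squared, which
  cancel by the preceding lemma and leave only \<open>(q;q)\<^sub>\<infinity>\<^sup>3\<close>. This is Jacobi's relation between
  \<open>\<theta>'(0)\<close> and the theta constants.
\<close>

lemma jtheta_half_periods:
  assumes \<tau>: "\<tau> \<in> upper_half"
  shows "jtheta \<tau> (1 / 2) * jtheta \<tau> (\<tau> / 2) * jtheta \<tau> ((1 + \<tau>) / 2) =
           2 * e2pi (- \<tau> / 4) * dedekind_eta \<tau> ^ 3"
proof -
  define s where "s = e2pi (\<tau> / 2)"
  have sq: "e2pi \<tau> = s\<^sup>2" by (simp add: s_def e2pi_power)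
  have s: "norm s < 1" unfolding s_def by (rule norm_e2pi_less_1) (use \<tau> in \<open>auto simp: upper_half_def\<close>)
  have q: "norm (s\<^sup>2) < 1" using norm_e2pi_less_1[OF \<tau>] sq by simp
  have s0: "s \<noteq> 0" by (simp add: s_def)
  define p where "p = qpoch (s\<^sup>2) (s\<^sup>2)"
  have inv: "inverse s * s\<^sup>2 = s" "inverse (- s) * s\<^sup>2 = - s"
    using s0 by (simp_all add: power2_eq_square)
  have spl: "qpoch (inverse s) (s\<^sup>2) = (1 - inverse s) * qpoch s (s\<^sup>2)"
    "qpoch (- inverse s) (s\<^sup>2) = (1 + inverse s) * qpoch (- s) (s\<^sup>2)"
    "qpoch (- 1) (s\<^sup>2) = 2 * qpoch (- (s\<^sup>2)) (s\<^sup>2)"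
    "qpoch s (s\<^sup>2) = (1 - s) * qpoch (s * s\<^sup>2) (s\<^sup>2)"
    "qpoch (- s) (s\<^sup>2) = (1 + s) * qpoch (- s * s\<^sup>2) (s\<^sup>2)"
    using qpoch_split_head[OF q, of "inverse s", unfolded inv]
      qpoch_split_head[OF q, of "inverse (- s)", unfolded inv]
      qpoch_split_head[OF q, of "-1"] qpoch_split_head[OF q, of s] qpoch_split_head[OF q, of "-s"]
    by simp_all
  define A where "A = qpoch (- (s\<^sup>2)) (s\<^sup>2)"
  define B where "B = qpoch s (s\<^sup>2)"
  define C where "C = qpoch (- s) (s\<^sup>2)"
  have ABC: "A * B * C = 1" unfolding A_def B_def C_def by (rule half_period_qpoch[OF s])
  have 1: "jtheta \<tau> (1 / 2) = e2pi (\<tau> / 8 + 1 / 4) * p * (A * (2 * A))"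
    unfolding jacobi_triple_product[OF \<tau>] sq e2pi_half p_def A_def by (simp add: spl(3))
  have e1: "e2pi ((1 + \<tau>) / 2) = - s"
    unfolding add_divide_distrib e2pi_add e2pi_half s_def by simp
  have 2: "jtheta \<tau> (\<tau> / 2) = e2pi (\<tau> / 8 + \<tau> / 4) * p * (- inverse s * B * B)"
  proof -
    have "qpoch (s * s\<^sup>2) (s\<^sup>2) * ((1 - inverse s) * B) = - inverse s * ((1 - s) * qpoch (s * s\<^sup>2) (s\<^sup>2)) * B"
      using s0 by (simp add: field_simps)
    then show ?thesis
      unfolding jacobi_triple_product[OF \<tau>] sq p_def B_def by (simp add: s_def[symmetric] spl(1,4))
  qed
  have 3: "jtheta \<tau> ((1 + \<tau>) / 2) = e2pi (\<tau> / 8 + (1 + \<tau>) / 4) * p * (inverse s * C * C)"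
  proof -
    have "qpoch (- s * s\<^sup>2) (s\<^sup>2) * ((1 + inverse s) * C) = inverse s * ((1 + s) * qpoch (- s * s\<^sup>2) (s\<^sup>2)) * C"
      using s0 by (simp add: field_simps)
    also have "(1 + s) * qpoch (- s * s\<^sup>2) (s\<^sup>2) = C" unfolding C_def spl(5) ..
    finally show ?thesis
      unfolding jacobi_triple_product[OF \<tau>] sq p_def C_def e1 by (simp add: spl(2))
  qed
  have "jtheta \<tau> (1 / 2) * jtheta \<tau> (\<tau> / 2) * jtheta \<tau> ((1 + \<tau>) / 2) =
     - 2 * (e2pi (\<tau> / 8 + 1 / 4) * e2pi (\<tau> / 8 + \<tau> / 4) * e2pi (\<tau> / 8 + (1 + \<tau>) / 4) * inverse s * inverse s) * p ^ 3 * (A * B * C) ^ 2"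
    unfolding 1 2 3 by (simp add: power2_eq_square power3_eq_cube mult_ac)
  also have "e2pi (\<tau> / 8 + 1 / 4) * e2pi (\<tau> / 8 + \<tau> / 4) * e2pi (\<tau> / 8 + (1 + \<tau>) / 4) * inverse s * inverse s =
     e2pi (1 / 2 - \<tau> / 4 + \<tau> / 8)"
    unfolding s_def e2pi_minus[symmetric] e2pi_add[symmetric] by (rule arg_cong[of _ _ e2pi]) (simp add: field_simps)
  also have "\<dots> = - (e2pi (- \<tau> / 4) * e2pi (\<tau> / 8))"
  proof -
    have "1 / 2 - \<tau> / 4 + \<tau> / 8 = 1 / 2 + - \<tau> / 4 + \<tau> / 8" by simp
    then show ?thesis by (simp only: e2pi_add e2pi_half) simp
  qed
  also have "dedekind_eta \<tau> ^ 3 = e2pi (\<tau> / 8) * p ^ 3"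
    unfolding dedekind_eta_eq power_mult_distrib e2pi_power sq p_def by simp
  ultimately show ?thesis unfolding ABC by simp
qed

section \<open>Lattice translations and the modular law of \<open>\<theta>\<close>\<close>

lemma theta_term_uminus: "theta_term t \<psi> \<tau> (- z) n = theta_term t (\<lambda>n. \<psi> (- n)) \<tau> z (- n)"
  by (simp add: theta_term_def)

lemma theta_series_uminus:
  assumes "\<And>n. \<psi> (- n) = s * \<psi> n"
  shows "theta_series t \<psi> \<tau> (- z) = s * theta_series t \<psi> \<tau> z"
proof -
  have "theta_series t \<psi> \<tau> (- z) = (\<Sum>\<^sub>\<infinity>n. theta_term t (\<lambda>n. \<psi> (- n)) \<tau> z (- n))"
    unfolding theta_series_def theta_term_uminus[symmetric] ..
  also have "\<dots> = (\<Sum>\<^sub>\<infinity>n. theta_term t (\<lambda>n. \<psi> (- n)) \<tau> z n)"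
    by (rule infsum_reindex_bij_witness[of _ uminus uminus]) auto
  also have "\<dots> = (\<Sum>\<^sub>\<infinity>n. s * theta_term t \<psi> \<tau> z n)"
    by (simp add: theta_term_def assms mult.assoc)
  finally show ?thesis by (simp add: infsum_cmult_right' theta_series_def)
qed

lemma anti_periodic_int:
  fixes \<psi> :: "int \<Rightarrow> complex"
  assumes "\<And>n. \<psi> (n + p) = - \<psi> n"
  shows "\<psi> (n + p * x) = e2pi (of_int x / 2) * \<psi> n"
proof (induction x rule: int_induct[where k = 0])
  case (step1 i)
  have "\<psi> (n + p * (i + 1)) = - \<psi> (n + p * i)" using assms[of "n + p * i"] by (simp add: algebra_simps)
  then show ?case using step1 e2pi_half_int[of "i + 1"] by (auto simp: e2pi_half_int[of i])
next
  case (step2 i)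
  have "\<psi> (n + p * i) = - \<psi> (n + p * (i - 1))" using assms[of "n + p * (i - 1)"] by (simp add: algebra_simps)
  then have "\<psi> (n + p * (i - 1)) = - \<psi> (n + p * i)" by simp
  then show ?case using step2 e2pi_half_int[of "i - 1"] by (auto simp: e2pi_half_int[of i])
qed auto

text \<open>
  Translation by \<open>x\<tau>\<close> is undone by the substitution \<open>n \<mapsto> n + 2kx\<close>, which costs the sign \<open>(-1)\<^sup>x\<close>;
  translation by \<open>y\<close> multiplies every term with odd \<open>n\<close> by \<open>(-1)\<^sup>y\<close>. Both signs are written as values of
  \<open>e2pi\<close>, so that they multiply well over several coordinates.
\<close>

lemma theta_series_lattice:
  assumes "k > 0" and per: "\<And>n. \<psi> (n + 2 * int k) = - \<psi> n" and ev: "\<And>n. even n \<Longrightarrow> \<psi> n = 0"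
  shows "theta_series (real k) \<psi> \<tau> (z + of_int x * \<tau> + of_int y) =
     e2pi (of_int (x + y) / 2 - of_nat k * ((of_int x)\<^sup>2 * \<tau> / 2 + of_int x * z)) * theta_series (real k) \<psi> \<tau> z"
proof -
  define E where "E = e2pi (of_int (x + y) / 2 - of_nat k * ((of_int x)\<^sup>2 * \<tau> / 2 + of_int x * z))"
  have "theta_term k \<psi> \<tau> (z + of_int x * \<tau> + of_int y) n = E * theta_term k \<psi> \<tau> z (n + 2 * int k * x)" for n
  proof (cases "even n")
    case False
    then obtain l where n: "n = 2 * l + 1" by (elim oddE)
    have "e2pi (of_int y / 2) = e2pi (of_int (n * y) / 2)"
      using False by (simp only: e2pi_half_int) simp
    then have "E * theta_term k \<psi> \<tau> z (n + 2 * int k * x) = \<psi> n * (e2pi (of_int x / 2) * e2pi (of_int x / 2)) *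
      (e2pi (- of_nat k * ((of_int x)\<^sup>2 * \<tau> / 2 + of_int x * z)) * e2pi (of_int (n * y) / 2) *
       e2pi ((of_int (n + 2 * int k * x))\<^sup>2 * \<tau> / (8 * of_real k) + of_int (n + 2 * int k * x) * z / 2))"
      unfolding E_def theta_term_def anti_periodic_int[of \<psi>, OF per]
      by (simp add: e2pi_add add_divide_distrib diff_conv_add_uminus del: add_uminus_conv_diff)
    also have "e2pi (of_int x / 2) * e2pi (of_int x / 2) = 1"
      by (simp add: e2pi_half_int)
    also have "e2pi (- of_nat k * ((of_int x)\<^sup>2 * \<tau> / 2 + of_int x * z)) * e2pi (of_int (n * y) / 2) *
       e2pi ((of_int (n + 2 * int k * x))\<^sup>2 * \<tau> / (8 * of_real k) + of_int (n + 2 * int k * x) * z / 2) =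
       e2pi ((of_int n)\<^sup>2 * \<tau> / (8 * of_real k) + of_int n * (z + of_int x * \<tau> + of_int y) / 2)"
      unfolding e2pi_add[symmetric] using \<open>k > 0\<close>
      by (intro arg_cong[of _ _ e2pi]) (simp add: field_simps power2_eq_square)
    finally show ?thesis by (simp add: theta_term_def)
  qed (simp add: theta_term_def ev)
  then have "theta_series k \<psi> \<tau> (z + of_int x * \<tau> + of_int y) = E * (\<Sum>\<^sub>\<infinity>n. theta_term k \<psi> \<tau> z (n + 2 * int k * x))"
    by (simp add: theta_series_def infsum_cmult_right')
  also have "(\<Sum>\<^sub>\<infinity>n. theta_term k \<psi> \<tau> z (n + 2 * int k * x)) = theta_series k \<psi> \<tau> z"
    unfolding theta_series_def
    by (rule infsum_reindex_bij_witness[of _ "\<lambda>n. n - 2 * int k * x" "\<lambda>n. n + 2 * int k * x"]) auto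
  finally show ?thesis by (simp add: E_def)
qed

lemma kronecker_m4_uminus: "kronecker_m4 (- n) = - 1 * kronecker_m4 n"
proof -
  have "- n mod 4 = 1 \<longleftrightarrow> n mod 4 = 3" "- n mod 4 = 3 \<longleftrightarrow> n mod 4 = 1" by presburger+
  then show ?thesis by (simp add: kronecker_m4_def)
qed

lemma kronecker_m4_add2: "kronecker_m4 (n + 2 * int 1) = - kronecker_m4 n"
proof -
  have "(n + 2 * int 1) mod 4 = 1 \<longleftrightarrow> n mod 4 = 3" "(n + 2 * int 1) mod 4 = 3 \<longleftrightarrow> n mod 4 = 1" by presburger+
  then show ?thesis by (simp add: kronecker_m4_def)
qed

lemma jtheta_uminus: "jtheta \<tau> (- z) = - jtheta \<tau> z"
  using theta_series_uminus[of kronecker_m4 "-1", OF kronecker_m4_uminus, of 1 \<tau> z]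
  by (simp add: jtheta_eq_theta_series)

lemma jtheta_lattice: "jtheta \<tau> (z + of_int x * \<tau> + of_int y) =
     e2pi (of_int (x + y) / 2 - ((of_int x)\<^sup>2 * \<tau> / 2 + of_int x * z)) * jtheta \<tau> z"
  using theta_series_lattice[of 1 kronecker_m4, OF _ kronecker_m4_add2 kronecker_m4_even, of \<tau> z x y]
  by (simp add: jtheta_eq_theta_series)

lemma jtheta_0 [simp]: "jtheta \<tau> 0 = 0"
  using jtheta_uminus[of \<tau> 0] by simp

lemma jtheta_lattice_0: "jtheta \<tau> (of_int a + of_int b * \<tau>) = 0"
  using jtheta_lattice[of \<tau> 0 b a] by (simp add: add.commute)

lemma jtheta_holomorphic: "\<tau> \<in> upper_half \<Longrightarrow> jtheta \<tau> holomorphic_on A"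
  using theta_series_has_field_derivative[of 1 kronecker_m4 \<tau>] exp_bounded_kronecker_m4
  unfolding jtheta_eq_theta_series[abs_def] holomorphic_on_def field_differentiable_def
  by (meson has_field_derivative_at_within zero_less_one)

lemma jtheta_has_deriv: "\<tau> \<in> upper_half \<Longrightarrow> (jtheta \<tau> has_field_derivative deriv (jtheta \<tau>) z) (at z)"
  using holomorphic_derivI[OF jtheta_holomorphic[of \<tau> UNIV]] by simp

text \<open>
  By the translation law it suffices to look at \<open>z = 0\<close>, where the derivative is \<open>2\<pi>i \<eta>\<^sup>3\<close>.
\<close>

lemma jtheta_simple_zero:
  assumes \<tau>: "\<tau> \<in> upper_half" and "jtheta \<tau> z = 0"
  shows "deriv (jtheta \<tau>) z \<noteq> 0"
proof
  assume 0: "deriv (jtheta \<tau>) z = 0"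
  obtain a b :: int where z: "z = of_int a + of_int b * \<tau>"
    using assms jtheta_zeroD by blast
  define E where "E = (\<lambda>w. e2pi (of_int (b + a) / 2 - ((of_int b)\<^sup>2 * \<tau> / 2 + of_int b * w)))"
  have eq: "jtheta \<tau> (w + z) = E w * jtheta \<tau> w" for w
    using jtheta_lattice[of \<tau> w b a] unfolding E_def z by (simp add: add_ac)
  have "((\<lambda>w. jtheta \<tau> (w + z)) has_field_derivative deriv (jtheta \<tau>) z) (at 0)"
    using jtheta_has_deriv[OF \<tau>, of z] DERIV_shift[of "jtheta \<tau>" _ 0 z] by simp
  moreover have "((\<lambda>w. E w * jtheta \<tau> w) has_field_derivative
      deriv E 0 * jtheta \<tau> 0 + 2 * pi * \<i> * dedekind_eta \<tau> ^ 3 * E 0) (at 0)"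
  proof (rule DERIV_mult[OF _ jtheta_deriv_0[OF \<tau>]])
    have "E holomorphic_on UNIV" unfolding E_def e2pi_def by (intro holomorphic_intros)
    then show "(E has_field_derivative deriv E 0) (at 0)"
      by (rule holomorphic_derivI) auto
  qed
  ultimately have "deriv (jtheta \<tau>) z = deriv E 0 * jtheta \<tau> 0 + 2 * pi * \<i> * dedekind_eta \<tau> ^ 3 * E 0"
    unfolding eq by (rule DERIV_unique)
  then show False using dedekind_eta_nonzero[OF \<tau>] 0 by (simp add: E_def)
qed

lemma periodic_int:
  fixes R :: "complex \<Rightarrow> complex"
  assumes "\<And>z. R (z + w) = R z" shows "R (z + of_int n * w) = R z"
proof (induction n rule: int_induct[where k = 0])
  case (step1 i)
  then show ?case using assms[of "z + of_int i * w"] by (simp add: algebra_simps)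
next
  case (step2 i)
  then show ?case using assms[of "z + of_int (i - 1) * w"] by (simp add: algebra_simps)
qed auto

lemma lattice_reduce:
  assumes "\<tau> \<in> upper_half"
  obtains z0 :: complex and a b :: int where "norm z0 \<le> norm \<tau> + 1" "z = z0 + of_int a * 1 + of_int b * \<tau>"
proof -
  define s where "s = Im z / Im \<tau>"
  define t where "t = Re (z - of_real s * \<tau>)"
  have I: "Im \<tau> > 0" using assms by (simp add: upper_half_def)
  have z: "z = of_real t + of_real s * \<tau>"
    using I by (simp add: complex_eq_iff t_def s_def)
  show ?thesis
  proof (rule that)
    show "z = (of_real (frac t) + of_real (frac s) * \<tau>) + of_int \<lfloor>t\<rfloor> * 1 + of_int \<lfloor>s\<rfloor> * \<tau>"
      by (subst z) (simp add: frac_def algebra_simps)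
    have "norm (of_real (frac t) + of_real (frac s) * \<tau>) \<le> frac t + frac s * norm \<tau>"
      by (rule norm_triangle_le) (simp add: norm_mult frac_ge_0)
    also have "\<dots> \<le> 1 + 1 * norm \<tau>"
      by (intro add_mono mult_right_mono) (auto simp: less_imp_le[OF frac_lt_1])
    finally show "norm (of_real (frac t) + of_real (frac s) * \<tau>) \<le> norm \<tau> + 1" by simp
  qed
qed

text \<open>
  The quotient \<open>f/g\<close> extends to an entire function, because its singularities are removable, and it
  is doubly periodic, hence bounded, hence constant.
\<close>

lemma proportional_if_same_multipliers:
  fixes f g :: "complex \<Rightarrow> complex"
  assumes \<tau>: "\<tau> \<in> upper_half"
    and holo: "f holomorphic_on UNIV" "g holomorphic_on UNIV"
    and one: "\<And>z. f (z + 1) = u z * f z" "\<And>z. g (z + 1) = u z * g z" "\<And>z. u z \<noteq> 0"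
    and tau: "\<And>z. f (z + \<tau>) = v z * f z" "\<And>z. g (z + \<tau>) = v z * g z" "\<And>z. v z \<noteq> 0"
    and zeros: "\<And>z. g z = 0 \<Longrightarrow> f z = 0 \<and> deriv g z \<noteq> 0"
  obtains C where "\<And>z. f z = C * g z"
proof -
  \<comment> \<open>\<open>R\<close> takes the value 0 at the zeros of \<open>g\<close>, so it is periodic everywhere; \<open>h\<close> is the continuous extension, with values given by l'Hospital's rule.\<close>
  define R where "R = (\<lambda>z. f z / g z)"
  define h where "h = (\<lambda>z. if g z = 0 then deriv f z / deriv g z else R z)"
  have df: "(f has_field_derivative deriv f z) (at z)" "(g has_field_derivative deriv g z) (at z)" for z
    using holo by (auto intro: holomorphic_derivI)
  have nz: "\<forall>\<^sub>F w in at z. g w \<noteq> 0" for z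
  proof (cases "g z = 0")
    case True
    then have "deriv g z \<noteq> 0" using zeros by blast
    then have "\<forall>\<^sub>F w in at z. (g w - g z) / (w - z) \<noteq> 0"
      using df(2)[of z] by (intro tendsto_imp_eventually_ne) (auto simp: has_field_derivative_iff)
    then show ?thesis by eventually_elim (use True in auto)
  next
    case False
    have "isCont g z" using df(2) DERIV_isCont by blast
    then show ?thesis using False by (simp add: isCont_def tendsto_imp_eventually_ne)
  qed
  have lim: "R \<midarrow>z\<rightarrow> h z" for z
  proof (cases "g z = 0")
    case True
    have "(\<lambda>w. ((f w - f z) / (w - z)) / ((g w - g z) / (w - z))) \<midarrow>z\<rightarrow> deriv f z / deriv g z"
      using zeros[OF True]
      by (intro tendsto_divide df(1)[unfolded has_field_derivative_iff]
            df(2)[unfolded has_field_derivative_iff]) auto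
    then have "(\<lambda>w. (f w / (w - z)) / (g w / (w - z))) \<midarrow>z\<rightarrow> h z"
      using True zeros[OF True] by (simp add: h_def)
    moreover have "\<forall>\<^sub>F w in at z. (f w / (w - z)) / (g w / (w - z)) = R w"
      unfolding eventually_at_filter by (intro always_eventually) (auto simp: R_def)
    ultimately show ?thesis by (rule Lim_transform_eventually)
  next
    case False
    have "isCont f z" "isCont g z" using df DERIV_isCont by blast+
    then have "R \<midarrow>z\<rightarrow> f z / g z"
      unfolding R_def isCont_def using False by (intro tendsto_divide)
    then show ?thesis using False by (simp add: h_def R_def)
  qed
  have hlim: "h \<midarrow>z\<rightarrow> h z" for z
  proof (rule Lim_transform_eventually[OF lim])
    show "\<forall>\<^sub>F w in at z. R w = h w" using nz[of z] by eventually_elim (simp add: h_def)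
  qed
  have "h holomorphic_on UNIV"
  proof -
    have "h field_differentiable at z" for z
    proof -
      obtain d where d: "d > 0" "\<And>w. w \<noteq> z \<Longrightarrow> dist w z < d \<Longrightarrow> g w \<noteq> 0"
        using nz[of z] unfolding eventually_at by auto
      have "R holomorphic_on ball z d - {z}"
        unfolding R_def
        by (intro holomorphic_intros holomorphic_on_subset[OF holo(1)] holomorphic_on_subset[OF holo(2)])
           (use d in \<open>auto simp: dist_commute\<close>)
      then have "h holomorphic_on ball z d - {z}"
        by (rule holomorphic_transform) (use d in \<open>auto simp: h_def dist_commute\<close>)
      then have "h holomorphic_on ball z d"
        by (rule no_isolated_singularity[rotated])
           (use hlim in \<open>auto simp: continuous_at_imp_continuous_on isCont_def\<close>)
      then show ?thesis using d(1) by (intro holomorphic_on_imp_differentiable_at) auto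
    qed
    then show ?thesis by (simp add: holomorphic_on_def field_differentiable_at_within)
  qed
  moreover have "bounded (range h)"
  proof -
    have R1: "R (z + 1) = R z" "R (z + \<tau>) = R z" for z
      by (simp_all add: R_def one tau)
    have "compact (h ` cball 0 (norm \<tau> + 1))"
      using hlim by (intro compact_continuous_image continuous_at_imp_continuous_on) (auto simp: isCont_def)
    then obtain M where M: "\<And>z. norm z \<le> norm \<tau> + 1 \<Longrightarrow> norm (h z) \<le> M"
      by (meson bounded_iff compact_imp_bounded imageI mem_cball_0)
    have M0: "M \<ge> 0" using order_trans[OF norm_ge_zero M[of 0]] by simp
    have RM: "norm (R z) \<le> M" for z
    proof -
      obtain z0 and a b :: int where z0: "norm z0 \<le> norm \<tau> + 1" "z = z0 + of_int a * 1 + of_int b * \<tau>"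
        using lattice_reduce[OF \<tau>] by metis
      have "R z = R z0"
        unfolding z0(2) by (simp only: periodic_int[of R, OF R1(2)] periodic_int[of R, OF R1(1)])
      moreover have "norm (R z0) \<le> M"
        using M[OF z0(1)] M0 by (cases "g z0 = 0") (auto simp: h_def R_def)
      ultimately show ?thesis by simp
    qed
    have "norm (h z) \<le> M" for z
      by (rule tendsto_upperbound[OF tendsto_norm[OF lim]]) (use RM in auto)
    then show ?thesis by (auto simp: bounded_iff)
  qed
  ultimately obtain C where C: "\<And>z. h z = C"
    using Liouville_theorem unfolding constant_on_def by blast
  show ?thesis
  proof (rule that[of C])
    fix z show "f z = C * g z"
      using C[of z] zeros[of z] by (cases "g z = 0") (auto simp: h_def R_def field_simps)
  qed
qed

text \<open>
  The last two equations express the periods \<open>1/j\<close> and \<open>\<tau>/j\<close> of the rescaled lattice through the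
  standard periods of the transformed point.
\<close>

lemma mobius_props:
  assumes "a * d - b * c = 1" "\<tau> \<in> upper_half"
  defines "j \<equiv> of_int c * \<tau> + of_int d"
  shows "j \<noteq> 0" "mobius a b c d \<tau> \<in> upper_half"
    "1 / j = of_int a - of_int c * mobius a b c d \<tau>"
    "\<tau> / j = of_int d * mobius a b c d \<tau> - of_int b"
proof -
  have I: "Im \<tau> > 0" using assms by (simp add: upper_half_def)
  show j: "j \<noteq> 0"
  proof
    assume "j = 0"
    then have "Im j = 0" "Re j = 0" by auto
    then have "c = 0" "d = 0" using I by (auto simp: j_def)
    then show False using assms by simp
  qed
  have det: "of_int a * of_int d - of_int b * of_int c = (1::complex)"
    using assms(1) by (metis of_int_1 of_int_diff of_int_mult)
  have det': "of_int a * of_int d - of_int b * of_int c = (1::real)"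
    using assms(1) by (metis of_int_1 of_int_diff of_int_mult)
  have "Im (mobius a b c d \<tau>) = Im \<tau> * (of_int a * of_int d - of_int b * of_int c) / ((Re j)\<^sup>2 + (Im j)\<^sup>2)"
    unfolding mobius_def j_def by (simp add: Im_divide algebra_simps)
  also have "\<dots> > 0"
    using I j unfolding det' by (auto simp: complex_eq_iff sum_power2_gt_zero_iff intro!: divide_pos_pos)
  finally show "mobius a b c d \<tau> \<in> upper_half" by (simp add: upper_half_def)
  have "of_int a * j - of_int c * (of_int a * \<tau> + of_int b) = of_int a * of_int d - of_int b * of_int c"
    by (simp add: j_def algebra_simps)
  then show "1 / j = of_int a - of_int c * mobius a b c d \<tau>"
    using j det unfolding mobius_def j_def[symmetric] by (simp add: field_simps)
  have "of_int d * (of_int a * \<tau> + of_int b) - of_int b * j = (of_int a * of_int d - of_int b * of_int c) * \<tau>"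
    by (simp add: j_def algebra_simps)
  then show "\<tau> / j = of_int d * mobius a b c d \<tau> - of_int b"
    using j det unfolding mobius_def j_def[symmetric] by (simp add: field_simps)
qed

lemma e2pi_half_odd: "odd n \<Longrightarrow> e2pi (of_int n / 2) = - 1"
  by (simp add: e2pi_half_int)

text \<open>
  These are the signs that the translation law produces for the two transformed periods.
\<close>

lemma odd_if_det_1:
  fixes a b c d :: int
  assumes "a * d - b * c = 1" shows "odd (a - c - c * a)" "odd (d - b - d * b)"
proof -
  have "\<not> (even a \<and> even c)" "\<not> (even b \<and> even d)"
    using assms by (metis dvd_diff dvd_mult dvd_mult2 odd_one)+
  then show "odd (a - c - c * a)" "odd (d - b - d * b)" by auto
qed

text \<open>
  The left-hand side, multiplied by the Gaussian factor, has the same multipliers as \<open>\<theta>(\<tau>, \<cdot>)\<close> under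
  translation by \<open>1\<close> and \<open>\<tau>\<close>, and it vanishes at all lattice points, so the two functions are
  proportional. Derivatives at \<open>0\<close> give the factor.
\<close>

lemma jtheta_modular:
  assumes det: "a * d - b * c = 1" and \<tau>: "\<tau> \<in> upper_half"
  defines "j \<equiv> of_int c * \<tau> + of_int d" and "\<tau>' \<equiv> mobius a b c d \<tau>"
  shows "jtheta \<tau>' (z / j) = dedekind_eta \<tau>' ^ 3 / (j * dedekind_eta \<tau> ^ 3) *
           e2pi (of_int c * z\<^sup>2 / (2 * j)) * jtheta \<tau> z"
proof -
  note mp = mobius_props[OF det \<tau>, folded j_def \<tau>'_def]
  define f where "f = (\<lambda>z. jtheta \<tau>' (z / j) * e2pi (- of_int c * z\<^sup>2 / (2 * j)))"
  define v where "v = (\<lambda>z. - e2pi (- \<tau> / 2 - z))"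
  obtain C where C: "\<And>z. f z = C * jtheta \<tau> z"
  proof (rule proportional_if_same_multipliers[OF \<tau>, of f "jtheta \<tau>" "\<lambda>_. -1" v])
    show "f holomorphic_on UNIV"
    proof -
      have "(jtheta \<tau>' \<circ> (\<lambda>z. z / j)) holomorphic_on UNIV"
        by (intro holomorphic_on_compose holomorphic_intros jtheta_holomorphic mp) (use mp in auto)
      then show ?thesis unfolding f_def e2pi_def o_def using mp(1) by (intro holomorphic_intros) auto
    qed
    show "jtheta \<tau> holomorphic_on UNIV" by (rule jtheta_holomorphic[OF \<tau>])
    show "jtheta \<tau> (z + 1) = - 1 * jtheta \<tau> z" for z
      using jtheta_lattice[of \<tau> z 0 1] by (simp add: e2pi_half)
    show "jtheta \<tau> (z + \<tau>) = v z * jtheta \<tau> z" for z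
    proof -
      have e: "of_int (1 + 0) / 2 - ((of_int 1)\<^sup>2 * \<tau> / 2 + of_int 1 * z) = 1 / 2 + (- \<tau> / 2 - z)" by simp
      have "jtheta \<tau> (z + of_int 1 * \<tau> + of_int 0) = v z * jtheta \<tau> z"
        unfolding jtheta_lattice e v_def e2pi_add[of "1 / 2"] e2pi_half by simp
      then show ?thesis by simp
    qed
    show "f (z + 1) = - 1 * f z" for z
    proof -
      have e: "(z + 1) / j = z / j + of_int (- c) * \<tau>' + of_int a"
        using mp(3) by (simp add: add_divide_distrib)
      have "f (z + 1) = e2pi (of_int (a - c) / 2 - ((of_int c)\<^sup>2 * \<tau>' / 2 - of_int c * (z / j))) * jtheta \<tau>' (z / j)
              * e2pi (- of_int c * (z + 1)\<^sup>2 / (2 * j))"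
        unfolding f_def e jtheta_lattice by simp
      also have "\<dots> = e2pi ((of_int (a - c) / 2 - ((of_int c)\<^sup>2 * \<tau>' / 2 - of_int c * (z / j)))
             + (- of_int c * (z + 1)\<^sup>2 / (2 * j))) * jtheta \<tau>' (z / j)"
        by (simp only: e2pi_add mult_ac)
      also have "(of_int (a - c) / 2 - ((of_int c)\<^sup>2 * \<tau>' / 2 - of_int c * (z / j)))
             + (- of_int c * (z + 1)\<^sup>2 / (2 * j)) =
             of_int (a - c) / 2 - (of_int c)\<^sup>2 * \<tau>' / 2 - of_int c * (1 / j) / 2 + (- of_int c * z\<^sup>2 / (2 * j))"
        using mp(1) by (simp add: field_simps power2_eq_square)
      also have "\<dots> = of_int (a - c - c * a) / 2 + (- of_int c * z\<^sup>2 / (2 * j))"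
        unfolding mp(3) by (simp add: field_simps power2_eq_square)
      finally show ?thesis
        unfolding e2pi_add e2pi_half_odd[OF odd_if_det_1(1)[OF det]] f_def by simp
    qed
    show "f (z + \<tau>) = v z * f z" for z
    proof -
      have e: "(z + \<tau>) / j = z / j + of_int d * \<tau>' + of_int (- b)"
        using mp(4) by (simp add: add_divide_distrib)
      have cj: "of_int c * \<tau> / j = 1 - of_int d / j"
        using mp(1) by (simp add: j_def field_simps)
      have "f (z + \<tau>) = e2pi (of_int (d - b) / 2 - ((of_int d)\<^sup>2 * \<tau>' / 2 + of_int d * (z / j))) * jtheta \<tau>' (z / j)
              * e2pi (- of_int c * (z + \<tau>)\<^sup>2 / (2 * j))"
        unfolding f_def e jtheta_lattice by simp
      also have "\<dots> = e2pi ((of_int (d - b) / 2 - ((of_int d)\<^sup>2 * \<tau>' / 2 + of_int d * (z / j)))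
             + (- of_int c * (z + \<tau>)\<^sup>2 / (2 * j))) * jtheta \<tau>' (z / j)"
        by (simp only: e2pi_add mult_ac)
      also have "- of_int c * (z + \<tau>)\<^sup>2 / (2 * j) = - of_int c * z\<^sup>2 / (2 * j) - (of_int c * \<tau> / j) * z - (of_int c * \<tau> / j) * \<tau> / 2"
        using mp(1) by (simp add: field_simps power2_eq_square)
      also have "\<dots> = - of_int c * z\<^sup>2 / (2 * j) - z + of_int d * (z / j) - \<tau> / 2 + of_int d * (\<tau> / j) / 2"
        unfolding cj by (simp add: field_simps)
      also have "(of_int (d - b) / 2 - ((of_int d)\<^sup>2 * \<tau>' / 2 + of_int d * (z / j)))
             + (- of_int c * z\<^sup>2 / (2 * j) - z + of_int d * (z / j) - \<tau> / 2 + of_int d * (\<tau> / j) / 2) =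
             of_int (d - b - d * b) / 2 + (- \<tau> / 2 - z) + (- of_int c * z\<^sup>2 / (2 * j))"
        unfolding mp(4) by (simp add: field_simps power2_eq_square)
      finally show ?thesis
        unfolding e2pi_add e2pi_half_odd[OF odd_if_det_1(2)[OF det]] f_def v_def by simp
    qed
    show "f z = 0 \<and> deriv (jtheta \<tau>) z \<noteq> 0" if "jtheta \<tau> z = 0" for z
    proof
      obtain m n :: int where z: "z = of_int m + of_int n * \<tau>"
        using jtheta_zeroD[OF \<tau> \<open>jtheta \<tau> z = 0\<close>] by blast
      have "z / j = of_int m * (1 / j) + of_int n * (\<tau> / j)" unfolding z by (simp add: add_divide_distrib)
      also have "\<dots> = of_int (m * a - n * b) + of_int (n * d - m * c) * \<tau>'"
        unfolding mp(3,4) by (simp add: algebra_simps)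
      finally show "f z = 0" unfolding f_def by (simp only: jtheta_lattice_0) simp
    qed (use jtheta_simple_zero[OF \<tau> that] in auto)
  qed (auto simp: v_def)
  have "(f has_field_derivative 2 * pi * \<i> * dedekind_eta \<tau>' ^ 3 * (1 / j)) (at 0)"
  proof -
    have 1: "((\<lambda>z. jtheta \<tau>' (z / j)) has_field_derivative 2 * pi * \<i> * dedekind_eta \<tau>' ^ 3 * (1 / j)) (at 0)"
      by (rule DERIV_chain'[of "\<lambda>z. z / j" "1 / j" 0 UNIV "jtheta \<tau>'"])
         (use jtheta_deriv_0[OF mp(2)] mp(1) in \<open>auto intro!: derivative_eq_intros\<close>)
    have 2: "((\<lambda>z. e2pi (- of_int c * z\<^sup>2 / (2 * j))) has_field_derivative 0) (at 0)"
      unfolding e2pi_def using mp(1) by (auto intro!: derivative_eq_intros)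
    show ?thesis using DERIV_mult[OF 1 2] by (simp add: f_def)
  qed
  moreover have "f = (\<lambda>z. C * jtheta \<tau> z)" using C by auto
  ultimately have "2 * pi * \<i> * dedekind_eta \<tau>' ^ 3 * (1 / j) = C * (2 * pi * \<i> * dedekind_eta \<tau> ^ 3)"
    using DERIV_cmult[OF jtheta_deriv_0[OF \<tau>], of C] by (metis DERIV_unique)
  then have C': "C = dedekind_eta \<tau>' ^ 3 / (j * dedekind_eta \<tau> ^ 3)"
    using mp(1) dedekind_eta_nonzero[OF \<tau>] by (simp add: field_simps)
  have "jtheta \<tau>' (z / j) = f z * e2pi (of_int c * z\<^sup>2 / (2 * j))"
    by (simp add: f_def mult.assoc e2pi_add[symmetric])
  then show ?thesis unfolding C C' by (simp add: mult_ac)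
qed

section \<open>The eta multiplier\<close>

text \<open>
  Sorting the factors by their exponents modulo 3.
\<close>

lemma qprod_trisect:
  "(\<Prod>i<N. (1 - q * (q ^ 3) ^ i) * (1 - q\<^sup>2 * (q ^ 3) ^ i) * (1 - q ^ 3 * (q ^ 3) ^ i)) = qprod q (3 * N)"
proof (induction N)
  case (Suc N)
  have "3 * Suc N = Suc (Suc (Suc (3 * N)))" by simp
  then have "qprod q (3 * Suc N) = qprod q (3 * N) * ((1 - q ^ (3 * N) * q) * (1 - q ^ (3 * N) * q\<^sup>2) * (1 - q ^ (3 * N) * q ^ 3))"
    by (simp only: qprod_Suc) (simp add: power2_eq_square power3_eq_cube mult_ac)
  moreover have "(q ^ 3) ^ N = q ^ (3 * N)" by (simp add: power_mult)
  ultimately show ?case unfolding prod.lessThan_Suc Suc by (simp only: mult_ac)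
qed simp

lemma qpoch_trisect:
  assumes "norm q < 1"
  shows "qpoch q (q ^ 3) * qpoch (q\<^sup>2) (q ^ 3) * qpoch (q ^ 3) (q ^ 3) = qpoch q q"
proof -
  have q: "norm (q ^ 3) < 1" using assms by (simp add: norm_power power_less_one_iff)
  have "(\<lambda>N. (\<Prod>i<N. 1 - q * (q ^ 3) ^ i) * (\<Prod>i<N. 1 - q\<^sup>2 * (q ^ 3) ^ i) * (\<Prod>i<N. 1 - q ^ 3 * (q ^ 3) ^ i))
     \<longlonglongrightarrow> qpoch q (q ^ 3) * qpoch (q\<^sup>2) (q ^ 3) * qpoch (q ^ 3) (q ^ 3)"
    by (intro tendsto_mult qpoch_tendsto q)
  moreover have "(\<lambda>N. qprod q (3 * N)) \<longlonglongrightarrow> qpoch q q"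
    using LIMSEQ_subseq_LIMSEQ[OF qprod_tendsto[OF assms], of "\<lambda>n. 3 * n"] by (simp add: strict_mono_def o_def)
  ultimately show ?thesis
    unfolding qprod_trisect[symmetric] prod.distrib[symmetric] by (rule LIMSEQ_unique)
qed

text \<open>
  Euler's pentagonal number theorem: in the triple product with \<open>q\<^sup>3\<close> and \<open>r = q\<close> the three progressions
  modulo 3 combine to \<open>(q;q)\<^sub>\<infinity>\<close>.
\<close>

lemma jtheta_3tau_tau:
  assumes \<tau>: "\<tau> \<in> upper_half"
  shows "jtheta (3 * \<tau>) \<tau> = - e2pi (- \<tau> / 6) * dedekind_eta \<tau>"
proof -
  define q where "q = e2pi \<tau>"
  have q: "norm q < 1" using norm_e2pi_less_1[OF \<tau>] by (simp add: q_def)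
  have q3: "e2pi (3 * \<tau>) = q ^ 3" by (simp add: q_def e2pi_power)
  have q3': "norm (q ^ 3) < 1" using q by (simp add: norm_power power_less_one_iff)
  have q0: "q \<noteq> 0" by (simp add: q_def)
  have i: "inverse q * q ^ 3 = q\<^sup>2" using q0 by (simp add: power2_eq_square power3_eq_cube)
  have \<tau>3: "3 * \<tau> \<in> upper_half" using \<tau> by (simp add: upper_half_def)
  have "jtheta (3 * \<tau>) \<tau> = e2pi (3 * \<tau> / 8 + \<tau> / 2) * qpoch (q ^ 3) (q ^ 3) *
          (qpoch (q * q ^ 3) (q ^ 3) * qpoch (inverse q) (q ^ 3))"
    using jacobi_triple_product[OF \<tau>3, of \<tau>] unfolding q3 q_def[symmetric] .
  also have "qpoch (inverse q) (q ^ 3) = (1 - inverse q) * qpoch (q\<^sup>2) (q ^ 3)"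
    using qpoch_split_head[OF q3', of "inverse q"] unfolding i .
  also have "1 - inverse q = - (inverse q * (1 - q))" using q0 by (simp add: field_simps)
  also have "e2pi (3 * \<tau> / 8 + \<tau> / 2) * qpoch (q ^ 3) (q ^ 3) *
          (qpoch (q * q ^ 3) (q ^ 3) * (- (inverse q * (1 - q)) * qpoch (q\<^sup>2) (q ^ 3))) =
      - (e2pi (3 * \<tau> / 8 + \<tau> / 2) * inverse q) * (((1 - q) * qpoch (q * q ^ 3) (q ^ 3)) * qpoch (q\<^sup>2) (q ^ 3) * qpoch (q ^ 3) (q ^ 3))"
    by (simp add: mult_ac)
  also have "(1 - q) * qpoch (q * q ^ 3) (q ^ 3) = qpoch q (q ^ 3)"
    by (rule qpoch_split_head[OF q3', symmetric])
  also have "qpoch q (q ^ 3) * qpoch (q\<^sup>2) (q ^ 3) * qpoch (q ^ 3) (q ^ 3) = qpoch q q"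
    by (rule qpoch_trisect[OF q])
  also have "e2pi (3 * \<tau> / 8 + \<tau> / 2) * inverse q = e2pi (- \<tau> / 6) * e2pi (\<tau> / 24)"
    unfolding q_def e2pi_minus[symmetric] e2pi_add[symmetric] by (intro arg_cong[of _ _ e2pi]) (simp add: field_simps)
  finally show ?thesis by (simp add: dedekind_eta_eq q_def)
qed

text \<open>
  Continuity comes from the theta series, which avoids uniform convergence of the product in \<open>\<tau>\<close>.
\<close>

lemma dedekind_eta_continuous: "continuous_on upper_half dedekind_eta"
proof -
  have "continuous_on upper_half ((\<lambda>p. theta_series 1 kronecker_m4 (fst p) (snd p)) \<circ> (\<lambda>\<tau>. (3 * \<tau>, \<tau>)))"
    by (intro continuous_on_compose continuous_intros continuous_on_subset[OF theta_series_continuous_on])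
       (auto simp: exp_bounded_kronecker_m4 upper_half_def)
  then have "continuous_on upper_half (\<lambda>\<tau>. - e2pi (\<tau> / 6) * jtheta (3 * \<tau>) \<tau>)"
    unfolding jtheta_eq_theta_series e2pi_def o_def by (intro continuous_intros) auto
  moreover have "- e2pi (\<tau> / 6) * jtheta (3 * \<tau>) \<tau> = dedekind_eta \<tau>" if "\<tau> \<in> upper_half" for \<tau>
  proof -
    have "e2pi (\<tau> / 6) * e2pi (- \<tau> / 6) = 1" unfolding e2pi_add[symmetric] by simp
    then show ?thesis by (simp add: jtheta_3tau_tau[OF that] mult.assoc[symmetric])
  qed
  ultimately show ?thesis by (metis (no_types, lifting) continuous_on_cong)
qed

lemma constant_if_power_constant:
  fixes g :: "complex \<Rightarrow> complex"
  assumes "continuous_on upper_half g" "n > 0" "\<And>\<tau>. \<tau> \<in> upper_half \<Longrightarrow> g \<tau> ^ n = c"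
  obtains K where "\<And>\<tau>. \<tau> \<in> upper_half \<Longrightarrow> g \<tau> = K"
proof -
  have "convex upper_half" unfolding upper_half_def by (rule convex_halfspace_Im_gt)
  moreover have "finite (g ` upper_half)"
    by (rule finite_subset[OF _ finite_nth_roots[OF \<open>n > 0\<close>, of c]]) (use assms in auto)
  ultimately have "g constant_on upper_half"
    using assms(1) convex_connected by (intro continuous_finite_range_constant) auto
  then show ?thesis using that unfolding constant_on_def by blast
qed

lemma neg_inverse_upper_half: "\<tau> \<in> upper_half \<Longrightarrow> - 1 / \<tau> \<in> upper_half"
  using mobius_props(2)[of 0 0 "-1" 1 \<tau>] by (simp add: mobius_def)

text \<open>
  The transformation \<open>\<tau> \<mapsto> -1/\<tau>\<close> permutes the three half periods. Multiplying the modular laws at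
  \<open>1/2\<close>, \<open>\<tau>/2\<close> and \<open>(1+\<tau>)/2\<close> gives a second equation between \<open>\<eta>(-1/\<tau>)\<^sup>3\<close> and the cube of the factor \<open>C\<close>
  of the modular law; the first one is the definition of \<open>C\<close>. Eliminating \<open>\<eta>(-1/\<tau>)\<close> leaves \<open>C\<^sup>2 = i\<tau>\<close>.
\<close>

lemma dedekind_eta_S_pow6:
  assumes \<tau>: "\<tau> \<in> upper_half"
  shows "dedekind_eta (- 1 / \<tau>) ^ 6 = \<i> * \<tau> ^ 3 * dedekind_eta \<tau> ^ 6"
proof -
  define \<tau>' where "\<tau>' = - 1 / \<tau>"
  have \<tau>': "\<tau>' \<in> upper_half" unfolding \<tau>'_def by (rule neg_inverse_upper_half[OF \<tau>])
  have [simp]: "\<tau> \<noteq> 0" using \<tau> by (auto simp: upper_half_def)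
  have \<tau>'_eq: "mobius 0 (- 1) 1 0 \<tau> = \<tau>'" by (simp add: mobius_def \<tau>'_def)
  define \<eta> where "\<eta> = dedekind_eta \<tau>"
  define \<eta>' where "\<eta>' = dedekind_eta \<tau>'"
  have nz: "\<eta> \<noteq> 0" "\<eta>' \<noteq> 0"
    using dedekind_eta_nonzero \<tau> \<tau>' by (auto simp: \<eta>_def \<eta>'_def)
  define C where "C = \<eta>' ^ 3 / (\<tau> * \<eta> ^ 3)"
  have law: "jtheta \<tau>' (z / \<tau>) = C * e2pi (z\<^sup>2 / (2 * \<tau>)) * jtheta \<tau> z" for z
    using jtheta_modular[of 0 0 "-1" 1 \<tau> z] \<tau> by (simp add: \<tau>'_eq C_def \<eta>_def \<eta>'_def)
  have 1: "jtheta \<tau>' (1 / 2) = C * e2pi (\<tau> / 8) * jtheta \<tau> (\<tau> / 2)"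
    using law[of "\<tau> / 2"] by (simp add: power2_eq_square)
  have 2: "- jtheta \<tau>' (\<tau>' / 2) = C * e2pi (- \<tau>' / 8) * jtheta \<tau> (1 / 2)"
  proof -
    have "1 / 2 / \<tau> = - (\<tau>' / 2)" by (simp add: \<tau>'_def)
    moreover have "(1 / 2)\<^sup>2 / (2 * \<tau>) = - \<tau>' / 8" by (simp add: \<tau>'_def power2_eq_square)
    ultimately show ?thesis using law[of "1 / 2"] by (simp only: jtheta_uminus)
  qed
  have 3: "jtheta \<tau>' ((1 + \<tau>') / 2) = C * e2pi (\<tau> / 8 - \<tau>' / 8 + 1 / 4) * jtheta \<tau> ((1 + \<tau>) / 2)"
  proof -
    have "(1 + \<tau>) / 2 / \<tau> = - ((1 + \<tau>') / 2) + of_int 0 * \<tau>' + of_int 1" by (simp add: \<tau>'_def field_simps)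
    moreover have "((1 + \<tau>) / 2)\<^sup>2 / (2 * \<tau>) = \<tau> / 8 - \<tau>' / 8 + 1 / 4"
      by (simp add: \<tau>'_def power2_eq_square field_simps)
    moreover have "jtheta \<tau>' (- ((1 + \<tau>') / 2) + of_int 0 * \<tau>' + of_int 1) = jtheta \<tau>' ((1 + \<tau>') / 2)"
      unfolding jtheta_lattice jtheta_uminus by (simp add: e2pi_half)
    ultimately show ?thesis using law[of "(1 + \<tau>) / 2"] by (simp only:)
  qed
  have "- (2 * e2pi (- \<tau>' / 4) * \<eta>' ^ 3) = jtheta \<tau>' (1 / 2) * (- jtheta \<tau>' (\<tau>' / 2)) * jtheta \<tau>' ((1 + \<tau>') / 2)"
    using jtheta_half_periods[OF \<tau>'] by (simp add: \<eta>'_def)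
  also have "\<dots> = C ^ 3 * (e2pi (\<tau> / 8) * e2pi (- \<tau>' / 8) * e2pi (\<tau> / 8 - \<tau>' / 8 + 1 / 4)) *
      (jtheta \<tau> (1 / 2) * jtheta \<tau> (\<tau> / 2) * jtheta \<tau> ((1 + \<tau>) / 2))"
    unfolding 1 2 3 by (simp only: power3_eq_cube mult_ac)
  also have "e2pi (\<tau> / 8) * e2pi (- \<tau>' / 8) * e2pi (\<tau> / 8 - \<tau>' / 8 + 1 / 4) = e2pi (\<tau> / 4) * (e2pi (- \<tau>' / 4) * e2pi (1 / 4))"
    unfolding e2pi_add[symmetric] by (intro arg_cong[of _ _ e2pi]) (simp add: field_simps)
  also have "e2pi (1 / 4) = \<i>"
    by (simp add: e2pi_def exp_eq_polar cis_conv_exp[symmetric] complex_eq_iff Re_exp Im_exp)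
  also have "jtheta \<tau> (1 / 2) * jtheta \<tau> (\<tau> / 2) * jtheta \<tau> ((1 + \<tau>) / 2) = 2 * e2pi (- \<tau> / 4) * \<eta> ^ 3"
    unfolding \<eta>_def by (rule jtheta_half_periods[OF \<tau>])
  also have "C ^ 3 * (e2pi (\<tau> / 4) * (e2pi (- \<tau>' / 4) * \<i>)) * (2 * e2pi (- \<tau> / 4) * \<eta> ^ 3) =
      2 * (e2pi (\<tau> / 4) * e2pi (- \<tau> / 4)) * e2pi (- \<tau>' / 4) * \<i> * C ^ 3 * \<eta> ^ 3"
    by (simp only: mult_ac)
  also have "e2pi (\<tau> / 4) * e2pi (- \<tau> / 4) = 1" unfolding e2pi_add[symmetric] by simp
  finally have "- (2 * e2pi (- \<tau>' / 4) * \<eta>' ^ 3) = 2 * 1 * e2pi (- \<tau>' / 4) * \<i> * C ^ 3 * \<eta> ^ 3" .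
  then have "(2 * e2pi (- \<tau>' / 4)) * (- (\<eta>' ^ 3)) = (2 * e2pi (- \<tau>' / 4)) * (\<i> * C ^ 3 * \<eta> ^ 3)"
    by (simp only: mult_ac mult_1 mult_minus_left mult_minus_right)
  then have "- (\<eta>' ^ 3) = \<i> * C ^ 3 * \<eta> ^ 3" by (subst (asm) mult_cancel_left) simp
  moreover have \<eta>'_eq: "\<eta>' ^ 3 = C * \<tau> * \<eta> ^ 3" using nz by (simp add: C_def)
  ultimately have "C * \<eta> ^ 3 * (- \<tau>) = C * \<eta> ^ 3 * (\<i> * C\<^sup>2)"
    by (simp add: power2_eq_square power3_eq_cube algebra_simps)
  moreover have "C * \<eta> ^ 3 \<noteq> 0" using nz by (simp add: C_def)
  ultimately have "- \<tau> = \<i> * C\<^sup>2" by (metis mult_left_cancel)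
  then have C2: "C\<^sup>2 = \<i> * \<tau>" by (metis add.inverse_inverse i_squared mult.assoc mult_minus_left mult_minus_right mult_1 power2_eq_square)
  have "\<eta>' ^ 6 = (\<eta>' ^ 3)\<^sup>2" by (simp flip: power_mult)
  also have "\<dots> = C\<^sup>2 * \<tau>\<^sup>2 * \<eta> ^ 6" unfolding \<eta>'_eq by (simp add: power_mult_distrib flip: power_mult)
  finally show ?thesis unfolding C2 by (simp add: \<eta>_def \<eta>'_def \<tau>'_def power2_eq_square power3_eq_cube)
qed

text \<open>
  The cube of the quotient \<open>\<eta>(-1/\<tau>)\<^sup>2 / \<tau>\<eta>(\<tau>)\<^sup>2\<close> is constant, so by connectedness of the upper half
  plane the quotient is constant too.
\<close>

lemma dedekind_eta_S_square:
  obtains K where "K \<noteq> 0" "\<And>\<tau>. \<tau> \<in> upper_half \<Longrightarrow> dedekind_eta (- 1 / \<tau>) ^ 2 = K * \<tau> * dedekind_eta \<tau> ^ 2"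
proof -
  define g where "g = (\<lambda>\<tau>. dedekind_eta (- 1 / \<tau>) ^ 2 / (\<tau> * dedekind_eta \<tau> ^ 2))"
  have nz: "\<tau> \<noteq> 0" "dedekind_eta \<tau> \<noteq> 0" if "\<tau> \<in> upper_half" for \<tau>
    using that dedekind_eta_nonzero by (auto simp: upper_half_def)
  have "continuous_on upper_half (dedekind_eta \<circ> (\<lambda>\<tau>. - 1 / \<tau>))"
    by (intro continuous_on_compose continuous_intros continuous_on_subset[OF dedekind_eta_continuous])
       (use nz neg_inverse_upper_half in auto)
  then have c: "continuous_on upper_half g"
    unfolding g_def o_def by (intro continuous_intros dedekind_eta_continuous) (use nz in auto)
  have g3: "g \<tau> ^ 3 = \<i>" if "\<tau> \<in> upper_half" for \<tau>
    using dedekind_eta_S_pow6[OF that] nz[OF that]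
    by (simp add: g_def power_divide power_mult_distrib flip: power_mult)
  obtain K where K: "\<And>\<tau>. \<tau> \<in> upper_half \<Longrightarrow> g \<tau> = K"
    using constant_if_power_constant[OF c _ g3] by auto
  show ?thesis
  proof (rule that)
    have "\<i> \<in> upper_half" by (simp add: upper_half_def)
    then show "K \<noteq> 0" using g3 K by fastforce
    show "dedekind_eta (- 1 / \<tau>) ^ 2 = K * \<tau> * dedekind_eta \<tau> ^ 2" if "\<tau> \<in> upper_half" for \<tau>
      using K[OF that] nz[OF that] by (simp add: g_def field_simps)
  qed
qed

lemma dedekind_eta_translate: "dedekind_eta (\<tau> + of_int n) = e2pi (of_int n / 24) * dedekind_eta \<tau>"
  by (simp add: dedekind_eta_eq e2pi_add add_divide_distrib)

text \<open>
  Working with \<open>\<eta>\<^sup>2\<close> avoids all choices of square roots, so that the law is closed under composition.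
  The induction is the Euclidean algorithm on the bottom row: multiplication by a power of \<open>T\<close> and by \<open>S\<close>
  replaces \<open>c\<close> by \<open>d mod c\<close>.
\<close>

lemma dedekind_eta_square_modular:
  assumes "a * d - b * c = (1::int)"
  shows "\<exists>K. K \<noteq> 0 \<and> (\<forall>\<tau>\<in>upper_half. dedekind_eta (mobius a b c d \<tau>) ^ 2 =
           K * (of_int c * \<tau> + of_int d) * dedekind_eta \<tau> ^ 2)"
  using assms
proof (induction "nat \<bar>c\<bar>" arbitrary: a b c d rule: less_induct)
  case less
  obtain KS where KS: "KS \<noteq> 0" "\<And>\<tau>. \<tau> \<in> upper_half \<Longrightarrow> dedekind_eta (- 1 / \<tau>) ^ 2 = KS * \<tau> * dedekind_eta \<tau> ^ 2"
    using dedekind_eta_S_square by metis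
  show ?case
  proof (cases "c = 0")
    case True
    then have "a * d = 1" using less.prems by simp
    then have ad: "a = d" "d = 1 \<or> d = -1" by (auto simp: zmult_eq_1_iff)
    have "mobius a b c d \<tau> = \<tau> + of_int (b * d)" for \<tau>
      using True ad by (auto simp: mobius_def field_simps)
    then have "dedekind_eta (mobius a b c d \<tau>) ^ 2 = (e2pi (of_int (b * d) / 24) ^ 2 / of_int d) *
         (of_int c * \<tau> + of_int d) * dedekind_eta \<tau> ^ 2" for \<tau>
      using True ad by (auto simp: dedekind_eta_translate power_mult_distrib simp del: of_int_mult)
    moreover have "e2pi (of_int (b * d) / 24) ^ 2 / of_int d \<noteq> 0" using ad by auto
    ultimately show ?thesis by blast
  next
    case False
    define k where "k = - (d div c)"
    define d' where "d' = d + k * c"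
    have d': "d' = d mod c" unfolding d'_def k_def by (simp add: minus_div_mult_eq_mod)
    have "nat \<bar>d'\<bar> < nat \<bar>c\<bar>" unfolding d' using False abs_mod_less[of c d] by simp
    moreover have "(b + k * a) * (- c) - (- a) * d' = 1"
      using less.prems by (simp add: d'_def algebra_simps)
    ultimately obtain KB where KB: "KB \<noteq> 0" "\<And>\<tau>. \<tau> \<in> upper_half \<Longrightarrow>
       dedekind_eta (mobius (b + k * a) (- a) d' (- c) \<tau>) ^ 2 = KB * (of_int d' * \<tau> + of_int (- c)) * dedekind_eta \<tau> ^ 2"
      using less.hyps[of d' "b + k * a" "- c" "- a"] by blast
    define E where "E = e2pi (of_int (- k) / 24) ^ 2"
    have "dedekind_eta (mobius a b c d \<tau>) ^ 2 = (- KB * KS * E) * (of_int c * \<tau> + of_int d) * dedekind_eta \<tau> ^ 2"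
      if \<tau>: "\<tau> \<in> upper_half" for \<tau>
    proof -
      \<comment> \<open>The given matrix sends \<open>\<tau>\<close> where the smaller one sends \<open>-1/\<rho>\<close>.\<close>
      define \<rho> where "\<rho> = \<tau> + of_int (- k)"
      have \<rho>: "\<rho> \<in> upper_half" using \<tau> by (simp add: \<rho>_def upper_half_def)
      then have \<rho>0: "\<rho> \<noteq> 0" by (auto simp: upper_half_def)
      have mult_\<rho>: "(x * (- 1 / \<rho>) + y) * \<rho> = - x + y * \<rho>" for x y
        using \<rho>0 by (simp add: field_simps)
      have j: "(of_int d' * (- 1 / \<rho>) + of_int (- c)) * \<rho> = - (of_int c * \<tau> + of_int d)"
        unfolding mult_\<rho> by (simp add: d'_def \<rho>_def algebra_simps)
      have n: "(of_int (b + k * a) * (- 1 / \<rho>) + of_int (- a)) * \<rho> = - (of_int a * \<tau> + of_int b)"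
        unfolding mult_\<rho> by (simp add: \<rho>_def algebra_simps)
      have "mobius (b + k * a) (- a) d' (- c) (- 1 / \<rho>) =
         ((of_int (b + k * a) * (- 1 / \<rho>) + of_int (- a)) * \<rho>) / ((of_int d' * (- 1 / \<rho>) + of_int (- c)) * \<rho>)"
        unfolding mobius_def using \<rho>0 by simp
      also have "\<dots> = mobius a b c d \<tau>" unfolding j n mobius_def by (rule minus_divide_divide)
      finally have "dedekind_eta (mobius a b c d \<tau>) ^ 2 =
         KB * (of_int d' * (- 1 / \<rho>) + of_int (- c)) * dedekind_eta (- 1 / \<rho>) ^ 2"
        using KB(2)[OF neg_inverse_upper_half[OF \<rho>]] by simp
      also have "\<dots> = KB * KS * ((of_int d' * (- 1 / \<rho>) + of_int (- c)) * \<rho>) * dedekind_eta \<rho> ^ 2"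
        unfolding KS(2)[OF \<rho>] by (simp only: mult_ac)
      also have "dedekind_eta \<rho> ^ 2 = E * dedekind_eta \<tau> ^ 2"
        unfolding \<rho>_def dedekind_eta_translate E_def by (simp only: power_mult_distrib)
      finally show ?thesis unfolding j by (simp only: mult_ac mult_minus_left mult_minus_right)
    qed
    moreover have "- KB * KS * E \<noteq> 0" using KB(1) KS(1) by (simp add: E_def)
    ultimately show ?thesis by blast
  qed
qed

text \<open>
  The quotient of \<open>\<eta>(A\<tau>)\<close> by \<open>\<surd>(c\<tau>+d) \<eta>(\<tau>)\<close> is continuous and has a constant square, so it is constant;
  that constant is what the definite description in \<open>eta_mult\<close> picks out. The principal root is
  continuous along \<open>c\<tau> + d\<close>: for \<open>c \<noteq> 0\<close> the branch cut is never met, and for \<open>c = 0\<close> the argument is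
  constant.
\<close>

lemma dedekind_eta_modular:
  assumes det: "a * d - b * c = (1::int)" and \<tau>: "\<tau> \<in> upper_half"
  shows "dedekind_eta (mobius a b c d \<tau>) =
           eta_mult a b c d * csqrt (of_int c * \<tau> + of_int d) * dedekind_eta \<tau>"
proof -
  let ?j = "\<lambda>\<tau>. of_int c * \<tau> + of_int d :: complex"
  obtain K where K: "\<And>\<tau>. \<tau> \<in> upper_half \<Longrightarrow> dedekind_eta (mobius a b c d \<tau>) ^ 2 = K * ?j \<tau> * dedekind_eta \<tau> ^ 2"
    using dedekind_eta_square_modular[OF det] by blast
  define g where "g = (\<lambda>\<tau>. dedekind_eta (mobius a b c d \<tau>) / (csqrt (?j \<tau>) * dedekind_eta \<tau>))"
  have nz: "?j \<tau> \<noteq> 0" "dedekind_eta \<tau> \<noteq> 0" if "\<tau> \<in> upper_half" for \<tau>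
    using that dedekind_eta_nonzero mobius_props(1)[OF det that] by auto
  have "continuous_on upper_half (dedekind_eta \<circ> mobius a b c d)"
    unfolding mobius_def
    by (intro continuous_on_compose continuous_intros continuous_on_subset[OF dedekind_eta_continuous])
       (use nz mobius_props(2)[OF det] in \<open>auto simp: mobius_def\<close>)
  moreover have "continuous_on upper_half (\<lambda>\<tau>. csqrt (?j \<tau>))"
  proof (cases "c = 0")
    case False
    have "?j \<tau> \<notin> \<real>\<^sub>\<le>\<^sub>0" if "\<tau> \<in> upper_half" for \<tau>
      using that False by (auto simp: complex_nonpos_Reals_iff upper_half_def)
    then show ?thesis
      by (intro continuous_on_compose2[OF continuous_on_csqrt] continuous_intros) auto
  qed auto
  ultimately have c: "continuous_on upper_half g"
    unfolding g_def o_def by (intro continuous_intros dedekind_eta_continuous) (use nz in auto)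
  have g2: "g \<tau> ^ 2 = K" if "\<tau> \<in> upper_half" for \<tau>
    using K[OF that] nz[OF that] by (simp add: g_def power_divide power_mult_distrib)
  obtain w where "\<And>\<tau>. \<tau> \<in> upper_half \<Longrightarrow> g \<tau> = w"
    using constant_if_power_constant[OF c _ g2] by auto
  then have w: "\<forall>\<tau>\<in>upper_half. dedekind_eta (mobius a b c d \<tau>) = w * csqrt (?j \<tau>) * dedekind_eta \<tau>"
    using nz by (auto simp: g_def field_simps)
  have "eta_mult a b c d = w"
    unfolding eta_mult_def
  proof (rule the_equality)
    show "\<forall>\<tau>\<in>upper_half. dedekind_eta (mobius a b c d \<tau>) = w * csqrt (?j \<tau>) * dedekind_eta \<tau>"
      by (rule w)
  next
    fix w' assume "\<forall>\<tau>\<in>upper_half. dedekind_eta (mobius a b c d \<tau>) = w' * csqrt (?j \<tau>) * dedekind_eta \<tau>"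
    then have "w' * csqrt (?j \<tau>) * dedekind_eta \<tau> = w * csqrt (?j \<tau>) * dedekind_eta \<tau>"
      using w \<tau> by (metis (no_types, lifting))
    then show "w' = w" using nz[OF \<tau>] by simp
  qed
  then show ?thesis using w \<tau> by simp
qed

text \<open>
  Cubing the modular law of \<open>\<eta>\<close> produces \<open>\<surd>j\<^sup>3 = j \<surd>j\<close>, and the factor \<open>j\<close> cancels.
\<close>

lemma jtheta_modular_eta_mult:
  assumes det: "a * d - b * c = 1" and \<tau>: "\<tau> \<in> upper_half"
  defines "j \<equiv> of_int c * \<tau> + of_int d"
  shows "jtheta (mobius a b c d \<tau>) (z / j) =
           eta_mult a b c d ^ 3 * csqrt j * e2pi (of_int c * z\<^sup>2 / (2 * j)) * jtheta \<tau> z"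
proof -
  have j: "j \<noteq> 0" using mobius_props(1)[OF det \<tau>] by (simp add: j_def)
  have "csqrt j ^ 3 = j * csqrt j" by (simp add: power3_eq_cube flip: power2_eq_square)
  then show ?thesis
    using jtheta_modular[OF det \<tau>, of z] dedekind_eta_nonzero[OF \<tau>] j
    unfolding dedekind_eta_modular[OF det \<tau>] j_def[symmetric]
    by (simp add: power_mult_distrib mult.assoc)
qed

section \<open>The function \<open>\<theta>\<^bsub>3/2\<^esub>\<close> as a theta series\<close>

definition chi12 :: "int \<Rightarrow> complex" where
  "chi12 n = (if n mod 12 \<in> {1, 11} then 1 else if n mod 12 \<in> {5, 7} then -1 else 0)"

lemma exp_bounded_chi12: "exp_bounded chi12"
  by (rule exp_bounded_if_le_1) (simp add: chi12_def)

text \<open>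
  Arithmetic of the character modulo 12 is checked on these twelve residues.
\<close>

lemma residue_12: "\<exists>k r. (n::int) = r + 12 * k \<and> r \<in> {0, 1, 2, 3, 4, 5, 6, 7, 8, 9, 10, 11}"
proof (intro exI conjI)
  show "n = n mod 12 + 12 * (n div 12)" by simp
  have "x \<in> {0, 1, 2, 3, 4, 5, 6, 7, 8, 9, 10, 11}" if "0 \<le> x" "x < 12" for x :: int
    using that by (simp, presburger)
  then show "n mod 12 \<in> {0, 1, 2, 3, 4, 5, 6, 7, 8, 9, 10, 11}" by simp
qed

lemma chi12_periodic: "chi12 (r + 12 * k) = chi12 r"
  by (simp add: chi12_def)

lemma chi12_uminus: "chi12 (- n) = 1 * chi12 n"
proof -
  obtain k r where n: "n = r + 12 * k" and r: "r \<in> {0, 1, 2, 3, 4, 5, 6, 7, 8, 9, 10, 11}"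
    using residue_12 by blast
  have "chi12 (- n) = chi12 (- r)" using chi12_periodic[of "- r" "- k"] by (simp add: n)
  also have "\<dots> = chi12 r" using r by (auto simp: chi12_def)
  also have "\<dots> = chi12 n" unfolding n by (rule chi12_periodic[symmetric])
  finally show ?thesis by simp
qed

lemma chi12_add6: "chi12 (n + 2 * int 3) = - chi12 n"
proof -
  obtain k r where n: "n = r + 12 * k" and r: "r \<in> {0, 1, 2, 3, 4, 5, 6, 7, 8, 9, 10, 11}"
    using residue_12 by blast
  have "chi12 (n + 2 * int 3) = chi12 (r + 6)" using chi12_periodic[of "r + 6" k] by (simp add: n add_ac)
  also have "\<dots> = - chi12 r" using r by (auto simp: chi12_def)
  also have "chi12 r = chi12 n" unfolding n by (rule chi12_periodic[symmetric])
  finally show ?thesis .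
qed

lemma chi12_not_coprime_6: "even n \<or> 3 dvd n \<Longrightarrow> chi12 n = 0"
proof -
  assume "even n \<or> 3 dvd n"
  then have "even (n mod 12) \<or> 3 dvd n mod 12" by (simp add: dvd_mod_iff)
  then show ?thesis by (auto simp: chi12_def)
qed

lemma chi12_3n2: "chi12 (3 * n + 2) = - kronecker_m4 n"
proof -
  define s where "s = n mod 4"
  have "n = s + 4 * (n div 4)" by (simp add: s_def)
  then have "3 * n + 2 = (3 * s + 2) + 12 * (n div 4)" by linarith
  then have "chi12 (3 * n + 2) = chi12 (3 * s + 2)" by (simp only: chi12_periodic)
  also have "s = 0 \<or> s = 1 \<or> s = 2 \<or> s = 3" unfolding s_def by presburger
  then have "chi12 (3 * s + 2) = (if s = 1 then - 1 else if s = 3 then 1 else 0)"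
    by (auto simp: chi12_def)
  finally show ?thesis by (simp add: kronecker_m4_def s_def)
qed

definition theta32 :: "complex \<Rightarrow> complex \<Rightarrow> complex" where
  "theta32 \<tau> z = theta_series 3 chi12 \<tau> z"

text \<open>
  The integers prime to 3 form the classes \<open>3n + 2\<close> and \<open>-(3n + 2)\<close>, which contribute equally, and each
  half is the series of the pentagonal number theorem.
\<close>

lemma theta32_0:
  assumes \<tau>: "\<tau> \<in> upper_half"
  shows "theta32 \<tau> 0 = 2 * dedekind_eta \<tau>"
proof -
  define T where "T = theta_term 3 chi12 \<tau> 0"
  define A where "A = range (\<lambda>n::int. 3 * n + 2)"
  define B where "B = range (\<lambda>n::int. - (3 * n + 2))"
  have sT: "T summable_on X" for X
    using theta_series_has_sum[OF _ exp_bounded_chi12 \<tau>, of 3 0]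
    by (auto simp: T_def intro: summable_on_subset_banach has_sum_imp_summable)
  have disj: "A \<inter> B = {}" unfolding A_def B_def by (auto, presburger)
  have "T n = 0" if "n \<notin> A \<union> B" for n
  proof -
    have "n \<noteq> 3 * ((n - 2) div 3) + 2" "n \<noteq> - (3 * ((- n - 2) div 3) + 2)"
      using that unfolding A_def B_def by blast+
    then have "3 dvd n" by presburger
    then show ?thesis by (simp add: T_def theta_term_def chi12_not_coprime_6)
  qed
  then have "theta32 \<tau> 0 = infsum T (A \<union> B)"
    unfolding theta32_def theta_series_def T_def[symmetric] by (intro infsum_cong_neutral) auto
  also have "\<dots> = infsum T A + infsum T B"
    by (intro infsum_Un_disjoint sT disj)
  also have "infsum T A = (\<Sum>\<^sub>\<infinity>n. T (3 * n + 2))"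
    unfolding A_def by (subst infsum_reindex) (auto simp: inj_on_def o_def)
  also have "infsum T B = (\<Sum>\<^sub>\<infinity>n. T (- (3 * n + 2)))"
    unfolding B_def by (subst infsum_reindex) (auto simp: inj_on_def o_def)
  also have "(\<lambda>n. T (- (3 * n + 2))) = (\<lambda>n. T (3 * n + 2))"
  proof -
    have "T (- m) = T m" for m using chi12_uminus[of m] by (simp add: T_def theta_term_def)
    then show ?thesis by (simp only:)
  qed
  also have "(\<lambda>n. T (3 * n + 2)) = (\<lambda>n. - e2pi (\<tau> / 6) * theta_term 1 kronecker_m4 (3 * \<tau>) \<tau> n)"
  proof
    fix n :: int
    have "(of_int (3 * n + 2))\<^sup>2 * \<tau> / (8 * of_real 3) + of_int (3 * n + 2) * 0 / 2 =
        \<tau> / 6 + ((of_int n)\<^sup>2 * (3 * \<tau>) / (8 * of_real 1) + of_int n * \<tau> / 2)"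
      by (simp add: field_simps power2_eq_square)
    then show "T (3 * n + 2) = - e2pi (\<tau> / 6) * theta_term 1 kronecker_m4 (3 * \<tau>) \<tau> n"
      unfolding T_def theta_term_def chi12_3n2 by (simp only: e2pi_add mult_ac mult_minus_left mult_minus_right)
  qed
  also have "(\<Sum>\<^sub>\<infinity>n. - e2pi (\<tau> / 6) * theta_term 1 kronecker_m4 (3 * \<tau>) \<tau> n) = - e2pi (\<tau> / 6) * jtheta (3 * \<tau>) \<tau>"
    unfolding jtheta_eq_theta_series theta_series_def by (rule infsum_cmult_right')
  also have "\<dots> = (e2pi (\<tau> / 6) * e2pi (- \<tau> / 6)) * dedekind_eta \<tau>"
    by (simp add: jtheta_3tau_tau[OF \<tau>])
  also have "e2pi (\<tau> / 6) * e2pi (- \<tau> / 6) = 1" unfolding e2pi_add[symmetric] by simp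
  finally show ?thesis by simp
qed

lemma theta32_uminus: "theta32 \<tau> (- z) = theta32 \<tau> z"
  using theta_series_uminus[of chi12 1, OF chi12_uminus, of 3 \<tau> z] by (simp add: theta32_def)

lemma theta32_lattice: "theta32 \<tau> (z + of_int x * \<tau> + of_int y) =
     e2pi (of_int (x + y) / 2 - 3 * ((of_int x)\<^sup>2 * \<tau> / 2 + of_int x * z)) * theta32 \<tau> z"
  using theta_series_lattice[of 3 chi12, OF _ chi12_add6 chi12_not_coprime_6[OF disjI1], of \<tau> z x y]
  by (simp add: theta32_def)

lemma theta32_holomorphic: "\<tau> \<in> upper_half \<Longrightarrow> theta32 \<tau> holomorphic_on A"
  using theta_series_has_field_derivative[of 3 chi12 \<tau>] exp_bounded_chi12
  unfolding theta32_def[abs_def] holomorphic_on_def field_differentiable_def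
  by (meson has_field_derivative_at_within zero_less_numeral)

text \<open>
  By evenness and the translation law the value at a half period equals its own negative.
\<close>

lemma theta32_half_period:
  assumes "\<not> (even m \<and> even n)"
  shows "theta32 \<tau> ((of_int m + of_int n * \<tau>) / 2) = 0"
proof -
  define z where "z = (of_int m + of_int n * \<tau>) / 2"
  have z2: "2 * z = of_int m + of_int n * \<tau>" by (simp add: z_def)
  have "- z = z + of_int (- n) * \<tau> + of_int (- m)" using z2 by (simp add: algebra_simps)
  then have "theta32 \<tau> z = theta32 \<tau> (z + of_int (- n) * \<tau> + of_int (- m))" by (metis theta32_uminus)
  also have "\<dots> = e2pi (of_int (3 * n * m - n - m) / 2) * theta32 \<tau> z"
    unfolding theta32_lattice
    by (intro arg_cong2[of _ _ _ _ "(*)"] arg_cong[of _ _ e2pi]) (auto simp: z_def field_simps power2_eq_square)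
  also have "e2pi (of_int (3 * n * m - n - m) / 2) = -1"
    by (rule e2pi_half_odd) (use assms in auto)
  finally show ?thesis by (simp add: z_def)
qed

text \<open>
  A form of the quintuple product identity. Both sides have the same multipliers, and the left-hand side
  vanishes at all half periods, where \<open>\<theta>(\<tau>,2z)\<close> has its simple zeros: at lattice points through \<open>\<theta>\<close>, at
  the other half periods through the series. The derivative at \<open>0\<close> determines the factor.
\<close>

theorem theta32_times_jtheta:
  assumes \<tau>: "\<tau> \<in> upper_half"
  shows "theta32 \<tau> z * jtheta \<tau> z = dedekind_eta \<tau> * jtheta \<tau> (2 * z)"
proof -
  have dg: "((\<lambda>z. jtheta \<tau> (2 * z)) has_field_derivative 2 * deriv (jtheta \<tau>) (2 * z)) (at z)" for z
  proof -
    have "((\<lambda>z. 2 * z) has_field_derivative 2) (at z)" by (auto intro!: derivative_eq_intros)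
    from DERIV_chain'[OF this jtheta_has_deriv[OF \<tau>]] show ?thesis by (simp only: mult_ac)
  qed
  obtain C where C: "\<And>z. theta32 \<tau> z * jtheta \<tau> z = C * jtheta \<tau> (2 * z)"
  proof (rule proportional_if_same_multipliers[OF \<tau>,
        of "\<lambda>z. theta32 \<tau> z * jtheta \<tau> z" "\<lambda>z. jtheta \<tau> (2 * z)" "\<lambda>_. 1" "\<lambda>z. e2pi (1 - (2 * \<tau> + 4 * z))"])
    show "(\<lambda>z. theta32 \<tau> z * jtheta \<tau> z) holomorphic_on UNIV"
      by (intro holomorphic_intros theta32_holomorphic jtheta_holomorphic \<tau>)
    show "(\<lambda>z. jtheta \<tau> (2 * z)) holomorphic_on UNIV"
      using dg by (meson field_differentiable_at_within field_differentiable_def holomorphic_on_def)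
    fix z
    show "theta32 \<tau> (z + 1) * jtheta \<tau> (z + 1) = 1 * (theta32 \<tau> z * jtheta \<tau> z)"
      using theta32_lattice[of \<tau> z 0 1] jtheta_lattice[of \<tau> z 0 1] by (simp add: e2pi_half)
    show "jtheta \<tau> (2 * (z + 1)) = 1 * jtheta \<tau> (2 * z)"
      using jtheta_lattice[of \<tau> "2 * z" 0 2] e2pi_of_int[of 1] by (simp add: ring_distribs)
    show "theta32 \<tau> (z + \<tau>) * jtheta \<tau> (z + \<tau>) = e2pi (1 - (2 * \<tau> + 4 * z)) * (theta32 \<tau> z * jtheta \<tau> z)"
    proof -
      have "theta32 \<tau> (z + \<tau>) * jtheta \<tau> (z + \<tau>) =
         (e2pi (1 / 2 - 3 * (\<tau> / 2 + z)) * e2pi (1 / 2 - (\<tau> / 2 + z))) * (theta32 \<tau> z * jtheta \<tau> z)"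
        using theta32_lattice[of \<tau> z 1 0] jtheta_lattice[of \<tau> z 1 0] by simp
      also have "e2pi (1 / 2 - 3 * (\<tau> / 2 + z)) * e2pi (1 / 2 - (\<tau> / 2 + z)) = e2pi (1 - (2 * \<tau> + 4 * z))"
        unfolding e2pi_add[symmetric] by (intro arg_cong[of _ _ e2pi]) (simp add: field_simps)
      finally show ?thesis .
    qed
    show "jtheta \<tau> (2 * (z + \<tau>)) = e2pi (1 - (2 * \<tau> + 4 * z)) * jtheta \<tau> (2 * z)"
      using jtheta_lattice[of \<tau> "2 * z" 2 0] by (simp add: ring_distribs)
    assume 0: "jtheta \<tau> (2 * z) = 0"
    then obtain m n :: int where mn: "2 * z = of_int m + of_int n * \<tau>"
      using jtheta_zeroD[OF \<tau>] by blast
    have "theta32 \<tau> z * jtheta \<tau> z = 0"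
    proof (cases "even m \<and> even n")
      case True
      then obtain m' n' where "m = 2 * m'" "n = 2 * n'" by (auto elim!: evenE)
      then have "2 * z = 2 * (of_int m' + of_int n' * \<tau>)" using mn by (simp add: algebra_simps)
      then have "z = of_int m' + of_int n' * \<tau>" by (subst (asm) mult_cancel_left) simp
      then show ?thesis by (simp add: jtheta_lattice_0)
    next
      case False
      have "z = (of_int m + of_int n * \<tau>) / 2" by (simp add: mn[symmetric])
      then have "theta32 \<tau> z = 0" using theta32_half_period[OF False, of \<tau>] by (simp only:)
      then show ?thesis by simp
    qed
    moreover have "deriv (\<lambda>z. jtheta \<tau> (2 * z)) z \<noteq> 0"
      using DERIV_imp_deriv[OF dg, of z] jtheta_simple_zero[OF \<tau> 0] by simp
    ultimately show "theta32 \<tau> z * jtheta \<tau> z = 0 \<and> deriv (\<lambda>z. jtheta \<tau> (2 * z)) z \<noteq> 0" by simp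
  qed auto
  have d0: "deriv (jtheta \<tau>) 0 = 2 * pi * \<i> * dedekind_eta \<tau> ^ 3"
    by (rule DERIV_imp_deriv[OF jtheta_deriv_0[OF \<tau>]])
  have "(theta32 \<tau> has_field_derivative deriv (theta32 \<tau>) 0) (at 0)"
    using holomorphic_derivI[OF theta32_holomorphic[OF \<tau>, of UNIV]] by simp
  from DERIV_mult[OF this jtheta_has_deriv[OF \<tau>]]
  have "((\<lambda>z. theta32 \<tau> z * jtheta \<tau> z) has_field_derivative deriv (jtheta \<tau>) 0 * theta32 \<tau> 0) (at 0)"
    by simp
  moreover have "((\<lambda>z. theta32 \<tau> z * jtheta \<tau> z) has_field_derivative C * (2 * deriv (jtheta \<tau>) (2 * 0))) (at 0)"
    unfolding C by (rule DERIV_cmult[OF dg])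
  ultimately have "deriv (jtheta \<tau>) 0 * theta32 \<tau> 0 = C * (2 * deriv (jtheta \<tau>) (2 * 0))"
    by (rule DERIV_unique)
  then have "C = dedekind_eta \<tau>"
    using dedekind_eta_nonzero[OF \<tau>] by (simp add: theta32_0[OF \<tau>] d0)
  then show ?thesis using C by simp
qed

lemma jtheta_nonzero_nearby:
  assumes "\<tau> \<in> upper_half" shows "\<forall>\<^sub>F w in at z. jtheta \<tau> w \<noteq> 0"
proof -
  have "(1 / 2 :: complex) \<noteq> of_int a + of_int b * \<tau>" for a b :: int
  proof
    assume eq: "(1 / 2 :: complex) = of_int a + of_int b * \<tau>"
    from arg_cong[OF eq, of Im] have "b = 0" using assms by (simp add: upper_half_def)
    then have "2 * a = 1" using arg_cong[OF eq, of Re] by (simp add: field_simps)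
    then show False by presburger
  qed
  then have "jtheta \<tau> (1 / 2) \<noteq> 0" using jtheta_zeroD[OF assms] by blast
  then show ?thesis
    using non_zero_neighbour_alt[OF jtheta_holomorphic[OF assms, of UNIV], of z "1 / 2"] connected_UNIV by simp
qed

text \<open>
  Zeros of \<open>\<theta>\<close> are isolated, so the factor can be cancelled by continuity.
\<close>

lemma eq_if_jtheta_mult_eq:
  assumes \<tau>: "\<tau> \<in> upper_half" and "isCont u z" "isCont v z"
    and eq: "\<And>z. u z * jtheta \<tau> z = v z * jtheta \<tau> z"
  shows "u z = v z"
proof (rule tendsto_unique[of "at z" u])
  have "\<forall>\<^sub>F w in at z. v w = u w"
    using jtheta_nonzero_nearby[OF \<tau>, of z] by eventually_elim (metis eq mult_right_cancel)
  then show "u \<midarrow>z\<rightarrow> v z" using assms(3) unfolding isCont_def by (rule Lim_transform_eventually[rotated])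
  show "u \<midarrow>z\<rightarrow> u z" using assms(2) by (simp add: isCont_def)
qed auto

lemma theta32_isCont: "\<tau> \<in> upper_half \<Longrightarrow> isCont (theta32 \<tau>) z"
  using holomorphic_on_imp_continuous_on[OF theta32_holomorphic[of \<tau> UNIV]]
  by (simp add: continuous_on_eq_continuous_at)

lemma jtheta32_eq_theta32:
  assumes \<tau>: "\<tau> \<in> upper_half"
  shows "jtheta32 \<tau> z = theta32 \<tau> z"
  unfolding jtheta32_def
proof (rule remove_sings_eqI)
  have "\<forall>\<^sub>F w in at z. theta32 \<tau> w = dedekind_eta \<tau> * jtheta \<tau> (2 * w) / jtheta \<tau> w"
    using jtheta_nonzero_nearby[OF \<tau>, of z]
    by eventually_elim (simp add: theta32_times_jtheta[OF \<tau>, symmetric])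
  then show "(\<lambda>w. dedekind_eta \<tau> * jtheta \<tau> (2 * w) / jtheta \<tau> w) \<midarrow>z\<rightarrow> theta32 \<tau> z"
    using theta32_isCont[OF \<tau>, of z] unfolding isCont_def by (rule Lim_transform_eventually[rotated])
qed

text \<open>
  The modular laws of \<open>\<eta>\<close>, \<open>\<theta>(\<tau>,z)\<close> and \<open>\<theta>(\<tau>,2z)\<close> combine: the multipliers give \<open>w w\<^sup>3/w\<^sup>3\<close> and the indices give
  \<open>4 - 1 = 3\<close>.
\<close>

lemma theta32_modular:
  assumes det: "a * d - b * c = 1" and \<tau>: "\<tau> \<in> upper_half"
  defines "j \<equiv> of_int c * \<tau> + of_int d"
  shows "theta32 (mobius a b c d \<tau>) (z / j) =
           eta_mult a b c d * csqrt j * e2pi (3 * of_int c * z\<^sup>2 / (2 * j)) * theta32 \<tau> z"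
proof -
  define \<tau>' where "\<tau>' = mobius a b c d \<tau>"
  define w where "w = eta_mult a b c d"
  have j: "j \<noteq> 0" using mobius_props(1)[OF det \<tau>] by (simp add: j_def)
  have \<tau>': "\<tau>' \<in> upper_half" unfolding \<tau>'_def by (rule mobius_props(2)[OF det \<tau>])
  have eta: "dedekind_eta \<tau>' = w * csqrt j * dedekind_eta \<tau>"
    unfolding \<tau>'_def w_def j_def by (rule dedekind_eta_modular[OF det \<tau>])
  have w0: "w ^ 3 * csqrt j \<noteq> 0" using eta dedekind_eta_nonzero[OF \<tau>'] by auto
  define e where "e = (\<lambda>z. e2pi (of_int c * z\<^sup>2 / (2 * j)))"
  have th: "jtheta \<tau>' (z / j) = w ^ 3 * csqrt j * e z * jtheta \<tau> z" for z
    unfolding \<tau>'_def w_def j_def e_def by (rule jtheta_modular_eta_mult[OF det \<tau>])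
  define u where "u = (\<lambda>z. theta32 \<tau>' (z / j))"
  define v where "v = (\<lambda>z. w * csqrt j * e2pi (3 * of_int c * z\<^sup>2 / (2 * j)) * theta32 \<tau> z)"
  have "u z = v z" for z
  proof (rule eq_if_jtheta_mult_eq[OF \<tau>, where u = u and v = v])
    show "isCont u z" unfolding u_def
      by (rule isCont_o2[OF _ theta32_isCont[OF \<tau>']]) (use j in \<open>auto intro!: continuous_intros\<close>)
    show "isCont v z" unfolding v_def e2pi_def
      using j by (intro continuous_intros theta32_isCont[OF \<tau>]) auto
    fix z
    have e4: "e (2 * z) = e z * e2pi (3 * of_int c * z\<^sup>2 / (2 * j))"
      unfolding e_def e2pi_add[symmetric] using j by (intro arg_cong[of _ _ e2pi]) (simp add: field_simps)
    have "w ^ 3 * csqrt j * e z * (u z * jtheta \<tau> z) = u z * jtheta \<tau>' (z / j)"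
      by (simp add: th mult_ac)
    also have "\<dots> = dedekind_eta \<tau>' * jtheta \<tau>' (2 * z / j)"
      unfolding u_def using theta32_times_jtheta[OF \<tau>', of "z / j"] by simp
    also have "\<dots> = w * csqrt j * dedekind_eta \<tau> * (w ^ 3 * csqrt j * e (2 * z) * jtheta \<tau> (2 * z))"
      unfolding eta th ..
    also have "\<dots> = w ^ 3 * csqrt j * e z * (w * csqrt j * e2pi (3 * of_int c * z\<^sup>2 / (2 * j)) * (dedekind_eta \<tau> * jtheta \<tau> (2 * z)))"
      unfolding e4 by (simp only: mult_ac)
    also have "\<dots> = w ^ 3 * csqrt j * e z * (v z * jtheta \<tau> z)"
      unfolding theta32_times_jtheta[OF \<tau>, symmetric] v_def by (simp only: mult_ac)
    finally have "w ^ 3 * csqrt j * e z * (u z * jtheta \<tau> z) = w ^ 3 * csqrt j * e z * (v z * jtheta \<tau> z)" .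
    moreover have "w ^ 3 * csqrt j * e z \<noteq> 0" using w0 by (simp add: e_def)
    ultimately show "u z * jtheta \<tau> z = v z * jtheta \<tau> z" by (metis mult_left_cancel)
  qed
  then show ?thesis by (simp add: u_def v_def w_def \<tau>'_def)
qed

section \<open>Uniqueness of Fourier expansions\<close>

lemma sum_roots_of_unity:
  assumes "M > 0"
  shows "(\<Sum>j<M. e2pi (of_nat j * of_int c / of_nat M)) = (if int M dvd c then of_nat M else 0)"
proof -
  define x where "x = e2pi (of_int c / of_nat M)"
  have x: "e2pi (of_nat j * of_int c / of_nat M) = x ^ j" for j
    by (simp add: x_def e2pi_power)
  have xM: "x ^ M = 1" using assms by (simp add: x_def e2pi_power)
  have x1: "x = 1 \<longleftrightarrow> int M dvd c"
  proof
    assume "x = 1"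
    then obtain n :: int where "of_int c / of_nat M = (of_int n :: complex)"
      by (auto simp: x_def e2pi_eq_1_iff)
    then have "(of_int c :: complex) = of_int (n * int M)" using assms by (simp add: field_simps)
    then have "c = n * int M" by (simp only: of_int_eq_iff)
    then show "int M dvd c" by simp
  next
    assume "int M dvd c"
    then obtain n where "c = int M * n" by (elim dvdE)
    then have "of_int c / of_nat M = (of_int n :: complex)" using assms by simp
    then show "x = 1" by (simp add: x_def)
  qed
  show ?thesis
  proof (cases "x = 1")
    case True
    then show ?thesis using x1 by (simp add: x)
  next
    case False
    then show ?thesis using x1 xM by (simp add: x geometric_sum)
  qed
qed

lemma has_sum_sum_finite:
  fixes f :: "'j \<Rightarrow> 'p \<Rightarrow> complex"
  assumes "finite J" "\<And>j. j \<in> J \<Longrightarrow> (f j has_sum s j) S"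
  shows "((\<lambda>p. \<Sum>j\<in>J. f j p) has_sum (\<Sum>j\<in>J. s j)) S"
  using assms by (induction J rule: finite_induct) (auto intro: has_sum_add)

text \<open>
  Averaging against the \<open>M\<close>-th roots of unity keeps exactly the terms with \<open>c p\<close> congruent to \<open>k\<close> modulo
  \<open>M\<close>. As \<open>M\<close> grows, the terms with \<open>c p \<noteq> k\<close> that survive are pushed into the tail of an absolutely
  convergent sum.
\<close>

lemma has_sum_0_frequency:
  fixes a :: "'p \<Rightarrow> complex" and c :: "'p \<Rightarrow> int"
  assumes "\<And>t::real. ((\<lambda>p. a p * e2pi (of_real t * of_int (c p))) has_sum 0) S"
  shows "(a has_sum 0) {p \<in> S. c p = k}"
proof -
  have a0: "(a has_sum 0) S" using assms[of 0] by simp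
  then have aS: "a summable_on S" by (rule has_sum_imp_summable)
  have sub: "a summable_on X" if "X \<subseteq> S" for X
    using aS that by (rule summable_on_subset_banach)
  have abs: "(\<lambda>p. norm (a p)) summable_on X" if "X \<subseteq> S" for X
    using sub[OF that] summable_on_iff_abs_summable_on_complex by blast
  have dvd: "(a has_sum 0) {p \<in> S. int M dvd c p - k}" if "M > 0" for M
  proof -
    have "((\<lambda>p. \<Sum>j<M. (e2pi (- of_nat j * of_int k / of_nat M) / of_nat M) * 
             (a p * e2pi (of_real (real j / real M) * of_int (c p)))) has_sum (\<Sum>j<M. (e2pi (- of_nat j * of_int k / of_nat M) / of_nat M) * 0)) S"
      by (intro has_sum_sum_finite has_sum_cmult_right assms) auto
    moreover have "(\<Sum>j<M. (e2pi (- of_nat j * of_int k / of_nat M) / of_nat M) * 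
             (a p * e2pi (of_real (real j / real M) * of_int (c p)))) = (if int M dvd c p - k then a p else 0)" for p
    proof -
      have "(e2pi (- of_nat j * of_int k / of_nat M) / of_nat M) * 
             (a p * e2pi (of_real (real j / real M) * of_int (c p))) = 
             a p / of_nat M * e2pi (of_nat j * of_int (c p - k) / of_nat M)" for j
      proof -
        have "of_nat j * of_int (c p - k) / of_nat M = (- of_nat j * of_int k / of_nat M + of_real (real j / real M) * of_int (c p) :: complex)"
          using that by (simp add: field_simps)
        then show ?thesis by (simp only: e2pi_add) simp
      qed
      then have "(\<Sum>j<M. (e2pi (- of_nat j * of_int k / of_nat M) / of_nat M) * 
             (a p * e2pi (of_real (real j / real M) * of_int (c p)))) =
             a p / of_nat M * (\<Sum>j<M. e2pi (of_nat j * of_int (c p - k) / of_nat M))"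
        by (simp only: sum_distrib_left)
      then show ?thesis unfolding sum_roots_of_unity[OF that] using that by simp
    qed
    ultimately have "((\<lambda>p. if int M dvd c p - k then a p else 0) has_sum 0) S" by simp
    then show ?thesis
      by (subst (asm) has_sum_cong_neutral[where T = "{p \<in> S. int M dvd c p - k}" and g = a]) auto
  qed
  define K where "K = {p \<in> S. c p = k}"
  have KS: "K \<subseteq> S" by (auto simp: K_def)
  have "norm (infsum a K) \<le> \<epsilon>" if "\<epsilon> > 0" for \<epsilon>
  proof -
    obtain F where F: "finite F" "F \<subseteq> S" "dist (\<Sum>p\<in>F. norm (a p)) (\<Sum>\<^sub>\<infinity>p\<in>S. norm (a p)) \<le> \<epsilon>"
      using infsum_finite_approximation[OF abs[OF order.refl] \<open>\<epsilon> > 0\<close>] by blast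
    have "infsum (\<lambda>p. norm (a p)) S = infsum (\<lambda>p. norm (a p)) F + infsum (\<lambda>p. norm (a p)) (S - F)"
      by (subst infsum_Un_disjoint[symmetric]) (use F abs in \<open>auto simp: Un_absorb1\<close>)
    then have tail: "infsum (\<lambda>p. norm (a p)) (S - F) \<le> \<epsilon>"
      using F by (simp add: dist_real_def abs_le_iff)
    \<comment> \<open>Larger than all \<open>\<bar>c p - k\<bar>\<close> on \<open>F\<close>, so no element of \<open>F\<close> can be congruent to \<open>k\<close> without being equal to it.\<close>
    define M where "M = Suc (\<Sum>p\<in>F. nat \<bar>c p - k\<bar>)"
    define R where "R = {p \<in> S. int M dvd c p - k \<and> c p \<noteq> k}"
    have RS: "R \<subseteq> S" by (auto simp: R_def)
    have RF: "R \<subseteq> S - F"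
    proof safe
      fix p assume p: "p \<in> R" "p \<in> F"
      then have "nat \<bar>c p - k\<bar> < M"
        unfolding M_def using member_le_sum[of p F "\<lambda>p. nat \<bar>c p - k\<bar>"] F by simp
      moreover have "int M dvd \<bar>c p - k\<bar>" "\<bar>c p - k\<bar> > 0" using p by (auto simp: R_def)
      then have "int M \<le> \<bar>c p - k\<bar>" by (rule zdvd_imp_le)
      ultimately show False by linarith
    qed (auto simp: R_def)
    have "0 = infsum a {p \<in> S. int M dvd c p - k}"
      using dvd[of M] infsumI by (fastforce simp: M_def)
    also have "{p \<in> S. int M dvd c p - k} = K \<union> R" by (auto simp: K_def R_def)
    also have "infsum a (K \<union> R) = infsum a K + infsum a R"
      by (rule infsum_Un_disjoint[OF sub[OF KS] sub[OF RS]]) (auto simp: K_def R_def)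
    finally have "norm (infsum a K) = norm (infsum a R)"
      by (metis add_eq_0_iff norm_minus_cancel)
    also have "\<dots> \<le> infsum (\<lambda>p. norm (a p)) R" by (rule norm_infsum_bound[OF abs[OF RS]])
    also have "\<dots> \<le> infsum (\<lambda>p. norm (a p)) (S - F)"
      by (rule infsum_mono2) (use RF abs RS in auto)
    finally show ?thesis using tail by linarith
  qed
  then have "norm (infsum a K) \<le> 0" by (meson dense_ge)
  then have "infsum a K = 0" by simp
  then show ?thesis using has_sum_infsum[OF sub[OF KS]] by (simp add: K_def)
qed

lemma cform_cvec_add:
  assumes "bilinear (form L)"
  shows "cform L (cvec l) (Z + of_real t *s cvec y) = cform L (cvec l) Z + of_real (t * form L l y)"
proof -
  interpret F: bounded_bilinear "form L" using assms by (simp add: bilinear_conv_bounded_bilinear)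
  have 1: "(\<chi> i. Re (cvec l $ i)) = l" "(\<chi> i. Im (cvec l $ i)) = 0" by (simp_all add: cvec_def vec_eq_iff)
  have 2: "(\<chi> i. Re ((Z + of_real t *s cvec y) $ i)) = (\<chi> i. Re (Z $ i)) + t *\<^sub>R y"
    "(\<chi> i. Im ((Z + of_real t *s cvec y) $ i)) = (\<chi> i. Im (Z $ i))"
    by (simp_all add: cvec_def vec_eq_iff)
  show ?thesis
    unfolding cform_def Let_def 1 2 by (simp add: F.add_right F.scaleR_right F.zero_left complex_eq_iff)
qed

lemma complexify_shift:
  "Z \<in> complexify L \<Longrightarrow> y \<in> pts L \<Longrightarrow> Z + c *s cvec y \<in> complexify L"
  unfolding complexify_def by (rule vec.span_add[OF _ vec.span_scale[OF vec.span_base]]) auto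

lemma eq_on_lattice_imp_eq:
  assumes L: "even_lattice L" and l: "l \<in> span (pts L)" "l' \<in> span (pts L)"
    and B: "pts L \<subseteq> span B" and eq: "\<And>y. y \<in> B \<Longrightarrow> form L l y = form L l' y"
  shows "l = l'"
proof (rule ccontr)
  assume "l \<noteq> l'"
  have bil: "bilinear (form L)" using L by (simp add: even_lattice_def)
  interpret F: bounded_bilinear "form L" using bil by (simp add: bilinear_conv_bounded_bilinear)
  have d: "l - l' \<in> span (pts L)" using l by (rule span_diff)
  have lin: "linear (form L (l - l'))" using bil by (simp add: bilinear_def)
  have "form L (l - l') y = 0" if "y \<in> B" for y using eq[OF that] by (simp add: F.diff_left)
  then have "form L (l - l') y = 0" if "y \<in> span B" for y
    using linear_eq_0_on_span[OF lin] that by blast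
  moreover have "span (pts L) \<subseteq> span B" using B by (simp add: span_minimal subspace_span)
  ultimately have "form L (l - l') (l - l') = 0" using d by blast
  moreover have "form L (l - l') (l - l') > 0" using L d \<open>l \<noteq> l'\<close> by (auto simp: even_lattice_def)
  ultimately show False by simp
qed

text \<open>
  The difference of two expansions sums to zero everywhere. Real translations of \<open>\<tau>\<close>, and of \<open>Z\<close> along
  the lattice vectors of a basis, multiply each term by a character with an integral frequency. Applying
  \<open>has_sum_0_frequency\<close> to these finitely many frequencies in turn isolates a single exponent, because
  the form is positive definite.
\<close>

theorem fourier_expansion_unique:
  fixes L :: "('n::finite) form_lattice"
  assumes L: "even_lattice L" and f: "has_fourier_expansion L N \<phi> f" and g: "has_fourier_expansion L N \<phi> g"
  shows "f = g"
proof -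
  define I where "I = fourier_index L N"
  define h where "h = (\<lambda>p. f p - g p)"
  define T where "T = (\<lambda>\<tau> Z (n, l). h (n, l) * e2pi (of_real n * \<tau> + cform L (cvec l) Z))"
  have bil: "bilinear (form L)" using L by (simp add: even_lattice_def)
  have T: "(T \<tau> Z has_sum 0) I" if "\<tau> \<in> upper_half" "Z \<in> complexify L" for \<tau> Z
  proof -
    have "((\<lambda>p. (case p of (n, l) \<Rightarrow> f (n, l) * exp (2 * pi * \<i> * (of_real n * \<tau> + cform L (cvec l) Z))) +
        - 1 * (case p of (n, l) \<Rightarrow> g (n, l) * exp (2 * pi * \<i> * (of_real n * \<tau> + cform L (cvec l) Z))))
          has_sum (\<phi> \<tau> Z + - 1 * \<phi> \<tau> Z)) I"
      using f g that unfolding has_fourier_expansion_def I_def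
      by (intro has_sum_add has_sum_cmult_right) auto
    moreover have "(\<lambda>p. (case p of (n, l) \<Rightarrow> f (n, l) * exp (2 * pi * \<i> * (of_real n * \<tau> + cform L (cvec l) Z))) +
        - 1 * (case p of (n, l) \<Rightarrow> g (n, l) * exp (2 * pi * \<i> * (of_real n * \<tau> + cform L (cvec l) Z)))) = T \<tau> Z"
      by (auto simp: T_def h_def e2pi_def fun_eq_iff algebra_simps)
    ultimately show ?thesis by simp
  qed
  have "h p0 = 0" if p0: "p0 \<in> I" for p0
  proof -
    obtain n0 l0 where p0_eq: "p0 = (n0, l0)" by (cases p0)
    have l0: "l0 \<in> dual_lattice L" and n0: "n0 - of_int N / 24 \<in> \<int>"
      using p0 by (auto simp: I_def fourier_index_def p0_eq)
    obtain B where B: "B \<subseteq> pts L" "independent B" "pts L \<subseteq> span B"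
      using maximal_independent_subset by blast
    then have "finite B" by (simp add: independent_imp_finite)
    have "(T \<tau> Z has_sum 0) {p \<in> I. fst p = n0 \<and> (\<forall>y\<in>F. form L (snd p) y = form L l0 y)}"
      if "finite F" "F \<subseteq> pts L" "\<tau> \<in> upper_half" "Z \<in> complexify L" for F \<tau> Z
      using that
    proof (induction F arbitrary: Z rule: finite_induct)
      case empty
      define c where "c = (\<lambda>p::real \<times> (real ^ 'n). \<lfloor>fst p - n0\<rfloor>)"
      have c: "of_int (c p) = fst p - n0" if "p \<in> I" for p
      proof -
        have "fst p - of_int N / 24 \<in> \<int>" using that by (auto simp: I_def fourier_index_def)
        then have "(fst p - of_int N / 24) - (n0 - of_int N / 24) \<in> \<int>" using n0 by (rule Ints_diff)
        then show ?thesis by (simp add: c_def)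
      qed
      have "((\<lambda>p. T \<tau> Z p * e2pi (of_real t * of_int (c p))) has_sum 0) I" for t :: real
      proof -
        have t: "\<tau> + of_real t \<in> upper_half" using empty by (simp add: upper_half_def)
        have "((\<lambda>p. e2pi (- of_real (t * n0)) * T (\<tau> + of_real t) Z p) has_sum (e2pi (- of_real (t * n0)) * 0)) I"
          by (intro has_sum_cmult_right T t empty)
        moreover have "e2pi (- of_real (t * n0)) * T (\<tau> + of_real t) Z p = T \<tau> Z p * e2pi (of_real t * of_int (c p))"
          if "p \<in> I" for p
        proof -
          obtain n l where p: "p = (n, l)" by (cases p)
          have "of_real t * of_int (c p) = (of_real t * of_real (of_int (c p)) :: complex)" by simp
          also have "\<dots> = of_real t * of_real (n - n0)" by (simp only: c[OF that]) (simp add: p)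
          finally have cc: "of_real t * of_int (c p) = (of_real t * of_real (n - n0) :: complex)" .
          have "- of_real (t * n0) + (of_real n * (\<tau> + of_real t) + cform L (cvec l) Z) =
            (of_real n * \<tau> + cform L (cvec l) Z) + of_real t * of_real (n - n0)"
            by (simp add: algebra_simps)
          then have "e2pi (- of_real (t * n0)) * e2pi (of_real n * (\<tau> + of_real t) + cform L (cvec l) Z) =
             e2pi (of_real n * \<tau> + cform L (cvec l) Z) * e2pi (of_real t * of_real (n - n0))"
            by (simp only: e2pi_add[symmetric])
          then show ?thesis unfolding cc by (simp only: T_def p split mult_ac)
        qed
        ultimately show ?thesis by (subst has_sum_cong) auto
      qed
      from has_sum_0_frequency[OF this, of 0]
      have "(T \<tau> Z has_sum 0) {p \<in> I. c p = 0}" .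
      moreover have "{p \<in> I. c p = 0} = {p \<in> I. fst p = n0}"
        using c by (auto, force+)
      ultimately show ?case by simp
    next
      case (insert y F)
      define S where "S = {p \<in> I. fst p = n0 \<and> (\<forall>y\<in>F. form L (snd p) y = form L l0 y)}"
      define c where "c = (\<lambda>p::real \<times> (real ^ 'n). \<lfloor>form L (snd p) y\<rfloor>)"
      have sym: "form L x z = form L z x" for x z using L by (auto simp: even_lattice_def)
      have c: "of_int \<lfloor>form L l y\<rfloor> = form L l y" if "l \<in> dual_lattice L" for l
      proof -
        have "form L l y \<in> \<int>" using that insert.prems by (subst sym) (auto simp: dual_lattice_def)
        then show ?thesis by (auto elim: Ints_cases)
      qed
      have IH: "(T \<tau> Z has_sum 0) S" if "Z \<in> complexify L" for Z
        unfolding S_def using insert.IH insert.prems that by blast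
      have SI: "snd p \<in> dual_lattice L" if "p \<in> S" for p
        using that by (auto simp: S_def I_def fourier_index_def)
      have "((\<lambda>p. T \<tau> Z p * e2pi (of_real t * of_int (c p))) has_sum 0) S" for t :: real
      proof -
        have "(T \<tau> (Z + of_real t *s cvec y) has_sum 0) S"
          by (intro IH complexify_shift) (use insert.prems in auto)
        moreover have "T \<tau> (Z + of_real t *s cvec y) p = T \<tau> Z p * e2pi (of_real t * of_int (c p))"
          if "p \<in> S" for p
        proof -
          obtain n l where p: "p = (n, l)" by (cases p)
          have "of_real t * of_int (c p) = (of_real t * of_real (of_int (c p)) :: complex)" by simp
          also have "\<dots> = of_real (t * form L l y)" by (simp only: c_def c[OF SI[OF that]]) (simp add: p)
          finally have cc: "of_real t * of_int (c p) = (of_real (t * form L l y) :: complex)" .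
          show ?thesis
            unfolding cc by (simp only: T_def p split cform_cvec_add[OF bil] e2pi_add mult_ac)
        qed
        ultimately show ?thesis by (subst has_sum_cong[symmetric]) auto
      qed
      from has_sum_0_frequency[OF this, of "\<lfloor>form L l0 y\<rfloor>"]
      have "(T \<tau> Z has_sum 0) {p \<in> S. c p = \<lfloor>form L l0 y\<rfloor>}" .
      moreover have "c p = \<lfloor>form L l0 y\<rfloor> \<longleftrightarrow> form L (snd p) y = form L l0 y" if "p \<in> S" for p
        using c[OF SI[OF that]] c[OF l0] by (metis c_def)
      then have "{p \<in> S. c p = \<lfloor>form L l0 y\<rfloor>} =
          {p \<in> I. fst p = n0 \<and> (\<forall>y\<in>insert y F. form L (snd p) y = form L l0 y)}"
        by (auto simp: S_def)
      ultimately show ?case by simp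
    qed
    from this[OF \<open>finite B\<close> B(1), of \<i> 0]
    have "(T \<i> 0 has_sum 0) {p \<in> I. fst p = n0 \<and> (\<forall>y\<in>B. form L (snd p) y = form L l0 y)}"
      by (simp add: upper_half_def complexify_def vec.span_zero)
    also have "{p \<in> I. fst p = n0 \<and> (\<forall>y\<in>B. form L (snd p) y = form L l0 y)} = {p0}"
    proof -
      have "l = l0" if "(n0, l) \<in> I" "\<forall>y\<in>B. form L l y = form L l0 y" for l
        by (rule eq_on_lattice_imp_eq[OF L _ _ B(3)])
           (use that l0 in \<open>auto simp: I_def fourier_index_def dual_lattice_def\<close>)
      then show ?thesis using p0 by (auto simp: p0_eq)
    qed
    finally have "T \<i> 0 p0 = 0" by (simp add: has_sum_finite_iff)
    then show ?thesis by (simp add: T_def p0_eq)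
  qed
  moreover have "h p = 0" if "p \<notin> I" for p
  proof -
    have "f p = 0" "g p = 0" using that f g unfolding has_fourier_expansion_def I_def by blast+
    then show ?thesis by (simp add: h_def)
  qed
  ultimately show ?thesis by (auto simp: h_def fun_eq_iff)
qed

lemma fourier_coeff_eq:
  assumes "even_lattice L" "has_fourier_expansion L N \<phi> f"
  shows "fourier_coeff L N \<phi> = f"
  unfolding fourier_coeff_def using assms fourier_expansion_unique by (intro the_equality) blast+

section \<open>Hyperplane sections of \<open>D\<^sub>n\<close>\<close>

definition ivec :: "('n::finite \<Rightarrow> int) \<Rightarrow> real ^ 'n" where
  "ivec N = (\<chi> i. of_int (N i))"

text \<open>
  Both \<open>v\<^sup>\<bottom>\<close> in \<open>D\<^sub>n\<close> and \<open>A\<^sub>m\<close> are lattices of this kind, as are their rescalings.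
\<close>

definition hyperplane_lattice :: "nat \<Rightarrow> ('n::finite \<Rightarrow> int) \<Rightarrow> 'n form_lattice" where
  "hyperplane_lattice t b =
     \<lparr>pts = {x \<in> pts D_lattice. x \<bullet> ivec b = 0}, form = \<lambda>x y. real t * (x \<bullet> y)\<rparr>"

lemma ivec_nth [simp]: "ivec N $ i = of_int (N i)"
  by (simp add: ivec_def)

lemma inner_ivec: "ivec M \<bullet> ivec N = of_int (\<Sum>i\<in>UNIV. M i * N i)"
  by (simp add: inner_vec_def)

lemma form_hyperplane_lattice [simp]: "form (hyperplane_lattice t b) x y = real t * (x \<bullet> y)"
  by (simp add: hyperplane_lattice_def)

lemma even_sum_iff:
  fixes f g :: "'i \<Rightarrow> int"
  assumes "finite A" "\<And>i. i \<in> A \<Longrightarrow> even (f i) \<longleftrightarrow> even (g i)"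
  shows "even (\<Sum>i\<in>A. f i) \<longleftrightarrow> even (\<Sum>i\<in>A. g i)"
  using assms by (induction A rule: finite_induct) auto

lemma pts_hyperplane_lattice:
  "x \<in> pts (hyperplane_lattice t b) \<longleftrightarrow>
     (\<exists>X. x = ivec X \<and> even (\<Sum>i\<in>UNIV. X i) \<and> (\<Sum>i\<in>UNIV. X i * b i) = 0)"
proof
  assume x: "x \<in> pts (hyperplane_lattice t b)"
  then have "\<forall>i. \<exists>k. x $ i = of_int k" by (auto simp: hyperplane_lattice_def D_lattice_def elim: Ints_cases)
  then obtain X where X: "\<And>i. x $ i = of_int (X i)" by metis
  then have xX: "x = ivec X" by (simp add: vec_eq_iff)
  from x obtain j :: int where "(\<Sum>i\<in>UNIV. x $ i) = 2 * of_int j"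
    by (auto simp: hyperplane_lattice_def D_lattice_def)
  then have "of_int (\<Sum>i\<in>UNIV. X i) = (of_int (2 * j) :: real)" by (simp add: X)
  then have "(\<Sum>i\<in>UNIV. X i) = 2 * j" by (simp only: of_int_eq_iff)
  moreover have "of_int (\<Sum>i\<in>UNIV. X i * b i) = (0::real)"
    using x unfolding xX inner_ivec[symmetric] by (simp add: hyperplane_lattice_def)
  then have "(\<Sum>i\<in>UNIV. X i * b i) = 0" by (simp only: of_int_eq_0_iff)
  ultimately show "\<exists>X. x = ivec X \<and> even (\<Sum>i\<in>UNIV. X i) \<and> (\<Sum>i\<in>UNIV. X i * b i) = 0"
    using xX by auto
next
  assume "\<exists>X. x = ivec X \<and> even (\<Sum>i\<in>UNIV. X i) \<and> (\<Sum>i\<in>UNIV. X i * b i) = 0"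
  then obtain X j where X: "x = ivec X" "(\<Sum>i\<in>UNIV. X i) = 2 * j" "(\<Sum>i\<in>UNIV. X i * b i) = 0"
    by (auto elim!: evenE)
  have "(\<Sum>i\<in>UNIV. x $ i) = of_int (\<Sum>i\<in>UNIV. X i)" by (simp add: X(1))
  also have "\<dots> = 2 * of_int j" unfolding X(2) by simp
  finally have "(\<Sum>i\<in>UNIV. x $ i) = 2 * of_int j" .
  then show "x \<in> pts (hyperplane_lattice t b)"
    by (auto simp: hyperplane_lattice_def D_lattice_def X inner_ivec simp del: of_int_sum)
qed

text \<open>
  The lattice contains the vectors \<open>2(b\<^sub>0 e\<^sub>j - b\<^sub>j e\<^sub>0)\<close>, where \<open>e\<^sub>0\<close> belongs to a coordinate with
  \<open>b\<^sub>0 \<noteq> 0\<close>, and these span the hyperplane.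
\<close>

lemma span_hyperplane_lattice:
  fixes b :: "'n::finite \<Rightarrow> int"
  assumes "b i0 \<noteq> 0"
  shows "span (pts (hyperplane_lattice t b)) = {x. x \<bullet> ivec b = 0}"
proof
  have "subspace {x. x \<bullet> ivec b = 0}" by (simp add: subspace_def inner_add_left)
  then show "span (pts (hyperplane_lattice t b)) \<subseteq> {x. x \<bullet> ivec b = 0}"
    by (rule span_minimal[rotated]) (auto simp: hyperplane_lattice_def)
next
  \<comment> \<open>The factor 2 makes the coordinate sums even.\<close>
  define w where "w = (\<lambda>j. ivec (\<lambda>i. (if i = j then 2 * b i0 else 0) - (if i = i0 then 2 * b j else 0)))"
  have w: "w j \<in> pts (hyperplane_lattice t b)" for j
    unfolding pts_hyperplane_lattice w_def
    by (intro exI conjI, rule refl) (simp_all add: sum_subtractf left_diff_distrib if_distrib[of "\<lambda>x. x * _"] sum.delta cong: if_cong)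
  show "{x. x \<bullet> ivec b = 0} \<subseteq> span (pts (hyperplane_lattice t b))"
  proof
    fix x :: "real ^ 'n" assume "x \<in> {x. x \<bullet> ivec b = 0}"
    then have x: "(\<Sum>j\<in>UNIV. x $ j * of_int (b j)) = 0" by (simp add: inner_vec_def)
    have "(\<Sum>j\<in>UNIV. (x $ j / (2 * of_int (b i0))) *\<^sub>R w j) = x"
    proof (rule vec_eq_iff[THEN iffD2], rule allI)
      fix i
      have "(\<Sum>j\<in>UNIV. (x $ j / (2 * of_int (b i0))) *\<^sub>R w j) $ i =
         (\<Sum>j\<in>UNIV. (if i = j then x $ j else 0) - (if i = i0 then x $ j * of_int (b j) / of_int (b i0) else 0))"
        unfolding sum_component by (rule sum.cong) (use assms in \<open>auto simp: w_def field_simps\<close>)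
      also have "\<dots> = x $ i - (if i = i0 then (\<Sum>j\<in>UNIV. x $ j * of_int (b j)) / of_int (b i0) else 0)"
        by (simp add: sum_subtractf sum_divide_distrib)
      finally show "(\<Sum>j\<in>UNIV. (x $ j / (2 * of_int (b i0))) *\<^sub>R w j) $ i = x $ i" using x by simp
    qed
    moreover have "(\<Sum>j\<in>UNIV. (x $ j / (2 * of_int (b i0))) *\<^sub>R w j) \<in> span (pts (hyperplane_lattice t b))"
      by (intro span_sum span_scale span_base w)
    ultimately show "x \<in> span (pts (hyperplane_lattice t b))" by simp
  qed
qed

lemma critical_weight_hyperplane_lattice:
  fixes b :: "'n::finite \<Rightarrow> int"
  assumes "b i0 \<noteq> 0"
  shows "critical_weight (hyperplane_lattice t b) = real CARD('n) / 2"
proof -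
  have nz: "ivec b \<noteq> 0" using assms by (auto simp: vec_eq_iff)
  have "dim (pts (hyperplane_lattice t b)) = dim {x. ivec b \<bullet> x = 0}"
    using span_hyperplane_lattice[of b i0 t, OF assms] by (metis (no_types, lifting) Collect_cong dim_span inner_commute)
  also have "\<dots> = CARD('n) - 1" by (simp add: dim_hyperplane[OF nz])
  finally show ?thesis
    using zero_less_card_finite[where 'a='n] by (simp add: critical_weight_def lattice_rank_def of_nat_diff)
qed

lemma even_lattice_hyperplane_lattice:
  fixes b :: "'n::finite \<Rightarrow> int"
  assumes "t > 0"
  shows "even_lattice (hyperplane_lattice t b)"
  unfolding even_lattice_def
proof (intro conjI ballI allI impI)
  let ?L = "hyperplane_lattice t b"
  show "0 \<in> pts ?L" by (auto simp: pts_hyperplane_lattice vec_eq_iff intro!: exI[of _ "\<lambda>_. 0"])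
  show "x - y \<in> pts ?L" if xy: "x \<in> pts ?L" "y \<in> pts ?L" for x y
  proof -
    obtain X Y where X: "x = ivec X" "even (\<Sum>i\<in>UNIV. X i)" "(\<Sum>i\<in>UNIV. X i * b i) = 0"
      and Y: "y = ivec Y" "even (\<Sum>i\<in>UNIV. Y i)" "(\<Sum>i\<in>UNIV. Y i * b i) = 0"
      using xy unfolding pts_hyperplane_lattice by blast
    show ?thesis unfolding pts_hyperplane_lattice
      by (rule exI[of _ "\<lambda>i. X i - Y i"]) (use X Y in \<open>simp add: vec_eq_iff sum_subtractf left_diff_distrib\<close>)
  qed
  show "discrete (pts ?L)"
    unfolding discrete_def isolated_in_def
  proof (intro ballI conjI)
    fix x assume x: "x \<in> pts ?L"
    have "y = x" if y: "y \<in> pts ?L" "dist x y < 1" for y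
    proof -
      obtain X Y where XY: "x = ivec X" "y = ivec Y" using y x unfolding pts_hyperplane_lattice by blast
      have "X i = Y i" for i
      proof -
        have "\<bar>(x - y) $ i\<bar> < 1" using component_le_norm_cart[of "x - y" i] y by (simp add: dist_norm)
        then have "of_int \<bar>X i - Y i\<bar> < (1::real)" by (simp add: XY)
        then show ?thesis by linarith
      qed
      then show ?thesis by (simp add: XY vec_eq_iff)
    qed
    then have "ball x 1 \<inter> pts ?L = {x}" using x by auto
    then show "\<exists>T. open T \<and> T \<inter> pts ?L = {x}" by blast
  qed auto
  show "bilinear (form ?L)"
    unfolding bilinear_def linear_iff by (simp add: inner_simps algebra_simps)
  show "form ?L x y = form ?L y x" for x y by (simp add: inner_commute)
  show "form ?L x x > 0" if "x \<noteq> 0" for x using that assms by simp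
  show "\<exists>j::int. form ?L x x = 2 * of_int j" if x: "x \<in> pts ?L" for x
  proof -
    obtain X where X: "x = ivec X" "even (\<Sum>i\<in>UNIV. X i)"
      using x unfolding pts_hyperplane_lattice by blast
    have "even (\<Sum>i\<in>UNIV. X i * X i)"
      using X(2) by (subst even_sum_iff[where g = X]) auto
    then obtain j where "(\<Sum>i\<in>UNIV. X i * X i) = 2 * j" by (elim evenE)
    then have "form ?L x x = 2 * of_int (int t * j)" by (simp add: X inner_ivec del: of_int_sum)
    then show ?thesis by blast
  qed
qed

lemma complexify_hyperplane_lattice:
  fixes b :: "'n::finite \<Rightarrow> int"
  assumes "Z \<in> complexify (hyperplane_lattice t b)"
  shows "(\<Sum>i\<in>UNIV. Z $ i * of_int (b i)) = 0"
proof -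
  let ?V = "{Z :: complex ^ 'n. (\<Sum>i\<in>UNIV. Z $ i * of_int (b i)) = 0}"
  have "vec.span (cvec ` pts (hyperplane_lattice t b)) \<subseteq> ?V"
  proof (rule vec.span_minimal)
    show "cvec ` pts (hyperplane_lattice t b) \<subseteq> ?V"
    proof
      fix Z :: "complex ^ 'n" assume "Z \<in> cvec ` pts (hyperplane_lattice t b)"
      then obtain X where X: "Z = cvec (ivec X)" "(\<Sum>i\<in>UNIV. X i * b i) = 0"
        by (auto simp: pts_hyperplane_lattice)
      have "(\<Sum>i\<in>UNIV. Z $ i * of_int (b i)) = of_int (\<Sum>i\<in>UNIV. X i * b i)"
        by (simp add: X(1) cvec_def)
      then show "Z \<in> ?V" by (simp add: X(2))
    qed
    show "vec.subspace ?V"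
      by (auto simp: vec.subspace_def ring_distribs sum.distrib mult.assoc simp flip: sum_distrib_left)
  qed
  then show ?thesis using assms by (auto simp: complexify_def)
qed

lemma cform_hyperplane_lattice:
  "cform (hyperplane_lattice t b) Z W = of_nat t * (\<Sum>i\<in>UNIV. Z $ i * W $ i)"
  by (simp add: cform_def Let_def inner_vec_def complex_eq_iff sum_subtractf sum.distrib algebra_simps)

lemma complexify_scale: "Z \<in> complexify L \<Longrightarrow> c *s Z \<in> complexify L"
  unfolding complexify_def by (rule vec.span_scale)

text \<open>
  Collecting the terms with equal exponent turns a sum over integer vectors into a Fourier expansion.
\<close>

lemma has_sum_group_by_exponent:
  fixes c :: "'k \<Rightarrow> complex" and E :: "'p \<Rightarrow> complex"
  assumes sum: "((\<lambda>k. c k * E (\<pi> k)) has_sum s) UNIV" and P: "\<And>k. c k \<noteq> 0 \<Longrightarrow> \<pi> k \<in> P"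
  shows "((\<lambda>p. infsum c {k. c k \<noteq> 0 \<and> \<pi> k = p} * E p) has_sum s) P"
proof -
  define W where "W = {k. c k \<noteq> 0}"
  define fib where "fib = (\<lambda>p. {k. c k \<noteq> 0 \<and> \<pi> k = p})"
  have 1: "((\<lambda>k. c k * E (\<pi> k)) has_sum s) W"
    using sum by (subst has_sum_cong_neutral[where T = UNIV]) (auto simp: W_def)
  have bij: "bij_betw snd (Sigma P fib) W"
    by (rule bij_betwI[of _ _ _ "\<lambda>k. (\<pi> k, k)"]) (auto simp: W_def fib_def P)
  have "((\<lambda>x. c (snd x) * E (\<pi> (snd x))) has_sum s) (Sigma P fib)"
    using 1 by (subst has_sum_reindex_bij_betw[OF bij])
  then show ?thesis
  proof (rule has_sum_SigmaD)
    fix p assume "p \<in> P"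
    have "(\<lambda>k. c k * E (\<pi> k)) summable_on fib p"
      by (rule summable_on_subset_banach[OF has_sum_imp_summable[OF sum]]) auto
    then have "(\<lambda>k. c k * E p) summable_on fib p"
      by (subst (asm) summable_on_cong[where g = "\<lambda>k. c k * E p"]) (auto simp: fib_def)
    then have "((\<lambda>k. c k * E p) has_sum (infsum c (fib p) * E p)) (fib p)"
      by (metis has_sum_infsum infsum_cmult_left')
    then show "((\<lambda>y. c (snd (p, y)) * E (\<pi> (snd (p, y)))) has_sum infsum c {k. c k \<noteq> 0 \<and> \<pi> k = p} * E p) (fib p)"
      by (subst has_sum_cong[where g = "\<lambda>k. c k * E p"]) (auto simp: fib_def)
  qed
qed

lemma has_sum_prod_UNIV:
  fixes f :: "'n::finite \<Rightarrow> int \<Rightarrow> complex"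
  assumes "\<And>i. (\<lambda>k. norm (f i k)) summable_on UNIV"
  shows "((\<lambda>N. \<Prod>i\<in>UNIV. f i (N i)) has_sum (\<Prod>i\<in>UNIV. infsum (f i) UNIV)) UNIV"
proof -
  have U: "PiE UNIV (\<lambda>_. UNIV) = (UNIV :: ('n \<Rightarrow> int) set)" by (auto simp: PiE_def)
  have "Infinite_Set_Sum.abs_summable_on (\<lambda>N. \<Prod>i\<in>UNIV. f i (N i)) (PiE UNIV (\<lambda>_. UNIV))"
    using assms by (intro abs_summable_on_prod_PiE) (auto simp: abs_summable_equivalent[symmetric])
  then have "(\<lambda>N. \<Prod>i\<in>UNIV. f i (N i)) summable_on UNIV"
    unfolding U abs_summable_equivalent[symmetric] by (rule abs_summable_summable)
  moreover have "infsum (\<lambda>N. \<Prod>i\<in>UNIV. f i (N i)) UNIV = (\<Prod>i\<in>UNIV. infsum (f i) UNIV)"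
    using infsum_prod_PiE_abs[of UNIV f "\<lambda>_. UNIV"] assms by (simp add: U)
  ultimately show ?thesis by (metis has_sum_infsum)
qed

lemma bezout_family:
  fixes b :: "'i \<Rightarrow> int"
  assumes "finite A" shows "\<exists>M. (\<Sum>i\<in>A. M i * b i) = Gcd (b ` A)"
  using assms
proof (induction A rule: finite_induct)
  case (insert i A)
  then obtain M where M: "(\<Sum>i\<in>A. M i * b i) = Gcd (b ` A)" by blast
  obtain u v where uv: "u * b i + v * Gcd (b ` A) = gcd (b i) (Gcd (b ` A))"
    using bezout_int by blast
  have "(\<Sum>k\<in>insert i A. (if k = i then u else v * M k) * b k) = u * b i + (\<Sum>k\<in>A. v * M k * b k)"
    using insert.hyps by (simp, intro sum.cong) auto
  also have "(\<Sum>k\<in>A. v * M k * b k) = v * Gcd (b ` A)" by (simp add: M[symmetric] sum_distrib_left mult.assoc)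
  finally show ?case using uv by (intro exI) (simp add: Gcd_insert)
qed simp

text \<open>
  Signs \<open>c\<^sub>i\<close> can be chosen with \<open>(c,b)\<close> congruent to 1 modulo 3: making every product
  \<open>c\<^sub>i b\<^sub>i\<close> congruent to 0 or 1, it remains to negate all signs or one of them, according to the residue of
  the sum. Modulo 2 any signs will do. A Bezout relation then corrects \<open>(c,b)\<close> to 1 by multiples of 6,
  which keeps the entries prime to 6.
\<close>

lemma exists_coprime_6_solution:
  fixes b :: "'n::finite \<Rightarrow> int"
  assumes gcd: "Gcd (range b) = 1" and odd: "odd (\<Sum>i\<in>UNIV. b i)"
  obtains N where "(\<Sum>i\<in>UNIV. N i * b i) = 1" "\<And>i. coprime (N i) 6"
proof -
  obtain M where M: "(\<Sum>i\<in>UNIV. M i * b i) = 1" using bezout_family[of UNIV b] gcd by auto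
  have "\<exists>i. \<not> 3 dvd b i"
  proof (rule ccontr)
    assume "\<nexists>i. \<not> 3 dvd b i"
    then have "3 dvd Gcd (range b)" by (intro Gcd_greatest) auto
    then show False using gcd by simp
  qed
  then obtain i0 where i0: "\<not> 3 dvd b i0" by blast
  \<comment> \<open>These signs make every \<open>e i * b i\<close> congruent to 0 or 1 modulo 3.\<close>
  define e where "e = (\<lambda>i. if b i mod 3 = 2 then - 1 else 1 :: int)"
  have "e i0 * b i0 mod 3 = 1"
  proof -
    have "b i0 mod 3 = 1 \<or> b i0 mod 3 = 2" using i0 by presburger
    then show ?thesis by (auto simp: e_def) presburger
  qed
  define s where "s = (\<Sum>i\<in>UNIV. e i * b i)"
  have "\<exists>c. (\<forall>i. c i = 1 \<or> c i = - 1) \<and> (\<Sum>i\<in>UNIV. c i * b i) mod 3 = 1"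
  proof -
    have "s mod 3 = 0 \<or> s mod 3 = 1 \<or> s mod 3 = 2" by presburger
    then consider "s mod 3 = 0" | "s mod 3 = 1" | "s mod 3 = 2" by blast
    then show ?thesis
    proof cases
      case 1
      have "(\<Sum>i\<in>UNIV. (e(i0 := - e i0)) i * b i) = (\<Sum>i\<in>UNIV. e i * b i - (if i = i0 then 2 * (e i0 * b i0) else 0))"
        by (rule sum.cong) auto
      also have "\<dots> = s - 2 * (e i0 * b i0)" by (simp add: sum_subtractf s_def)
      finally have "(\<Sum>i\<in>UNIV. (e(i0 := - e i0)) i * b i) mod 3 = 1"
        using 1 \<open>e i0 * b i0 mod 3 = 1\<close> by presburger
      then show ?thesis by (intro exI[of _ "e(i0 := - e i0)"] conjI) (auto simp: e_def)
    next
      case 2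
      then show ?thesis by (intro exI[of _ e]) (auto simp: s_def e_def)
    next
      case 3
      have "(\<Sum>i\<in>UNIV. - e i * b i) = - s" by (simp add: s_def sum_negf)
      then have "(\<Sum>i\<in>UNIV. - e i * b i) mod 3 = 1" using 3 by presburger
      then show ?thesis by (intro exI[of _ "\<lambda>i. - e i"]) (auto simp: e_def)
    qed
  qed
  then obtain c where c: "\<And>i. c i = 1 \<or> c i = - 1" "(\<Sum>i\<in>UNIV. c i * b i) mod 3 = 1" by blast
  have "even (\<Sum>i\<in>UNIV. c i * b i) \<longleftrightarrow> even (\<Sum>i\<in>UNIV. b i)"
  proof (rule even_sum_iff)
    fix i
    have "odd (c i)" using c(1)[of i] by (elim disjE) simp_all
    then show "even (c i * b i) \<longleftrightarrow> even (b i)" by simp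
  qed simp
  then have "odd (\<Sum>i\<in>UNIV. c i * b i)" using odd by simp
  moreover have "\<exists>k. S = 1 + 6 * k" if "odd S" "S mod 3 = 1" for S :: int
    using that by presburger
  ultimately obtain k where k: "(\<Sum>i\<in>UNIV. c i * b i) = 1 + 6 * k" using c(2) by blast
  show ?thesis
  proof (rule that[of "\<lambda>i. c i - 6 * k * M i"])
    have "(\<Sum>i\<in>UNIV. (c i - 6 * k * M i) * b i) = (\<Sum>i\<in>UNIV. c i * b i) - 6 * k * (\<Sum>i\<in>UNIV. M i * b i)"
      by (simp add: left_diff_distrib sum_subtractf sum_distrib_left mult.assoc)
    then show "(\<Sum>i\<in>UNIV. (c i - 6 * k * M i) * b i) = 1" by (simp add: k M)
    fix i
    have "coprime (c i - 6 * k * M i) 6 \<longleftrightarrow> coprime (c i) 6"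
    proof -
      have "gcd 6 ((- (k * M i)) * 6 + c i) = gcd 6 (c i)" by (rule gcd_add_mult)
      then show ?thesis by (simp add: coprime_iff_gcd_eq_1 gcd.commute algebra_simps)
    qed
    then show "coprime (c i - 6 * k * M i) 6" using c(1)[of i] by auto
  qed
qed

text \<open>
  The last hypothesis says that \<open>N'\<close> is the mirror image in \<open>b\<^sup>\<bottom>\<close> of a vector \<open>N\<close> with \<open>(N,b) = 1\<close>. Since
  \<open>(b,b)\<close> is odd it would divide every \<open>b\<^sub>i\<close>, hence be 1, which is impossible with two non-zero entries.
\<close>

lemma reflection_not_integral:
  fixes b N N' :: "'n::finite \<Rightarrow> int"
  assumes gcd: "Gcd (range b) = 1" and odd: "odd (\<Sum>i\<in>UNIV. b i)" and two: "card {i. b i \<noteq> 0} \<ge> 2"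
    and refl: "\<And>i. (\<Sum>i\<in>UNIV. (b i)\<^sup>2) * (N' i - N i) = - 2 * b i"
  shows False
proof -
  define B where "B = (\<Sum>i\<in>UNIV. (b i)\<^sup>2)"
  have "even B \<longleftrightarrow> even (\<Sum>i\<in>UNIV. b i)" unfolding B_def by (rule even_sum_iff) auto
  then have "odd B" using odd by simp
  have "B dvd b i" for i
  proof -
    have "B dvd - 2 * b i" unfolding refl[of i, folded B_def, symmetric] by simp
    then have "B dvd 2 * b i" by simp
    moreover have "coprime B 2" using \<open>odd B\<close> by simp
    ultimately show ?thesis by (simp add: coprime_dvd_mult_right_iff)
  qed
  then have "B dvd 1" using Gcd_greatest[of "range b" B] gcd by auto
  moreover have "B \<ge> int (card {i. b i \<noteq> 0})"
  proof -
    have "int (card {i. b i \<noteq> 0}) = (\<Sum>i\<in>UNIV. if b i \<noteq> 0 then 1 else 0)"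
      by (simp add: sum.If_cases)
    also have "\<dots> \<le> B" unfolding B_def by (intro sum_mono) (auto simp: power2_eq_square int_one_le_iff_zero_less zero_less_mult_iff)
    finally show ?thesis .
  qed
  ultimately show False using two by auto
qed

section \<open>Products of theta series on a hyperplane section\<close>

lemma e2pi_sum: "finite A \<Longrightarrow> e2pi (\<Sum>i\<in>A. f i) = (\<Prod>i\<in>A. e2pi (f i))"
  by (induction A rule: finite_induct) (auto simp: e2pi_add)

definition complex_differentiable_within ::
    "(complex \<times> (complex ^ 'n) \<Rightarrow> complex) \<Rightarrow> complex \<times> (complex ^ ('n::finite)) \<Rightarrow> (complex \<times> (complex ^ 'n)) set \<Rightarrow> bool" where
  "complex_differentiable_within F p S \<longleftrightarrow>
     (\<exists>D. (F has_derivative D) (at p within S) \<and> (\<forall>u t Z. D (u * t, u *s Z) = u * D (t, Z)))"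

lemma complex_differentiable_within_const: "complex_differentiable_within (\<lambda>_. c) p S"
  unfolding complex_differentiable_within_def by (intro exI[of _ "\<lambda>_. 0"]) auto

lemma complex_differentiable_within_mult:
  assumes "complex_differentiable_within F p S" "complex_differentiable_within G p S"
  shows "complex_differentiable_within (\<lambda>x. F x * G x) p S"
proof -
  obtain D D' where D: "(F has_derivative D) (at p within S)" "\<And>u t Z. D (u * t, u *s Z) = u * D (t, Z)"
    and D': "(G has_derivative D') (at p within S)" "\<And>u t Z. D' (u * t, u *s Z) = u * D' (t, Z)"
    using assms unfolding complex_differentiable_within_def by blast
  show ?thesis
    unfolding complex_differentiable_within_def
    by (intro exI[of _ "\<lambda>h. F p * D' h + D h * G p"] conjI has_derivative_mult D D')
       (simp add: D(2) D'(2) algebra_simps)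
qed

lemma complex_differentiable_within_prod:
  assumes "finite A" "\<And>i. i \<in> A \<Longrightarrow> complex_differentiable_within (F i) p S"
  shows "complex_differentiable_within (\<lambda>x. \<Prod>i\<in>A. F i x) p S"
  using assms
  by (induction A rule: finite_induct)
     (auto intro!: complex_differentiable_within_const complex_differentiable_within_mult)

text \<open>
  The principal square root is compatible with half-integral principal powers.
\<close>

lemma csqrt_power: "z \<noteq> 0 \<Longrightarrow> csqrt z ^ m = z powr of_real (real m / 2)"
proof -
  assume z: "z \<noteq> 0"
  have "csqrt z ^ m = exp (Ln z / 2) ^ m" using z by (simp add: csqrt_exp_Ln)
  also have "\<dots> = exp (of_real (real m / 2) * Ln z)" by (simp flip: exp_of_nat_mult)
  finally show ?thesis using z by (simp add: powr_def)
qed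

text \<open>
  What \<open>\<theta>\<close> and \<open>\<theta>\<^bsub>3/2\<^esub>\<close> have in common. The function has index \<open>t\<close> and multiplier \<open>v\<^sub>\<eta>\<^sup>d\<close>, and \<open>td = 3\<close> matches the
  leading exponent \<open>1/8t\<close> of \<open>q\<close> with \<open>d/24\<close>.
\<close>

locale theta_block =
  fixes t d :: nat and \<psi> :: "int \<Rightarrow> complex"
  assumes index_weight: "t * d = 3"
    and bounded: "exp_bounded \<psi>"
    and antiperiodic: "\<And>n. \<psi> (n + 2 * int t) = - \<psi> n"
    and square: "\<And>n. \<psi> n \<noteq> 0 \<Longrightarrow> 8 * int t dvd n\<^sup>2 - 1"
    and nonzero: "\<And>n. coprime n 6 \<Longrightarrow> \<psi> n \<noteq> 0"
    and modular: "\<And>a b c e \<tau> z. a * e - b * c = 1 \<Longrightarrow> \<tau> \<in> upper_half \<Longrightarrow>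
      theta_series (real t) \<psi> (mobius a b c e \<tau>) (z / (of_int c * \<tau> + of_int e)) =
        eta_mult a b c e ^ d * csqrt (of_int c * \<tau> + of_int e) *
        e2pi (of_nat t * of_int c * z\<^sup>2 / (2 * (of_int c * \<tau> + of_int e))) * theta_series (real t) \<psi> \<tau> z"
begin

lemma t_pos: "t > 0"
  using index_weight by (cases t) auto

lemma odd_support: "\<psi> n \<noteq> 0 \<Longrightarrow> odd n"
proof -
  assume "\<psi> n \<noteq> 0"
  from square[OF this] have "even (n\<^sup>2 - 1)"
    by (rule dvd_trans[rotated]) simp
  then show "odd n" by simp
qed

lemma lattice_law:
  "theta_series (real t) \<psi> \<tau> (z + of_int x * \<tau> + of_int y) =
     e2pi (of_int (x + y) / 2 - of_nat t * ((of_int x)\<^sup>2 * \<tau> / 2 + of_int x * z)) * theta_series (real t) \<psi> \<tau> z"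
proof (rule theta_series_lattice)
  show "t > 0" by (rule t_pos)
  show "\<psi> (n + 2 * int t) = - \<psi> n" for n by (rule antiperiodic)
  show "\<psi> n = 0" if "even n" for n using odd_support that by blast
qed

end

text \<open>
  The constant \<open>s\<close> accommodates the sign by which \<open>\<theta>\<^bsub>A\<^esub>\<close> differs from \<open>\<theta>\<^bsub>D\<^esub>\<close>, and \<open>\<phi>\<close> is only required to agree with
  the product on \<open>L \<otimes> \<complex>\<close>, so that it may be a pullback.
\<close>

locale restricted_theta_product = theta_block t d \<psi>
  for t d :: nat and \<psi> :: "int \<Rightarrow> complex" +
  fixes b :: "'n::finite \<Rightarrow> int" and i0 :: 'n and \<phi> :: "complex \<Rightarrow> complex ^ 'n \<Rightarrow> complex" and s :: complex
  assumes b_nonzero: "b i0 \<noteq> 0" and s_nonzero: "s \<noteq> 0"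
    and \<phi>_eq: "\<And>\<tau> Z. \<tau> \<in> upper_half \<Longrightarrow> Z \<in> complexify (hyperplane_lattice t b) \<Longrightarrow>
      \<phi> \<tau> Z = s * (\<Prod>i\<in>UNIV. theta_series (real t) \<psi> \<tau> (Z $ i))"
begin

abbreviation "L \<equiv> hyperplane_lattice t b"
abbreviation "B \<equiv> ivec b \<bullet> ivec b"

definition char_product :: "('n \<Rightarrow> int) \<Rightarrow> complex" where
  "char_product N = s * (\<Prod>i\<in>UNIV. \<psi> (N i))"

definition projection :: "('n \<Rightarrow> int) \<Rightarrow> real ^ 'n" where
  "projection N = ivec N - ((ivec N \<bullet> ivec b) / B) *\<^sub>R ivec b"

text \<open>
  On \<open>b\<^sup>\<bottom>\<close> the linear form \<open>(N/2, \<cdot>)\<close> is represented, with respect to \<open>t\<close> times the Euclidean form, by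
  the projection of \<open>N/2t\<close>.
\<close>

definition exponent :: "('n \<Rightarrow> int) \<Rightarrow> real \<times> (real ^ 'n)" where
  "exponent N = ((ivec N \<bullet> ivec N) / (8 * real t), (1 / (2 * real t)) *\<^sub>R projection N)"

text \<open>
  The coefficient collects all integer vectors with the given exponent.
\<close>

definition fourier :: "real \<times> (real ^ 'n) \<Rightarrow> complex" where
  "fourier p = infsum char_product {N. char_product N \<noteq> 0 \<and> exponent N = p}"

lemma B_pos: "B > 0"
  using b_nonzero by (auto simp: vec_eq_iff)

lemma char_product_nonzero_iff: "char_product N \<noteq> 0 \<longleftrightarrow> (\<forall>i. \<psi> (N i) \<noteq> 0)"
  using s_nonzero by (simp add: char_product_def)

lemma projection_orthogonal: "projection N \<bullet> ivec b = 0"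
  using B_pos by (simp add: projection_def inner_diff_left)

text \<open>
  Pythagoras: the projection removes from \<open>N\<close> a vector of squared length \<open>(N,b)\<^sup>2/(b,b)\<close>.
\<close>

lemma exponent_norm:
  "2 * fst (exponent N) - form L (snd (exponent N)) (snd (exponent N)) =
     (of_int (\<Sum>i\<in>UNIV. N i * b i))\<^sup>2 / (4 * real t * B)"
proof -
  define a where "a = ivec N \<bullet> ivec N"
  define c where "c = ivec N \<bullet> ivec b"
  have "projection N \<bullet> projection N = projection N \<bullet> ivec N"
    using projection_orthogonal[of N] by (subst (2) projection_def) (simp add: inner_diff_right)
  also have "\<dots> = a - c\<^sup>2 / B"
    by (simp add: projection_def inner_diff_left a_def c_def inner_commute[of "ivec b" "ivec N"] power2_eq_square)
  finally have PP: "projection N \<bullet> projection N = a - c\<^sup>2 / B" .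
  have "2 * fst (exponent N) - form L (snd (exponent N)) (snd (exponent N)) = c\<^sup>2 / (4 * real t * B)"
    using t_pos B_pos by (simp add: exponent_def a_def[symmetric] PP) (simp add: field_simps)
  then show ?thesis by (simp add: c_def inner_ivec)
qed

text \<open>
  The congruence of \<open>n\<close> comes from \<open>N\<^sub>i\<^sup>2 \<equiv> 1\<close> modulo \<open>8t\<close>. The vector lies in the dual lattice because all
  \<open>N\<^sub>i\<close> are odd and the lattice consists of vectors with even coordinate sum.
\<close>

lemma exponent_in_index:
  assumes "char_product N \<noteq> 0" shows "exponent N \<in> fourier_index L (int (d * CARD('n)))"
proof -
  have \<psi>: "\<psi> (N i) \<noteq> 0" for i using assms char_product_nonzero_iff by blast
  have "\<forall>i. \<exists>k. (N i)\<^sup>2 - 1 = 8 * int t * k" using square[OF \<psi>] by (auto elim!: dvdE)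
  then obtain k where k: "\<And>i. (N i)\<^sup>2 = 1 + 8 * int t * k i" by (metis add.commute diff_add_cancel)
  have n: "(ivec N \<bullet> ivec N) / (8 * real t) = of_int (int CARD('n)) / (8 * real t) + of_int (\<Sum>i\<in>UNIV. k i)"
  proof -
    have "(\<Sum>i\<in>UNIV. N i * N i) = int CARD('n) + 8 * int t * (\<Sum>i\<in>UNIV. k i)"
      by (simp add: power2_eq_square[symmetric] k sum.distrib sum_distrib_left)
    then have "ivec N \<bullet> ivec N = of_int (int CARD('n) + 8 * int t * (\<Sum>i\<in>UNIV. k i))"
      unfolding inner_ivec by (simp only:)
    then show ?thesis using t_pos by (simp add: field_simps)
  qed
  have "real t * real d = 3" using index_weight by (metis of_nat_mult of_nat_numeral)
  then have w: "of_int (int CARD('n)) / (8 * real t) = of_int (int (d * CARD('n))) / 24"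
    using t_pos by (simp add: field_simps)
  have "(ivec N \<bullet> ivec N) / (8 * real t) - of_int (int (d * CARD('n))) / 24 = of_int (\<Sum>i\<in>UNIV. k i)"
    unfolding n w by simp
  then have 1: "(ivec N \<bullet> ivec N) / (8 * real t) - of_int (int (d * CARD('n))) / 24 \<in> \<int>"
    by (metis Ints_of_int)
  have 2: "(ivec N \<bullet> ivec N) / (8 * real t) \<in> \<rat>"
    unfolding inner_ivec by (intro Rats_divide) auto
  have 3: "snd (exponent N) \<in> dual_lattice L"
  proof -
    have "snd (exponent N) \<in> span (pts L)"
      unfolding span_hyperplane_lattice[where b = b, OF b_nonzero] by (simp add: exponent_def projection_orthogonal)
    moreover have "form L x (snd (exponent N)) \<in> \<int>" if x: "x \<in> pts L" for x
    proof -
      obtain X where X: "x = ivec X" "even (\<Sum>i\<in>UNIV. X i)" "(\<Sum>i\<in>UNIV. X i * b i) = 0"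
        using x unfolding pts_hyperplane_lattice by blast
      have "x \<bullet> ivec b = 0" using X by (simp add: inner_ivec del: of_int_sum)
      then have "form L x (snd (exponent N)) = x \<bullet> ivec N / 2"
        using t_pos by (simp add: exponent_def projection_def inner_diff_right)
      moreover have "even (\<Sum>i\<in>UNIV. X i * N i)"
        using X(2) odd_support[OF \<psi>] by (subst even_sum_iff[where g = X]) auto
      then obtain j where "(\<Sum>i\<in>UNIV. X i * N i) = 2 * j" by (elim evenE)
      then have "x \<bullet> ivec N / 2 = of_int j" unfolding X(1) inner_ivec by simp
      ultimately show ?thesis by simp
    qed
    ultimately show ?thesis by (simp add: dual_lattice_def)
  qed
  have 4: "2 * fst (exponent N) - form L (snd (exponent N)) (snd (exponent N)) \<ge> 0"
    unfolding exponent_norm using B_pos by simp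
  show ?thesis
    using 1 2 3 4 by (simp add: fourier_index_def exponent_def)
qed

text \<open>
  The part of \<open>N\<close> along \<open>b\<close> does not contribute to the pairing with \<open>Z\<close>, since \<open>Z\<close> is orthogonal to \<open>b\<close>.
\<close>

lemma term_eq:
  assumes Z: "Z \<in> complexify L"
  shows "s * (\<Prod>i\<in>UNIV. theta_term (real t) \<psi> \<tau> (Z $ i) (N i)) =
    char_product N * e2pi (of_real (fst (exponent N)) * \<tau> + cform L (cvec (snd (exponent N))) Z)"
proof -
  define c where "c = (ivec N \<bullet> ivec b) / B"
  have l: "of_real (snd (exponent N) $ i) = (of_int (N i) - of_real c * of_int (b i)) / (2 * of_nat t :: complex)" for i
    by (simp add: exponent_def projection_def c_def)
  have "cform L (cvec (snd (exponent N))) Z = (\<Sum>i\<in>UNIV. of_nat t * (of_real (snd (exponent N) $ i) * Z $ i))"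
    by (simp add: cform_hyperplane_lattice cvec_def sum_distrib_left)
  also have "\<dots> = (\<Sum>i\<in>UNIV. of_int (N i) * Z $ i / 2 - of_real c / 2 * (Z $ i * of_int (b i)))"
    unfolding l using t_pos by (intro sum.cong) (auto simp: field_simps)
  also have "\<dots> = (\<Sum>i\<in>UNIV. of_int (N i) * Z $ i / 2) - of_real c / 2 * (\<Sum>i\<in>UNIV. Z $ i * of_int (b i))"
    by (simp add: sum_subtractf sum_distrib_left)
  finally have l': "cform L (cvec (snd (exponent N))) Z = (\<Sum>i\<in>UNIV. of_int (N i) * Z $ i / 2)"
    unfolding complexify_hyperplane_lattice[OF Z] by simp
  have n': "of_real (fst (exponent N)) * \<tau> = (\<Sum>i\<in>UNIV. (of_int (N i))\<^sup>2 * \<tau> / (8 * of_real (real t)))"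
    by (simp add: exponent_def inner_vec_def power2_eq_square sum_divide_distrib sum_distrib_right)
  show ?thesis
    unfolding n' l' sum.distrib[symmetric] e2pi_sum[OF finite] char_product_def theta_term_def prod.distrib
    by (simp only: mult.assoc)
qed

lemma fourier_expansion: "has_fourier_expansion L (int (d * CARD('n))) \<phi> fourier"
  unfolding has_fourier_expansion_def
proof (intro conjI allI impI ballI)
  fix p assume "p \<notin> fourier_index L (int (d * CARD('n)))"
  then have "{N. char_product N \<noteq> 0 \<and> exponent N = p} = {}" using exponent_in_index by auto
  then show "fourier p = 0" unfolding fourier_def by (simp only: infsum_empty)
next
  fix \<tau> Z assume \<tau>: "\<tau> \<in> upper_half" and Z: "Z \<in> complexify L"
  define E where "E = (\<lambda>p :: real \<times> (real ^ 'n). e2pi (of_real (fst p) * \<tau> + cform L (cvec (snd p)) Z))"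
  have "((\<lambda>N. \<Prod>i\<in>UNIV. theta_term (real t) \<psi> \<tau> (Z $ i) (N i)) has_sum
          (\<Prod>i\<in>UNIV. infsum (theta_term (real t) \<psi> \<tau> (Z $ i)) UNIV)) UNIV"
    using t_pos by (intro has_sum_prod_UNIV theta_term_abs_summable bounded \<tau>) auto
  from has_sum_cmult_right[OF this, of s]
  have "((\<lambda>N. char_product N * E (exponent N)) has_sum \<phi> \<tau> Z) UNIV"
    unfolding term_eq[OF Z] \<phi>_eq[OF \<tau> Z] theta_series_def E_def .
  from has_sum_group_by_exponent[OF this exponent_in_index]
  have "((\<lambda>p. fourier p * E p) has_sum \<phi> \<tau> Z) (fourier_index L (int (d * CARD('n))))"
    unfolding fourier_def .
  then show "((\<lambda>(n, l). fourier (n, l) * exp (2 * pi * \<i> * (of_real n * \<tau> + cform L (cvec l) Z))) has_sum \<phi> \<tau> Z)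
        (fourier_index L (int (d * CARD('n))))"
    by (simp add: E_def e2pi_def case_prod_unfold)
qed

lemma holomorphic: "jacobi_holomorphic L \<phi>"
  unfolding jacobi_holomorphic_def
proof
  fix p assume p: "p \<in> upper_half \<times> complexify L"
  let ?S = "upper_half \<times> complexify L"
  obtain \<tau> Z where p_eq: "p = (\<tau>, Z)" by (cases p)
  then have \<tau>: "\<tau> \<in> upper_half" using p by simp
  have "complex_differentiable_within (\<lambda>x. theta_series (real t) \<psi> (fst x) (snd x $ i)) p ?S" for i
  proof -
    obtain A C where AC: "((\<lambda>(\<tau>, z). theta_series (real t) \<psi> \<tau> z) has_derivative (\<lambda>(s, u). A * s + C * u))
           (at (\<tau>, Z $ i) within upper_half \<times> UNIV)"
      using theta_series_has_derivative[OF _ bounded \<tau>] t_pos by (metis of_nat_0_less_iff)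
    have "((\<lambda>x. (fst x, snd x $ i)) has_derivative (\<lambda>x. (fst x, snd x $ i))) (at p within ?S)"
      by (intro bounded_linear_imp_has_derivative bounded_linear_Pair bounded_linear_fst
            bounded_linear_compose[OF bounded_linear_vec_nth bounded_linear_snd])
    note * = has_derivative_in_compose[OF this, of "\<lambda>(\<tau>, z). theta_series (real t) \<psi> \<tau> z" "\<lambda>(s, u). A * s + C * u"]
    have "((\<lambda>x. theta_series (real t) \<psi> (fst x) (snd x $ i)) has_derivative (\<lambda>x. A * fst x + C * (snd x $ i))) (at p within ?S)"
    proof -
      have "(\<lambda>x. (fst x, snd x $ i)) ` ?S \<subseteq> upper_half \<times> UNIV" by auto
      from has_derivative_subset[OF AC this] show ?thesis
        using * by (simp add: p_eq case_prod_unfold)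
    qed
    then show ?thesis
      unfolding complex_differentiable_within_def
      by (intro exI conjI) (assumption, simp add: algebra_simps)
  qed
  then have "complex_differentiable_within
      (\<lambda>x. s * (\<Prod>i\<in>UNIV. theta_series (real t) \<psi> (fst x) (snd x $ i))) p ?S"
    by (intro complex_differentiable_within_mult complex_differentiable_within_const
          complex_differentiable_within_prod) auto
  then obtain D where D: "((\<lambda>x. s * (\<Prod>i\<in>UNIV. theta_series (real t) \<psi> (fst x) (snd x $ i))) has_derivative D) (at p within ?S)"
    "\<forall>u t Z. D (u * t, u *s Z) = u * D (t, Z)"
    unfolding complex_differentiable_within_def by blast
  have "((\<lambda>(\<tau>, Z). \<phi> \<tau> Z) has_derivative D) (at p within ?S)"
    by (rule has_derivative_transform[OF p _ D(1)]) (auto simp: \<phi>_eq)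
  then show "\<exists>D. ((\<lambda>(\<tau>, Z). \<phi> \<tau> Z) has_derivative D) (at p within ?S) \<and> (\<forall>u t Z. D (u * t, u *s Z) = u * D (t, Z))"
    using D(2) by blast
qed

lemma modular_law:
  assumes det: "a * e - b' * c = 1" and \<tau>: "\<tau> \<in> upper_half" and Z: "Z \<in> complexify L"
  shows "\<phi> (mobius a b' c e \<tau>) (inverse (of_int c * \<tau> + of_int e) *s Z) =
          eta_mult a b' c e powi (int (d * CARD('n))) * (of_int c * \<tau> + of_int e) powr of_real (real CARD('n) / 2) *
          exp (pi * \<i> * of_int c * cform L Z Z / (of_int c * \<tau> + of_int e)) * \<phi> \<tau> Z"
proof -
  define j where "j = of_int c * \<tau> + of_int e"
  have j: "j \<noteq> 0" unfolding j_def by (rule mobius_props(1)[OF det \<tau>])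
  have "\<phi> (mobius a b' c e \<tau>) (inverse j *s Z) =
     s * (\<Prod>i\<in>UNIV. theta_series (real t) \<psi> (mobius a b' c e \<tau>) (Z $ i / j))"
    by (subst \<phi>_eq[OF mobius_props(2)[OF det \<tau>] complexify_scale[OF Z]]) (simp add: divide_inverse mult.commute)
  also have "\<dots> = s * (\<Prod>i\<in>UNIV. (eta_mult a b' c e ^ d * csqrt j) * e2pi (of_nat t * of_int c * (Z $ i)\<^sup>2 / (2 * j)) *
      theta_series (real t) \<psi> \<tau> (Z $ i))"
    unfolding j_def modular[OF det \<tau>] ..
  also have "\<dots> = (eta_mult a b' c e ^ d * csqrt j) ^ CARD('n) *
      e2pi (\<Sum>i\<in>UNIV. of_nat t * of_int c * (Z $ i)\<^sup>2 / (2 * j)) * (s * (\<Prod>i\<in>UNIV. theta_series (real t) \<psi> \<tau> (Z $ i)))"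
    by (simp only: prod.distrib prod_constant e2pi_sum[OF finite] power_mult_distrib mult_ac)
  also have "(\<Sum>i\<in>UNIV. of_nat t * of_int c * (Z $ i)\<^sup>2 / (2 * j)) = of_int c * cform L Z Z / (2 * j)"
    by (simp add: cform_hyperplane_lattice sum_distrib_left sum_divide_distrib power2_eq_square mult_ac)
  also have "e2pi (of_int c * cform L Z Z / (2 * j)) = exp (pi * \<i> * of_int c * cform L Z Z / j)"
    using j unfolding e2pi_def by (intro arg_cong[of _ _ exp]) (simp add: field_simps)
  also have "(eta_mult a b' c e ^ d * csqrt j) ^ CARD('n) = eta_mult a b' c e powi (int (d * CARD('n))) * j powr of_real (real CARD('n) / 2)"
    by (simp only: power_mult_distrib csqrt_power[OF j] power_mult power_int_of_nat)
  finally show ?thesis unfolding \<phi>_eq[OF \<tau> Z] j_def .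
qed

text \<open>
  The signs of the one-variable translation laws multiply to \<open>1\<close> because lattice vectors have even
  coordinate sum.
\<close>

lemma elliptic_law:
  assumes xy: "x \<in> pts L" "y \<in> pts L" and \<tau>: "\<tau> \<in> upper_half" and Z: "Z \<in> complexify L"
  shows "\<phi> \<tau> (Z + \<tau> *s cvec x + cvec y) =
          exp (- pi * \<i> * (of_real (form L x x) * \<tau> + 2 * cform L (cvec x) Z)) * \<phi> \<tau> Z"
proof -
  obtain X Y where X: "x = ivec X" "even (\<Sum>i\<in>UNIV. X i)"
    and Y: "y = ivec Y" "even (\<Sum>i\<in>UNIV. Y i)"
    using xy unfolding pts_hyperplane_lattice by blast
  have Z': "Z + \<tau> *s cvec x + cvec y \<in> complexify L"
    using complexify_shift[OF complexify_shift[OF Z xy(1), of \<tau>] xy(2), of 1] by simp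
  have nth: "(Z + \<tau> *s cvec x + cvec y) $ i = Z $ i + of_int (X i) * \<tau> + of_int (Y i)" for i
    by (simp add: X(1) Y(1) cvec_def)
  have "\<phi> \<tau> (Z + \<tau> *s cvec x + cvec y) = s * (\<Prod>i\<in>UNIV. 
      e2pi (of_int (X i + Y i) / 2 - of_nat t * ((of_int (X i))\<^sup>2 * \<tau> / 2 + of_int (X i) * Z $ i)) *
      theta_series (real t) \<psi> \<tau> (Z $ i))"
    unfolding \<phi>_eq[OF \<tau> Z'] nth
    unfolding lattice_law ..
  also have "\<dots> = e2pi (\<Sum>i\<in>UNIV. of_int (X i + Y i) / 2 - of_nat t * ((of_int (X i))\<^sup>2 * \<tau> / 2 + of_int (X i) * Z $ i)) * \<phi> \<tau> Z"
    unfolding \<phi>_eq[OF \<tau> Z] prod.distrib e2pi_sum[OF finite] by (simp only: mult_ac)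
  also have "(\<Sum>i\<in>UNIV. of_int (X i + Y i) / 2 - of_nat t * ((of_int (X i))\<^sup>2 * \<tau> / 2 + of_int (X i) * Z $ i)) =
     of_int (\<Sum>i\<in>UNIV. X i + Y i) / 2 + - (of_real (form L x x) * \<tau> / 2 + cform L (cvec x) Z)"
  proof -
    have split: "(\<Sum>i\<in>UNIV. F i - of_nat t * (G i + H i)) = sum F UNIV - of_nat t * (sum G UNIV + sum H UNIV)"
      for F G H :: "'n \<Rightarrow> complex"
      by (simp only: sum_subtractf sum.distrib sum_distrib_left[symmetric])
    have 1: "of_real (form L x x) * \<tau> / 2 = of_nat t * (\<Sum>i\<in>UNIV. (of_int (X i))\<^sup>2 * \<tau> / 2)"
      by (simp add: X(1) inner_ivec power2_eq_square sum_distrib_right sum_divide_distrib)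
    have 2: "cform L (cvec x) Z = of_nat t * (\<Sum>i\<in>UNIV. of_int (X i) * Z $ i)"
      by (simp add: cform_hyperplane_lattice cvec_def X(1))
    have 3: "(\<Sum>i\<in>UNIV. of_int (X i + Y i) / 2 :: complex) = of_int (\<Sum>i\<in>UNIV. X i + Y i) / 2"
      by (simp only: of_int_sum sum_divide_distrib)
    show ?thesis unfolding split 1 2 3 by (simp only: distrib_left diff_conv_add_uminus)
  qed
  also have "e2pi (of_int (\<Sum>i\<in>UNIV. X i + Y i) / 2 + - (of_real (form L x x) * \<tau> / 2 + cform L (cvec x) Z)) =
     e2pi (- (of_real (form L x x) * \<tau> / 2 + cform L (cvec x) Z))"
    using X(2) Y(2) by (simp only: e2pi_add[of "of_int _ / 2"] e2pi_half_int sum.distrib) simp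
  also have "\<dots> = exp (- pi * \<i> * (of_real (form L x x) * \<tau> + 2 * cform L (cvec x) Z))"
    unfolding e2pi_def by (intro arg_cong[of _ _ exp]) (simp add: field_simps)
  finally show ?thesis .
qed

theorem jacobi_form: "\<phi> \<in> jacobi_forms (real CARD('n) / 2) L (int (d * CARD('n)))"
  unfolding jacobi_forms_def
  using even_lattice_hyperplane_lattice[OF t_pos] holomorphic modular_law elliptic_law fourier_expansion
  by blast

lemma fourier_coeff: "fourier_coeff L (int (d * CARD('n))) \<phi> = fourier"
  by (rule fourier_coeff_eq[OF even_lattice_hyperplane_lattice[OF t_pos] fourier_expansion])

lemma fourier_nonzeroE:
  assumes "fourier p \<noteq> 0" obtains N where "char_product N \<noteq> 0" "exponent N = p"
proof -
  have "{N. char_product N \<noteq> 0 \<and> exponent N = p} \<noteq> {}"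
  proof
    assume "{N. char_product N \<noteq> 0 \<and> exponent N = p} = {}"
    then have "fourier p = 0" unfolding fourier_def by (simp only: infsum_empty)
    then show False using assms by simp
  qed
  then show ?thesis using that by blast
qed

context
  assumes gcd: "Gcd (range b) = 1" and odd_sum: "odd (\<Sum>i\<in>UNIV. b i)" and two: "card {i. b i \<noteq> 0} \<ge> 2"
begin

text \<open>
  Modulo 2 the number \<open>(N,b)\<close> is the sum of the \<open>b\<^sub>i\<close>, so it is odd and its square is at least 1.
\<close>

lemma norm_lower_bound:
  assumes "fourier (n, l) \<noteq> 0" shows "2 * n - form L l l \<ge> 1 / (4 * real t * B)"
proof -
  obtain N where N: "char_product N \<noteq> 0" "exponent N = (n, l)" using fourier_nonzeroE[OF assms] .
  define k where "k = (\<Sum>i\<in>UNIV. N i * b i)"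
  have "even k \<longleftrightarrow> even (\<Sum>i\<in>UNIV. b i)"
    unfolding k_def by (rule even_sum_iff) (use N(1) odd_support in \<open>auto simp: char_product_nonzero_iff\<close>)
  then have "k \<noteq> 0" using odd_sum by auto
  then have "1 \<le> k\<^sup>2" by (simp add: int_one_le_iff_zero_less)
  then have "1 \<le> (of_int k :: real)\<^sup>2" by (metis of_int_1 of_int_le_iff of_int_power)
  then have "1 / (4 * real t * B) \<le> (of_int k)\<^sup>2 / (4 * real t * B)"
    using B_pos by (intro divide_right_mono) auto
  then show ?thesis using exponent_norm[of N] by (simp add: N(2) k_def)
qed

text \<open>
  A second vector with the same exponent has the same projection and satisfies \<open>(N',b) = \<plusminus>1\<close>. The sign \<open>+\<close>
  forces \<open>N' = N\<close>, and the sign \<open>-\<close> would make \<open>N'\<close> the mirror image of \<open>N\<close>.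
\<close>

lemma minimal_exponent_coeff:
  assumes N: "(\<Sum>i\<in>UNIV. N i * b i) = 1" "\<And>i. coprime (N i) 6"
  shows "fourier (exponent N) \<noteq> 0"
proof -
  have cN: "char_product N \<noteq> 0" using nonzero[OF N(2)] by (simp add: char_product_nonzero_iff)
  have "N' = N" if N': "exponent N' = exponent N" for N'
  proof -
    define k where "k = (\<Sum>i\<in>UNIV. N' i * b i)"
    have "(of_int k)\<^sup>2 / (4 * real t * B) = 1 / (4 * real t * B)"
      using exponent_norm[of N] exponent_norm[of N'] by (simp add: N' N(1) k_def)
    then have "(of_int k)\<^sup>2 = (1::real)" using B_pos t_pos by (simp add: divide_cancel_right)
    then have "k\<^sup>2 = 1" by (metis of_int_eq_1_iff of_int_power)
    then have k: "k = 1 \<or> k = - 1" by (simp add: power2_eq_1_iff)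
    have "projection N' = projection N" using N' t_pos by (simp add: exponent_def)
    then have "ivec N' - ivec N = ((of_int k - 1) / B) *\<^sub>R ivec b"
      by (simp add: projection_def inner_ivec N(1) k_def[symmetric] diff_divide_distrib scaleR_diff_left algebra_simps del: of_int_sum)
    then have "(ivec N' - ivec N) $ i = (((of_int k - 1) / B) *\<^sub>R ivec b) $ i" for i by (rule arg_cong)
    then have eq: "B * (of_int (N' i) - of_int (N i)) = (of_int k - 1) * of_int (b i)" for i
      using B_pos by (simp add: field_simps)
    have eq': "(\<Sum>i\<in>UNIV. (b i)\<^sup>2) * (N' i - N i) = (k - 1) * b i" for i
    proof -
      have "of_int ((\<Sum>i\<in>UNIV. (b i)\<^sup>2) * (N' i - N i)) = (of_int ((k - 1) * b i) :: real)"
        using eq[of i] by (simp add: inner_ivec power2_eq_square)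
      then show ?thesis by (simp only: of_int_eq_iff)
    qed
    have "k \<noteq> - 1"
    proof
      assume "k = - 1"
      then show False using eq' by (intro reflection_not_integral[OF gcd odd_sum two, of N' N]) simp
    qed
    then have "k = 1" using k by blast
    then have "B * (of_int (N' i) - of_int (N i)) = 0" for i using eq by simp
    then show "N' = N" using B_pos by (simp add: fun_eq_iff)
  qed
  then have "{N'. char_product N' \<noteq> 0 \<and> exponent N' = exponent N} = {N}" using cN by auto
  then show ?thesis using cN by (simp add: fourier_def)
qed

theorem cusp_form: "\<phi> \<in> jacobi_cusp_forms (real CARD('n) / 2) L (int (d * CARD('n)))"
proof -
  have "1 / (4 * real t * B) > 0" using B_pos t_pos by simp
  then have "2 * n - form L l l > 0" if "fourier (n, l) \<noteq> 0" for n l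
    using norm_lower_bound[OF that] by (rule less_le_trans)
  then show ?thesis
    unfolding jacobi_cusp_forms_def mem_Collect_eq fourier_coeff using jacobi_form by blast
qed

theorem order_eq: "Ord L (int (d * CARD('n))) \<phi> = 1 / (4 * real t * B)"
  unfolding Ord_def fourier_coeff
proof (rule Least_equality)
  obtain N where N: "(\<Sum>i\<in>UNIV. N i * b i) = 1" "\<And>i. coprime (N i) 6"
    using exists_coprime_6_solution[OF gcd odd_sum] by metis
  have "fourier (fst (exponent N), snd (exponent N)) \<noteq> 0" using minimal_exponent_coeff[OF N] by simp
  moreover have "1 / (4 * real t * B) = 2 * fst (exponent N) - form L (snd (exponent N)) (snd (exponent N))"
    unfolding exponent_norm N(1) by simp
  ultimately show "\<exists>n l. fourier (n, l) \<noteq> 0 \<and> 1 / (4 * real t * B) = 2 * n - form L l l" by blast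
next
  fix r assume "\<exists>n l. fourier (n, l) \<noteq> 0 \<and> r = 2 * n - form L l l"
  then show "1 / (4 * real t * B) \<le> r" using norm_lower_bound by blast
qed

text \<open>
  Otherwise the zero coefficients would form a second Fourier expansion.
\<close>

theorem nonzero_form: "nonzero_on L \<phi>"
proof (rule ccontr)
  assume "\<not> nonzero_on L \<phi>"
  then have "\<phi> \<tau> Z = 0" if "\<tau> \<in> upper_half" "Z \<in> complexify L" for \<tau> Z
    using that by (auto simp: nonzero_on_def)
  then have "has_fourier_expansion L (int (d * CARD('n))) \<phi> (\<lambda>_. 0)"
    by (simp add: has_fourier_expansion_def case_prod_unfold)
  then have "fourier = (\<lambda>_. 0)"
    by (rule fourier_expansion_unique[OF even_lattice_hyperplane_lattice[OF t_pos] fourier_expansion])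
  moreover obtain N where N: "(\<Sum>i\<in>UNIV. N i * b i) = 1" "\<And>i. coprime (N i) 6"
    using exists_coprime_6_solution[OF gcd odd_sum] by metis
  ultimately show False using minimal_exponent_coeff[OF N] by simp
qed

end

end

section \<open>The lattices \<open>v\<^sup>\<bottom>\<close> and \<open>A\<^sub>m\<close>\<close>

lemma kronecker_m4_square: "kronecker_m4 n \<noteq> 0 \<Longrightarrow> 8 * int 1 dvd n\<^sup>2 - 1"
proof -
  assume "kronecker_m4 n \<noteq> 0"
  then have "odd n" using kronecker_m4_even by blast
  then obtain k where n: "n = 2 * k + 1" by (elim oddE)
  have "even (k * (k + 1))" by simp
  then obtain l where l: "k * (k + 1) = 2 * l" by (elim evenE)
  have "n\<^sup>2 - 1 = 4 * (k * (k + 1))" by (simp add: n power2_eq_square algebra_simps)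
  also have "\<dots> = 8 * l" unfolding l by simp
  finally show ?thesis by simp
qed

lemma chi12_square: "chi12 n \<noteq> 0 \<Longrightarrow> 8 * int 3 dvd n\<^sup>2 - 1"
proof -
  assume nz: "chi12 n \<noteq> 0"
  obtain k r where n: "n = r + 12 * k" and r: "r \<in> {0, 1, 2, 3, 4, 5, 6, 7, 8, 9, 10, 11}"
    using residue_12 by blast
  have "chi12 r \<noteq> 0" using nz unfolding n chi12_periodic .
  then have "24 dvd r\<^sup>2 - 1" using r by (auto simp: chi12_def)
  then have "24 dvd (r\<^sup>2 - 1) + 24 * (k * r + 6 * k\<^sup>2)" by (rule dvd_add) simp
  also have "(r\<^sup>2 - 1) + 24 * (k * r + 6 * k\<^sup>2) = n\<^sup>2 - 1"
    by (simp add: n power2_eq_square algebra_simps)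
  finally show ?thesis by simp
qed

lemma coprime_6_cases:
  fixes n :: int assumes "coprime n 6" shows "odd n" "\<not> 3 dvd n"
proof -
  have "\<not> 2 dvd n" "\<not> 3 dvd n"
    using coprime_common_divisor[OF assms, of 2] coprime_common_divisor[OF assms, of 3] by auto
  then show "odd n" "\<not> 3 dvd n" by auto
qed

lemma kronecker_m4_nonzero: "odd n \<Longrightarrow> kronecker_m4 n \<noteq> 0"
proof -
  assume "odd n"
  then have "n mod 4 = 1 \<or> n mod 4 = 3" by presburger
  then show ?thesis by (auto simp: kronecker_m4_def)
qed

lemma chi12_nonzero: "coprime n 6 \<Longrightarrow> chi12 n \<noteq> 0"
proof -
  assume "coprime n 6"
  then have c: "odd n" "\<not> 3 dvd n" by (rule coprime_6_cases)+
  obtain k r where n: "n = r + 12 * k" and r: "r \<in> {0, 1, 2, 3, 4, 5, 6, 7, 8, 9, 10, 11}"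
    using residue_12 by blast
  have "odd r" using c(1) by (simp add: n)
  moreover have "\<not> 3 dvd r"
  proof
    assume "3 dvd r"
    then have "3 dvd r + 12 * k" by (intro dvd_add) auto
    then show False using c(2) n by simp
  qed
  ultimately have "chi12 r \<noteq> 0" using r by (auto simp: chi12_def)
  then show ?thesis unfolding n chi12_periodic .
qed

interpretation jtheta_block: theta_block 1 3 kronecker_m4
proof
  show "kronecker_m4 n \<noteq> 0" if "coprime n 6" for n
    using coprime_6_cases(1)[OF that] by (rule kronecker_m4_nonzero)
  fix a b c e :: int and \<tau> z :: complex
  assume "a * e - b * c = 1" "\<tau> \<in> upper_half"
  from jtheta_modular_eta_mult[OF this, of z]
  show "theta_series (real 1) kronecker_m4 (mobius a b c e \<tau>) (z / (of_int c * \<tau> + of_int e)) =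
        eta_mult a b c e ^ 3 * csqrt (of_int c * \<tau> + of_int e) *
        e2pi (of_nat 1 * of_int c * z\<^sup>2 / (2 * (of_int c * \<tau> + of_int e))) * theta_series (real 1) kronecker_m4 \<tau> z"
    by (simp add: jtheta_eq_theta_series)
qed (use exp_bounded_kronecker_m4 kronecker_m4_add2 kronecker_m4_square in auto)

interpretation theta32_block: theta_block 3 1 chi12
proof
  show "8 * int 3 dvd n\<^sup>2 - 1" if "chi12 n \<noteq> 0" for n using chi12_square[OF that] .
  show "chi12 (n + 2 * int 3) = - chi12 n" for n by (rule chi12_add6)
  fix a b c e :: int and \<tau> z :: complex
  assume "a * e - b * c = 1" "\<tau> \<in> upper_half"
  from theta32_modular[OF this, of z]
  show "theta_series (real 3) chi12 (mobius a b c e \<tau>) (z / (of_int c * \<tau> + of_int e)) =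
        eta_mult a b c e ^ 1 * csqrt (of_int c * \<tau> + of_int e) *
        e2pi (of_nat 3 * of_int c * z\<^sup>2 / (2 * (of_int c * \<tau> + of_int e))) * theta_series (real 3) chi12 \<tau> z"
    by (simp add: theta32_def)
qed (use exp_bounded_chi12 chi12_nonzero in auto)

lemma orth_compl_D_lattice:
  fixes b :: "'n::finite \<Rightarrow> int"
  assumes "v = (\<chi> i. 2 * of_int (b i))"
  shows "orth_compl D_lattice v = hyperplane_lattice 1 b"
    "orth_compl (rescale 3 D_lattice) v = hyperplane_lattice 3 b"
    "v \<bullet> v = 4 * (ivec b \<bullet> ivec b)"
proof -
  have v: "v = 2 *\<^sub>R ivec b" by (simp add: assms vec_eq_iff)
  show "orth_compl D_lattice v = hyperplane_lattice 1 b"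
    "orth_compl (rescale 3 D_lattice) v = hyperplane_lattice 3 b"
    "v \<bullet> v = 4 * (ivec b \<bullet> ivec b)"
    by (simp_all add: orth_compl_def rescale_def hyperplane_lattice_def D_lattice_def v)
qed

text \<open>
  A vanishing coordinate sum is in particular even.
\<close>

lemma A_lattice_eq:
  "(A_lattice :: ('m::finite) option form_lattice) = hyperplane_lattice 1 (\<lambda>_. 1)"
  "rescale 3 (A_lattice :: ('m::finite) option form_lattice) = hyperplane_lattice 3 (\<lambda>_. 1)"
proof -
  have "(\<exists>j::int. (\<Sum>i\<in>UNIV. x $ i) = 2 * of_int j) \<and> x \<bullet> ivec (\<lambda>_. 1) = 0 \<longleftrightarrow> (\<Sum>i\<in>UNIV. x $ i) = 0"
    for x :: "real ^ 'm option"
    by (auto simp: inner_vec_def intro: exI[of _ 0])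
  then show "(A_lattice :: ('m::finite) option form_lattice) = hyperplane_lattice 1 (\<lambda>_. 1)"
    "rescale 3 (A_lattice :: ('m::finite) option form_lattice) = hyperplane_lattice 3 (\<lambda>_. 1)"
    by (simp_all add: A_lattice_def rescale_def hyperplane_lattice_def D_lattice_def conj_assoc)
qed

lemma prod_UNIV_option:
  fixes f :: "('m::finite) option \<Rightarrow> complex"
  shows "(\<Prod>i\<in>UNIV. f i) = f None * (\<Prod>i\<in>UNIV. f (Some i))"
  by (simp add: UNIV_option_conv prod.reindex)

lemma sum_UNIV_option:
  fixes f :: "('m::finite) option \<Rightarrow> complex"
  shows "(\<Sum>i\<in>UNIV. f i) = f None + (\<Sum>i\<in>UNIV. f (Some i))"
  by (simp add: UNIV_option_conv sum.reindex)

lemma card_UNIV_option: "CARD('m option) = CARD('m::finite) + 1"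
  by (simp add: UNIV_option_conv card_image)

lemma None_coordinate:
  assumes "Z \<in> complexify (hyperplane_lattice t (\<lambda>_ :: ('m::finite) option. 1))"
  shows "Z $ None = - (\<Sum>i\<in>UNIV. Z $ Some i)"
  using complexify_hyperplane_lattice[OF assms] by (simp add: sum_UNIV_option add_eq_0_iff)

lemma restricted_theta_D:
  fixes b :: "'n::finite \<Rightarrow> int" assumes "b i0 \<noteq> 0"
  shows "restricted_theta_product 1 3 kronecker_m4 b i0 (pullback theta_D (hyperplane_lattice 1 b)) 1"
  by unfold_locales (use assms in \<open>auto simp: pullback_def theta_D_def jtheta_eq_theta_series\<close>)

lemma restricted_theta_D3:
  fixes b :: "'n::finite \<Rightarrow> int" assumes "b i0 \<noteq> 0"
  shows "restricted_theta_product 3 1 chi12 b i0 (pullback theta_D3 (hyperplane_lattice 3 b)) 1"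
  by unfold_locales
     (use assms in \<open>auto simp: pullback_def theta_D3_def jtheta32_eq_theta32 theta32_def\<close>)

text \<open>
  The last coordinate is minus the sum of the others, and \<open>\<theta>\<close> is odd: hence the sign.
\<close>

lemma restricted_theta_A:
  "restricted_theta_product 1 3 kronecker_m4 (\<lambda>_ :: ('m::finite) option. 1) None theta_A (- 1)"
proof unfold_locales
  fix \<tau> and Z :: "complex ^ 'm option"
  assume "Z \<in> complexify (hyperplane_lattice 1 (\<lambda>_. 1))"
  then have "Z $ None = - (\<Sum>i\<in>UNIV. Z $ Some i)" by (rule None_coordinate)
  then show "theta_A \<tau> Z = - 1 * (\<Prod>i\<in>UNIV. theta_series (real 1) kronecker_m4 \<tau> (Z $ i))"
    by (simp add: theta_A_def prod_UNIV_option jtheta_uminus flip: jtheta_eq_theta_series)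
qed auto

lemma restricted_theta_A3:
  "restricted_theta_product 3 1 chi12 (\<lambda>_ :: ('m::finite) option. 1) None theta_A3 1"
proof unfold_locales
  fix \<tau> and Z :: "complex ^ 'm option"
  assume \<tau>: "\<tau> \<in> upper_half" and "Z \<in> complexify (hyperplane_lattice 3 (\<lambda>_. 1))"
  then have "Z $ None = - (\<Sum>i\<in>UNIV. Z $ Some i)" by (intro None_coordinate)
  then show "theta_A3 \<tau> Z = 1 * (\<Prod>i\<in>UNIV. theta_series (real 3) chi12 \<tau> (Z $ i))"
    using \<tau> by (simp add: theta_A3_def prod_UNIV_option jtheta32_eq_theta32 theta32_uminus mult.commute flip: theta32_def)
qed auto

text \<open>
  With \<open>v = 2b\<close> the bound \<open>1/4t(b,b)\<close> reads \<open>1/t(v,v)\<close>.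
\<close>

lemma theta_D_restrictions:
  fixes b :: "'m::finite \<Rightarrow> int" and v :: "real ^ 'm"
  defines "L \<equiv> orth_compl D_lattice v" and "L3 \<equiv> orth_compl (rescale 3 D_lattice) v"
  assumes v: "v = (\<chi> i. 2 * of_int (b i))" and two: "card {i. b i \<noteq> 0} \<ge> 2"
    and "(\<Sum>i\<in>UNIV. b i) mod 2 = 1" and gcd: "Gcd (range b) = 1"
  shows "v \<bullet> v = 4 * (\<Sum>i\<in>UNIV. (of_int (b i))\<^sup>2) \<and>
     pullback theta_D L \<in> jacobi_cusp_forms (real CARD('m) / 2) L (3 * int CARD('m)) \<and>
     nonzero_on L (pullback theta_D L) \<and>
     real CARD('m) / 2 = critical_weight L \<and>
     Ord L (3 * int CARD('m)) (pullback theta_D L) = 1 / (v \<bullet> v) \<and>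
     1 / (v \<bullet> v) > 0 \<and>
     pullback theta_D3 L3 \<in> jacobi_cusp_forms (real CARD('m) / 2) L3 (int CARD('m)) \<and>
     nonzero_on L3 (pullback theta_D3 L3) \<and>
     real CARD('m) / 2 = critical_weight L3 \<and>
     Ord L3 (int CARD('m)) (pullback theta_D3 L3) = 1 / (3 * (v \<bullet> v)) \<and>
     1 / (3 * (v \<bullet> v)) > 0"
proof -
  have odd: "odd (\<Sum>i\<in>UNIV. b i)" using \<open>(\<Sum>i\<in>UNIV. b i) mod 2 = 1\<close> by presburger
  have "{i. b i \<noteq> 0} \<noteq> {}" using two by (intro notI) simp
  then obtain i0 where i0: "b i0 \<noteq> 0" by blast
  interpret D: restricted_theta_product 1 3 kronecker_m4 b i0 "pullback theta_D (hyperplane_lattice 1 b)" 1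
    by (rule restricted_theta_D[where b = b, OF i0])
  interpret D3: restricted_theta_product 3 1 chi12 b i0 "pullback theta_D3 (hyperplane_lattice 3 b)" 1
    by (rule restricted_theta_D3[where b = b, OF i0])
  have vv: "v \<bullet> v = 4 * (ivec b \<bullet> ivec b)" by (rule orth_compl_D_lattice(3)[OF v])
  moreover have "ivec b \<bullet> ivec b = (\<Sum>i\<in>UNIV. (of_int (b i))\<^sup>2)"
    by (simp add: inner_vec_def power2_eq_square)
  moreover note D.cusp_form[OF gcd odd two] D.nonzero_form[OF gcd odd two] D.order_eq[OF gcd odd two]
    D3.cusp_form[OF gcd odd two] D3.nonzero_form[OF gcd odd two] D3.order_eq[OF gcd odd two]
    critical_weight_hyperplane_lattice[where b = b, OF i0] D.B_pos
  ultimately show ?thesis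
    unfolding L_def L3_def orth_compl_D_lattice(1,2)[OF v] vv by simp
qed

text \<open>
  For even \<open>m\<close> the vector \<open>(1, \<dots>, 1)\<close> has odd coordinate sum \<open>m + 1\<close>, which is also its norm, and at least
  two non-zero entries.
\<close>

lemma theta_A_forms:
  defines "A \<equiv> (A_lattice :: ('m::finite) option form_lattice)"
  defines "A3 \<equiv> rescale 3 A"
  shows "theta_A \<in> jacobi_forms ((real CARD('m) + 1) / 2) A (3 * int CARD('m) + 3)"
    and "critical_weight A = (real CARD('m) + 1) / 2"
    and "theta_A3 \<in> jacobi_forms ((real CARD('m) + 1) / 2) A3 (int CARD('m) + 1)"
    and "even CARD('m) \<Longrightarrow> theta_A \<in> jacobi_cusp_forms ((real CARD('m) + 1) / 2) A (3 * int CARD('m) + 3)"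
    and "even CARD('m) \<Longrightarrow> Ord A (3 * int CARD('m) + 3) theta_A = 1 / (4 * (real CARD('m) + 1))"
    and "even CARD('m) \<Longrightarrow> Ord A3 (int CARD('m) + 1) theta_A3 = 1 / (12 * (real CARD('m) + 1))"
proof -
  let ?one = "\<lambda>_ :: 'm option. 1 :: int"
  have gcd: "Gcd (range ?one) = 1" by simp
  have two: "card {i. ?one i \<noteq> 0} \<ge> 2"
    using zero_less_card_finite[where 'a = 'm] by (simp add: card_UNIV_option)
  have odd: "odd (\<Sum>i\<in>UNIV. ?one i)" if "even CARD('m)"
    using that by (simp add: card_UNIV_option)
  have B: "ivec ?one \<bullet> ivec ?one = real CARD('m) + 1"
    by (simp add: inner_ivec card_UNIV_option)
  interpret A: restricted_theta_product 1 3 kronecker_m4 ?one None theta_A "- 1"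
    by (rule restricted_theta_A)
  interpret A3: restricted_theta_product 3 1 chi12 ?one None theta_A3 1
    by (rule restricted_theta_A3)
  have N: "int (3 * CARD('m option)) = 3 * int CARD('m) + 3" "int (1 * CARD('m option)) = int CARD('m) + 1"
    and w: "real CARD('m option) / 2 = (real CARD('m) + 1) / 2"
    by (simp_all add: card_UNIV_option)
  have eq: "A = hyperplane_lattice 1 ?one" "A3 = hyperplane_lattice 3 ?one"
    by (simp_all only: A3_def A_def A_lattice_eq(2)) (simp only: A_lattice_eq(1))
  show "theta_A \<in> jacobi_forms ((real CARD('m) + 1) / 2) A (3 * int CARD('m) + 3)"
    using A.jacobi_form unfolding eq N w .
  show "critical_weight A = (real CARD('m) + 1) / 2"
    using critical_weight_hyperplane_lattice[of ?one None 1] unfolding eq w by simp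
  show "theta_A3 \<in> jacobi_forms ((real CARD('m) + 1) / 2) A3 (int CARD('m) + 1)"
    using A3.jacobi_form unfolding eq N w .
  assume "even CARD('m)"
  note odd = odd[OF this]
  show "theta_A \<in> jacobi_cusp_forms ((real CARD('m) + 1) / 2) A (3 * int CARD('m) + 3)"
    using A.cusp_form[OF gcd odd two] unfolding eq N w .
  show "Ord A (3 * int CARD('m) + 3) theta_A = 1 / (4 * (real CARD('m) + 1))"
    using A.order_eq[OF gcd odd two] unfolding eq N B by simp
  show "Ord A3 (int CARD('m) + 1) theta_A3 = 1 / (12 * (real CARD('m) + 1))"
    using A3.order_eq[OF gcd odd two] unfolding eq N B by simp
qed

theorem proposition3p3:
  shows
    "(\<forall>(b :: 'm::finite \<Rightarrow> int) (v :: real ^ 'm).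
        v = (\<chi> i. 2 * of_int (b i)) \<and> v \<in> pts D_lattice \<and>
        card {i. b i \<noteq> 0} \<ge> 2 \<and> (\<Sum>i\<in>UNIV. b i) mod 2 = 1 \<and> Gcd (range b) = 1 \<longrightarrow>
        (let m = CARD('m);
             L = orth_compl D_lattice v;
             L3 = orth_compl (rescale 3 D_lattice) v
         in v \<bullet> v = 4 * (\<Sum>i\<in>UNIV. (of_int (b i))\<^sup>2) \<and>
            pullback theta_D L \<in> jacobi_cusp_forms (real m / 2) L (3 * int m) \<and>
            nonzero_on L (pullback theta_D L) \<and>
            real m / 2 = critical_weight L \<and>
            Ord L (3 * int m) (pullback theta_D L) = 1 / (v \<bullet> v) \<and>
            1 / (v \<bullet> v) > 0 \<and>
            pullback theta_D3 L3 \<in> jacobi_cusp_forms (real m / 2) L3 (int m) \<and>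
            nonzero_on L3 (pullback theta_D3 L3) \<and>
            real m / 2 = critical_weight L3 \<and>
            Ord L3 (int m) (pullback theta_D3 L3) = 1 / (3 * (v \<bullet> v)) \<and>
            1 / (3 * (v \<bullet> v)) > 0))
     \<and>
     (let m = CARD('m);
          A = (A_lattice :: 'm option form_lattice)
      in theta_A \<in> jacobi_forms ((real m + 1) / 2) A (3 * int m + 3) \<and>
         (real m + 1) / 2 = critical_weight A \<and>
         (even m \<longrightarrow>
            theta_A \<in> jacobi_cusp_forms ((real m + 1) / 2) A (3 * int m + 3) \<and>
            Ord A (3 * int m + 3) theta_A = 1 / (4 * (real m + 1)) \<and>
            1 / (4 * (real m + 1)) > 0))
     \<and>
     (let m = CARD('m);
          A3 = rescale 3 (A_lattice :: 'm option form_lattice)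
      in theta_A3 \<in> jacobi_forms ((real m + 1) / 2) A3 (int m + 1) \<and>
         (even m \<longrightarrow>
            Ord A3 (int m + 1) theta_A3 = 1 / (12 * (real m + 1)) \<and>
            1 / (12 * (real m + 1)) > 0))"
proof (intro conjI allI impI, goal_cases)
  case (1 b v)
  then show ?case unfolding Let_def by (intro theta_D_restrictions) auto
next
  case 2
  show ?case unfolding Let_def using theta_A_forms(1,2,4,5)[where 'm = 'm] by simp
next
  case 3
  show ?case unfolding Let_def using theta_A_forms(3,6)[where 'm = 'm] by simp
qed

end
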